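(* Let $\mathcal{H}$ be an infinite-dimensional Hilbert space, let $E\subset c_0$ be a symmetrically normed sequence space, and let $C_E$ be the corresponding operator ideal in $B(\mathcal{H})$. For any self-adjoint operators $a,b\in C_E$, the generalized derivation $\delta_{a,b}:B(\mathcal{H})\to C_E$, $\delta_{a,b}(x)=ax-xb$, satisfies $$\|\delta_{a,b}\|_{B(\mathcal{H})\to C_E}=\big\|\,(\mu(a_+)+\mu(b_-))\oplus(\mu(b_+)+\mu(a_-))\,\big\|_{E}.$$
   Context: $B(\mathcal{H})$ is the algebra of bounded linear operators on $\mathcal{H}$ with operator norm. For a compact operator $x$, $\mu(x)=(\mu_1(x),\mu_2(x),\dots)$ is the decreasing sequence of its singular values (with multiplicity); for a sequence $x\in c_0$, $\mu(x)$ is the decreasing rearrangement of $|x|$. For self-adjoint $a$, $a_+$ and $a_-$ denote the positive and negative parts ($a=a_+-a_-$, $a_\pm\ge 0$, $a_+a_-=0$). A symmetrically normed sequence space $E\subset c_0$ is a linear subspace of $c_0$ equipped with a norm $\|\cdot\|_E$ (not assumed complete) such that $x\in E$, $y\in c_0$ and $\mu(y)\le\mu(x)$ imply $y\in E$ and $\|y\|_E\le\|x\|_E$. The corresponding ideal is $C_E=\{x\in B(\mathcal{H}) \text{ compact}:\mu(x)\in E\}$ with norm $\|x\|_{C_E}=\|\mu(x)\|_E$. For sequences $f,g\in\ell_\infty$, $f\oplus g\in\ell_\infty\oplus\ell_\infty$ is identified with an element of $\ell_\infty$ (the sequence consisting of all entries of $f$ together with all entries of $g$, via a bijection $\mathbb{N}\sqcup\mathbb{N}\cong\mathbb{N}$;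 the $E$-norm does not depend on the choice of bijection). $\|\delta_{a,b}\|_{B(\mathcal{H})\to C_E}=\sup\{\|ax-xb\|_{C_E}:x\in B(\mathcal{H}),\ \|x\|\le 1\}$. *)

theory Defs
  imports "HOL-Analysis.Analysis" "HOL-Library.Nat_Bijection"
begin

(* Complex Hilbert spaces; the inner product is linear in its first argument. *)
class complex_hilbert = banach +
  fixes scaleC :: "complex \<Rightarrow> 'a \<Rightarrow> 'a"  (infixr "*\<^sub>C" 75)
    and cinner :: "'a \<Rightarrow> 'a \<Rightarrow> complex"
  assumes scaleC_add_right: "c *\<^sub>C (x + y) = c *\<^sub>C x + c *\<^sub>C y"
    and scaleC_add_left: "(c + d) *\<^sub>C x = c *\<^sub>C x + d *\<^sub>C x"
    and scaleC_scaleC: "c *\<^sub>C d *\<^sub>C x = (c * d) *\<^sub>C x"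
    and scaleC_of_real: "complex_of_real r *\<^sub>C x = r *\<^sub>R x"
    and cinner_commute: "cinner x y = cnj (cinner y x)"
    and cinner_add_left: "cinner (x + y) z = cinner x z + cinner y z"
    and cinner_scaleC_left: "cinner (c *\<^sub>C x) y = c * cinner x y"
    and norm_eq_sqrt_cinner: "norm x = sqrt (Re (cinner x x))"

interpretation complex_vector:
  vector_space "scaleC :: complex \<Rightarrow> 'a \<Rightarrow> 'a::complex_hilbert"
proof
  show "1 *\<^sub>C x = x" for x :: 'a
    using scaleC_of_real[of 1 x] by simp
qed (simp_all add: scaleC_add_right scaleC_add_left scaleC_scaleC)

definition infinite_dimensional :: "'a::complex_hilbert itself \<Rightarrow> bool" where
  "infinite_dimensional _ \<longleftrightarrow>
     \<not> (\<exists>B::'a set. finite B \<and> complex_vector.span B = UNIV)"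

(* B(H): the complex-linear elements of the library's type of bounded real-linear maps,
   whose norm is the operator norm. *)
definition bounded_ops :: "('a::complex_hilbert \<Rightarrow>\<^sub>L 'a) set" where
  "bounded_ops = {T. \<forall>c x. blinfun_apply T (c *\<^sub>C x) = c *\<^sub>C blinfun_apply T x}"

definition compact_op :: "('a::complex_hilbert \<Rightarrow>\<^sub>L 'a) \<Rightarrow> bool" where
  "compact_op T \<longleftrightarrow> compact (closure (blinfun_apply T ` cball 0 1))"

definition cadjoint :: "('a::complex_hilbert \<Rightarrow>\<^sub>L 'a) \<Rightarrow> ('a \<Rightarrow>\<^sub>L 'a)" where
  "cadjoint T =
     (THE S. \<forall>x y. cinner (blinfun_apply S x) y = cinner x (blinfun_apply T y))"

definition selfadjoint_op :: "('a::complex_hilbert \<Rightarrow>\<^sub>L 'a) \<Rightarrow> bool" where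
  "selfadjoint_op T \<longleftrightarrow>
     (\<forall>x y. cinner (blinfun_apply T x) y = cinner x (blinfun_apply T y))"

definition positive_op :: "('a::complex_hilbert \<Rightarrow>\<^sub>L 'a) \<Rightarrow> bool" where
  "positive_op T \<longleftrightarrow>
     T \<in> bounded_ops \<and> (\<forall>x. cinner (blinfun_apply T x) x \<in> \<real>\<^sub>\<ge>\<^sub>0)"

definition abs_op :: "('a::complex_hilbert \<Rightarrow>\<^sub>L 'a) \<Rightarrow> ('a \<Rightarrow>\<^sub>L 'a)" where
  "abs_op T = (THE S. positive_op S \<and> S o\<^sub>L S = cadjoint T o\<^sub>L T)"

definition pos_neg_decomposition ::
    "('a::complex_hilbert \<Rightarrow>\<^sub>L 'a) \<Rightarrow> ('a \<Rightarrow>\<^sub>L 'a) \<Rightarrow> ('a \<Rightarrow>\<^sub>L 'a) \<Rightarrow> bool" where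
  "pos_neg_decomposition a p m \<longleftrightarrow>
     a = p - m \<and> positive_op p \<and> positive_op m \<and> p o\<^sub>L m = 0"

definition pos_op :: "('a::complex_hilbert \<Rightarrow>\<^sub>L 'a) \<Rightarrow> ('a \<Rightarrow>\<^sub>L 'a)" where
  "pos_op a = (THE p. \<exists>m. pos_neg_decomposition a p m)"

definition neg_op :: "('a::complex_hilbert \<Rightarrow>\<^sub>L 'a) \<Rightarrow> ('a \<Rightarrow>\<^sub>L 'a)" where
  "neg_op a = (THE m. \<exists>p. pos_neg_decomposition a p m)"

(* The decreasing sequence in which every s > 0 occurs exactly m s times; if the
   multiplicities of the positive values have a finite sum, it ends in zeros. *)
definition decreasing_enumeration :: "(real \<Rightarrow> nat) \<Rightarrow> nat \<Rightarrow> real" where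
  "decreasing_enumeration m =
     (THE f. decseq f \<and> (\<forall>n. 0 \<le> f n) \<and>
        (\<forall>s>0. finite {n. f n = s} \<and> card {n. f n = s} = m s))"

(* Singular values of a compact operator: the eigenvalues of its absolute value, each
   repeated according to the complex dimension of its eigenspace. Indexing starts at 0. *)
definition singular_values :: "('a::complex_hilbert \<Rightarrow>\<^sub>L 'a) \<Rightarrow> nat \<Rightarrow> real" where
  "singular_values T = decreasing_enumeration
     (\<lambda>s. complex_vector.dim {x. blinfun_apply (abs_op T) x = complex_of_real s *\<^sub>C x})"

definition c0 :: "(nat \<Rightarrow> complex) set" where
  "c0 = {x. x \<longlonglongrightarrow> 0}"

definition decreasing_rearrangement :: "(nat \<Rightarrow> complex) \<Rightarrow> nat \<Rightarrow> real" where
  "decreasing_rearrangement x = decreasing_enumeration (\<lambda>s. card {n. cmod (x n) = s})"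

(* A normed space is given by its carrier E and a function N that is only meaningful on E. *)
definition symmetrically_normed ::
    "(nat \<Rightarrow> complex) set \<Rightarrow> ((nat \<Rightarrow> complex) \<Rightarrow> real) \<Rightarrow> bool" where
  "symmetrically_normed E N \<longleftrightarrow>
     E \<subseteq> c0 \<and>
     (\<lambda>n. 0) \<in> E \<and>
     (\<forall>x\<in>E. \<forall>y\<in>E. (\<lambda>n. x n + y n) \<in> E) \<and>
     (\<forall>c. \<forall>x\<in>E. (\<lambda>n. c * x n) \<in> E) \<and>
     (\<forall>x\<in>E. 0 \<le> N x) \<and>
     (\<forall>x\<in>E. N x = 0 \<longleftrightarrow> x = (\<lambda>n. 0)) \<and>
     (\<forall>x\<in>E. \<forall>y\<in>E. N (\<lambda>n. x n + y n) \<le> N x + N y) \<and>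
     (\<forall>c. \<forall>x\<in>E. N (\<lambda>n. c * x n) = cmod c * N x) \<and>
     (\<forall>x\<in>E. \<forall>y\<in>c0. (\<forall>n. decreasing_rearrangement y n \<le> decreasing_rearrangement x n)
        \<longrightarrow> y \<in> E \<and> N y \<le> N x)"

definition op_ideal :: "(nat \<Rightarrow> complex) set \<Rightarrow> ('a::complex_hilbert \<Rightarrow>\<^sub>L 'a) set" where
  "op_ideal E =
     {T \<in> bounded_ops. compact_op T \<and> (\<lambda>n. complex_of_real (singular_values T n)) \<in> E}"

definition op_ideal_norm ::
    "((nat \<Rightarrow> complex) \<Rightarrow> real) \<Rightarrow> ('a::complex_hilbert \<Rightarrow>\<^sub>L 'a) \<Rightarrow> real" where
  "op_ideal_norm N T = N (\<lambda>n. complex_of_real (singular_values T n))"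

definition gen_derivation ::
    "('a::complex_hilbert \<Rightarrow>\<^sub>L 'a) \<Rightarrow> ('a \<Rightarrow>\<^sub>L 'a) \<Rightarrow> ('a \<Rightarrow>\<^sub>L 'a) \<Rightarrow> ('a \<Rightarrow>\<^sub>L 'a)" where
  "gen_derivation a b x = (a o\<^sub>L x) - (x o\<^sub>L b)"

(* Taken in the extended reals, so that the supremum is meaningful before boundedness is known. *)
definition gen_derivation_norm ::
    "((nat \<Rightarrow> complex) \<Rightarrow> real) \<Rightarrow> ('a::complex_hilbert \<Rightarrow>\<^sub>L 'a) \<Rightarrow> ('a \<Rightarrow>\<^sub>L 'a) \<Rightarrow> ereal" where
  "gen_derivation_norm N a b =
     (SUP x \<in> {x \<in> bounded_ops. norm x \<le> 1}. ereal (op_ideal_norm N (gen_derivation a b x)))"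

(* sum_decode is the library's bijection from nat to nat + nat (evens left, odds right). *)
definition seq_oplus :: "(nat \<Rightarrow> real) \<Rightarrow> (nat \<Rightarrow> real) \<Rightarrow> nat \<Rightarrow> complex" where
  "seq_oplus f g n = complex_of_real (case_sum f g (sum_decode n))"

end

theory Submission
  imports Defs
begin

text \<open>
  Let \<open>w = (\<mu>(a\<^sub>+) + \<mu>(b\<^sub>-)) \<oplus> (\<mu>(b\<^sub>+) + \<mu>(a\<^sub>-))\<close>. For unitary \<open>x\<close> the singular values of \<open>a x - x b\<close> are
  those of \<open>a - x b x\<^sup>*\<close>, the difference of the positive operators \<open>a\<^sub>+ + x b\<^sub>- x\<^sup>*\<close> and \<open>a\<^sub>- + x b\<^sub>+ x\<^sup>*\<close>.
  They are as large as possible when \<open>x\<close> carries the eigenvectors of \<open>b\<^sub>-\<close> to those of \<open>a\<^sub>+\<close> and the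
  eigenvectors of \<open>b\<^sub>+\<close> to those of \<open>a\<^sub>-\<close>, in decreasing order of the eigenvalues; then they are the
  entries of \<open>w\<close>. The theorem says that this pairing is optimal for every symmetric norm and for
  all contractions \<open>x\<close>.

  For the upper bound, the singular values \<open>s\<close> of \<open>a x - x b\<close> need not lie below the rearrangement
  \<open>w\<^sup>*\<close> of \<open>w\<close> entrywise: two orthogonal projections of rank one produce \<open>1, 1\<close> against \<open>2, 0\<close>. They are
  majorized by \<open>w\<^sup>*\<close> (\<open>ky_fan_estimate\<close>). For a general symmetric norm, majorization alone does not
  give an inequality of norms. However, removing the \<open>n\<close> largest eigenvalues of each sign from \<open>a\<close>
  and \<open>b\<close> changes \<open>a x - x b\<close> by an operator of rank at most \<open>4 n\<close>, so that majorization holds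
  uniformly along the sequences: the sum of \<open>m\<close> entries of \<open>s\<close> from position \<open>4 n\<close> on is at most
  the sum of \<open>m\<close> entries of \<open>w\<^sup>*\<close> from position \<open>n\<close> on (\<open>deriv_op_majorization\<close>). This uniform
  majorization, which goes back to Kalton and Sukochev, does imply domination of the norms with
  constant one (\<open>uniform_majorization\<close>). Indeed, cut the index set into blocks of geometrically
  growing length. In each block a greedy choice of rearrangements shows that the entries of \<open>s\<close> are
  nearly below an average of \<open>M\<close> rearrangements of the entries of \<open>w\<^sup>*\<close>, where \<open>M\<close> does not depend on
  the block (\<open>average_of_rearrangements\<close>, \<open>blockwise_majorization\<close>). Hence a finite average of
  rearrangements of \<open>w\<^sup>*\<close> suffices, which matters because \<open>E\<close> is not assumed to be complete. The entries
  that are lost at the beginning of the blocks are recovered by averaging over the positions of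
  the cuts.

  For the lower bound, the pairing may fail to exist: if \<open>a\<^sub>+\<close> has finite rank, \<open>b\<^sub>-\<close> has infinite rank
  and \<open>a\<close> is injective, there is no room for the images of the eigenvectors of \<open>b\<^sub>-\<close>. Eigenvectors
  of \<open>a\<close> with tiny eigenvalues then take the place of kernel vectors. This spoils \<open>w\<close> at a sparse set
  of positions, and the average over \<open>Q\<close> disjoint choices of this set loses only a factor close to one
  (\<open>completed_eigenvectors\<close>, \<open>norm_w_le_if_deriv_bounded\<close>).

  Compact operators are handled throughout as diagonal operators \<open>y \<mapsto> \<Sum>n. d n \<langle>y, f n\<rangle> e n\<close> with respect
  to orthonormal systems, which the spectral theorem provides; the pairing operators \<open>x\<close> are of the
  same form.
\<close>

section \<open>Hilbert space geometry\<close>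

lemma cinner_add_right: "cinner x (y + z) = cinner x y + cinner x z"
  for x :: "'a::complex_hilbert"
  by (metis cinner_add_left cinner_commute complex_cnj_add)

lemma cinner_scaleC_right: "cinner x (c *\<^sub>C y) = cnj c * cinner x y"
  for x :: "'a::complex_hilbert"
  by (metis cinner_commute cinner_scaleC_left complex_cnj_mult)

lemma cinner_zero [simp]:
  fixes x :: "'a::complex_hilbert"
  shows "cinner 0 x = 0" and "cinner x 0 = 0"
  using cinner_add_left[of 0 0 x] cinner_add_right[of x 0 0] by auto

lemma cinner_minus [simp]:
  fixes x :: "'a::complex_hilbert"
  shows "cinner (- x) y = - cinner x y" and "cinner x (- y) = - cinner x y"
  using cinner_add_left[of x "- x" y] cinner_add_right[of x y "- y"]
  by (auto simp: add_eq_0_iff)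

lemma cinner_diff_left: "cinner (x - y) z = cinner x z - cinner y z"
  for x :: "'a::complex_hilbert"
  using cinner_add_left[of x "- y" z] by simp

lemma cinner_diff_right: "cinner x (y - z) = cinner x y - cinner x z"
  for x :: "'a::complex_hilbert"
  using cinner_add_right[of x y "- z"] by simp

lemma cinner_sum_left: "cinner (\<Sum>i\<in>F. f i) y = (\<Sum>i\<in>F. cinner (f i) y)"
  for y :: "'a::complex_hilbert"
  by (induction F rule: infinite_finite_induct) (simp_all add: cinner_add_left)

lemma cinner_sum_right: "cinner y (\<Sum>i\<in>F. f i) = (\<Sum>i\<in>F. cinner y (f i))"
  for y :: "'a::complex_hilbert"
  by (induction F rule: infinite_finite_induct) (simp_all add: cinner_add_right)

lemma cinner_scaleR_left: "cinner (r *\<^sub>R x) y = r *\<^sub>R cinner x y"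
  for x :: "'a::complex_hilbert"
  by (metis cinner_scaleC_left scaleC_of_real scaleR_conv_of_real)

lemma cinner_scaleR_right: "cinner x (r *\<^sub>R y) = r *\<^sub>R cinner x y"
  for x :: "'a::complex_hilbert"
  by (metis cinner_scaleC_right complex_cnj_complex_of_real scaleC_of_real scaleR_conv_of_real)

lemma cinner_self: "cinner x x = complex_of_real ((norm x)\<^sup>2)"
  for x :: "'a::complex_hilbert"
proof -
  have "Im (cinner x x) = 0"
    using arg_cong[OF cinner_commute[of x x], of Im] by simp
  moreover have "0 \<le> Re (cinner x x)"
    using norm_ge_zero[of x] by (simp add: norm_eq_sqrt_cinner)
  ultimately show ?thesis
    by (simp add: complex_eq_iff norm_eq_sqrt_cinner)
qed

lemma norm_scaleC [simp]: "norm (c *\<^sub>C x) = cmod c * norm x"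
  for x :: "'a::complex_hilbert"
proof -
  have "complex_of_real ((norm (c *\<^sub>C x))\<^sup>2) = (c * cnj c) * cinner x x"
    unfolding cinner_self[symmetric] by (simp add: cinner_scaleC_left cinner_scaleC_right)
  also have "\<dots> = complex_of_real ((cmod c * norm x)\<^sup>2)"
    by (simp add: cinner_self complex_norm_square[symmetric] power_mult_distrib)
  finally have "(norm (c *\<^sub>C x))\<^sup>2 = (cmod c * norm x)\<^sup>2"
    by (simp only: of_real_eq_iff)
  thus ?thesis by simp
qed

lemma norm_add_square:
  fixes x y :: "'a::complex_hilbert"
  shows "(norm (x + y))\<^sup>2 = (norm x)\<^sup>2 + (norm y)\<^sup>2 + 2 * Re (cinner x y)"
proof -
  have "complex_of_real ((norm (x + y))\<^sup>2)
      = complex_of_real ((norm x)\<^sup>2 + (norm y)\<^sup>2) + (cinner x y + cnj (cinner x y))"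
    unfolding cinner_self[symmetric] of_real_add cinner_commute[of y x, symmetric]
    by (simp add: cinner_add_left cinner_add_right)
  also have "\<dots> = complex_of_real ((norm x)\<^sup>2 + (norm y)\<^sup>2 + 2 * Re (cinner x y))"
    by (simp add: complex_add_cnj)
  finally show ?thesis by (simp only: of_real_eq_iff)
qed

lemma norm_diff_square:
  fixes x y :: "'a::complex_hilbert"
  shows "(norm (x - y))\<^sup>2 = (norm x)\<^sup>2 + (norm y)\<^sup>2 - 2 * Re (cinner x y)"
  using norm_add_square[of x "- y"] by simp

lemma cinner_Cauchy_Schwarz: "cmod (cinner x y) \<le> norm x * norm y"
  for x :: "'a::complex_hilbert"
proof (cases "y = 0")
  case False
  define c where "c = cinner x y / complex_of_real ((norm y)\<^sup>2)"
  have ny: "complex_of_real ((norm y)\<^sup>2) \<noteq> 0" using False by simp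
  have cy: "c * complex_of_real ((norm y)\<^sup>2) = cinner x y"
    using ny by (simp add: c_def)
  have "0 \<le> (norm (x - c *\<^sub>C y))\<^sup>2" by simp
  also have "\<dots> = (norm x)\<^sup>2 + (cmod c * norm y)\<^sup>2 - 2 * Re (cnj c * cinner x y)"
    by (simp add: norm_diff_square cinner_scaleC_right)
  also have "cnj c * cinner x y = complex_of_real ((cmod c * norm y)\<^sup>2)"
  proof -
    have "cnj c * cinner x y = (c * cnj c) * complex_of_real ((norm y)\<^sup>2)"
      by (simp add: cy[symmetric])
    thus ?thesis
      by (simp add: complex_norm_square[symmetric] power_mult_distrib)
  qed
  finally have "(cmod c * norm y)\<^sup>2 \<le> (norm x)\<^sup>2" by simp
  hence "cmod c * norm y \<le> norm x"
    by (rule power2_le_imp_le) simp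
  hence "cmod c * norm y * norm y \<le> norm x * norm y"
    by (rule mult_right_mono) simp
  moreover have "cmod (cinner x y) = cmod c * norm y * norm y"
    by (subst cy[symmetric]) (simp add: norm_mult power2_eq_square)
  ultimately show ?thesis by simp
qed simp

lemma bounded_linear_cinner_left: "bounded_linear (\<lambda>x. cinner x y)"
  for y :: "'a::complex_hilbert"
  by (rule bounded_linear_intro[where K = "norm y"])
    (simp_all add: cinner_add_left cinner_scaleR_left cinner_Cauchy_Schwarz)

lemma bounded_linear_scaleC: "bounded_linear (\<lambda>x. c *\<^sub>C x)"
  for dummy :: "'a::complex_hilbert"
  by (rule bounded_linear_intro[where K = "cmod c"])
    (simp_all add: complex_vector.scale_right_distrib scaleC_of_real[symmetric]
      complex_vector.scale_left_commute)

lemma cinner_eq_zero_all: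
  fixes x :: "'a::complex_hilbert"
  assumes "\<And>y. cinner x y = 0"
  shows "x = 0"
  using assms[of x] by (simp add: cinner_self)

lemma cinner_ext:
  fixes x y :: "'a::complex_hilbert"
  assumes "\<And>z. cinner x z = cinner y z"
  shows "x = y"
  using cinner_eq_zero_all[of "x - y"] assms by (simp add: cinner_diff_left)

text \<open>The parallelogram law turns a sequence of unit vectors on which \<open>\<phi>\<close> tends to its norm into a
  Cauchy sequence, and the first-order condition at its limit identifies the functional.\<close>

lemma riesz_representation:
  fixes \<phi> :: "'a::complex_hilbert \<Rightarrow> complex"
  assumes "bounded_linear \<phi>" and hom: "\<And>c x. \<phi> (c *\<^sub>C x) = c * \<phi> x"
  shows "\<exists>z. \<forall>x. \<phi> x = cinner x z"
proof -
  interpret \<phi>: bounded_linear \<phi> by fact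
  define M where "M = onorm \<phi>"
  have M: "cmod (\<phi> x) \<le> M * norm x" for x
    unfolding M_def by (rule onorm) fact
  have M0: "0 \<le> M" unfolding M_def by (rule onorm_pos_le) fact
  have near: "\<exists>x. norm x = 1 \<and> M - 1 / Suc n \<le> Re (\<phi> x)" if nz: "M \<noteq> 0" for n
  proof (rule ccontr)
    assume "\<not> ?thesis"
    hence *: "\<And>x. norm x = 1 \<Longrightarrow> Re (\<phi> x) < M - 1 / Suc n" by force
    obtain x0 where x0: "\<phi> x0 \<noteq> 0"
      using nz onorm_eq_0[OF assms(1)] by (auto simp: M_def)
    have b0: "0 \<le> M - 1 / Suc n"
    proof -
      have "x0 \<noteq> 0" using x0 by auto
      define z where "z = (1 / norm x0) *\<^sub>R x0"
      have z: "norm z = 1" using \<open>x0 \<noteq> 0\<close> by (simp add: z_def)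
      have "\<phi> (- z) = - \<phi> z" using \<phi>.scaleR[of "-1" z] by simp
      thus ?thesis using *[of z] *[of "- z"] z by simp
    qed
    have cm: "cmod (\<phi> x) \<le> (M - 1 / Suc n) * norm x" for x
    proof (cases "\<phi> x = 0")
      case False
      hence "x \<noteq> 0" by auto
      define c where "c = cnj (sgn (\<phi> x)) / norm x"
      have "norm (c *\<^sub>C x) = 1" using False \<open>x \<noteq> 0\<close>
        by (simp add: c_def norm_divide norm_sgn)
      from *[OF this] have "Re (c * \<phi> x) < M - 1 / Suc n" by (simp add: hom)
      moreover have "c * \<phi> x = complex_of_real (cmod (\<phi> x) / norm x)"
      proof -
        have "cnj (sgn (\<phi> x)) * \<phi> x = cmod (\<phi> x)" 
          using complex_norm_square[of "\<phi> x"] False 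
          by (simp add: sgn_div_norm scaleR_conv_of_real field_simps power2_eq_square)
        thus ?thesis by (simp add: c_def)
      qed
      ultimately show ?thesis using \<open>x \<noteq> 0\<close> by (simp add: field_simps)
    next
      case True
      thus ?thesis using b0 by simp
    qed
    have "onorm \<phi> \<le> M - 1 / Suc n" by (rule onorm_bound[OF b0]) (rule cm)
    thus False by (simp add: M_def)
  qed
  show ?thesis
  proof (cases "M = 0")
    case True
    thus ?thesis using M by (intro exI[of _ 0]) simp
  next
    case False
    hence Mpos: "M > 0" using M0 by simp
    obtain X where X: "\<And>n. norm (X n) = 1" and XM: "\<And>n. M - 1 / Suc n \<le> Re (\<phi> (X n))"
      using near[OF False] by metis
    have close: "(norm (X m - X n))\<^sup>2 \<le> 4 / M * (1 / Suc m + 1 / Suc n)" for m n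
    proof -
      define \<epsilon> where "\<epsilon> = (1 / Suc m + 1 / Suc n :: real)"
      have "2 * M - \<epsilon> \<le> Re (\<phi> (X m + X n))"
        using XM[of m] XM[of n] by (simp add: \<phi>.add \<epsilon>_def)
      also have "\<dots> \<le> M * norm (X m + X n)"
        using M[of "X m + X n"] complex_Re_le_cmod order_trans by blast
      finally have h: "2 - \<epsilon> / M \<le> norm (X m + X n)"
        using Mpos by (simp add: field_simps)
      have n2: "norm (X m + X n) \<le> 2" using norm_triangle_ineq[of "X m" "X n"] X by simp
      have par: "(norm (X m - X n))\<^sup>2 = 4 - (norm (X m + X n))\<^sup>2"
        by (simp add: norm_diff_square norm_add_square X)
      also have "\<dots> = (2 - norm (X m + X n)) * (2 + norm (X m + X n))"
        by (simp add: power2_eq_square algebra_simps)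
      also have "\<dots> \<le> (\<epsilon> / M) * 4"
        using h n2 by (intro mult_mono) (use Mpos in \<open>auto simp: \<epsilon>_def\<close>)
      finally show ?thesis by (simp add: \<epsilon>_def)
    qed
    have "Cauchy X"
    proof (rule metric_CauchyI)
      fix e :: real assume "e > 0"
      define d where "d = M * e\<^sup>2 / 16"
      have "d > 0" using \<open>e > 0\<close> Mpos by (simp add: d_def)
      then obtain K where K: "1 / Suc K < d" using nat_approx_posE by blast
      show "\<exists>K. \<forall>m\<ge>K. \<forall>n\<ge>K. dist (X m) (X n) < e"
      proof (intro exI[of _ K] allI impI)
        fix m n assume "K \<le> m" "K \<le> n"
        hence "(1::real) / Suc m \<le> 1 / Suc K" "(1::real) / Suc n \<le> 1 / Suc K"
          by (auto simp: field_simps)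
        hence "1 / real (Suc m) + 1 / real (Suc n) < 2 * d" using K by simp
        hence "4 / M * (1 / Suc m + 1 / Suc n) < 4 / M * (2 * d)"
          using Mpos by (intro mult_strict_left_mono) auto
        also have "\<dots> = e\<^sup>2 / 2" using Mpos by (simp add: d_def)
        also have "\<dots> < e\<^sup>2" using \<open>e > 0\<close> by simp
        finally have "(norm (X m - X n))\<^sup>2 < e\<^sup>2" using close[of m n] by linarith
        thus "dist (X m) (X n) < e"
          using \<open>e > 0\<close> by (simp add: dist_norm power2_less_imp_less)
      qed
    qed
    then obtain x where x: "X \<longlonglongrightarrow> x" using Cauchy_convergent convergent_def by blast
    have nx: "norm x = 1"
      using tendsto_norm[OF x] X by (simp add: LIMSEQ_const_iff)
    have phix: "M \<le> Re (\<phi> x)"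
    proof (rule LIMSEQ_le)
      show "(\<lambda>n. M - 1 / Suc n) \<longlonglongrightarrow> M"
        using tendsto_diff[OF tendsto_const[of M] LIMSEQ_inverse_real_of_nat]
        by (simp add: inverse_eq_divide)
      show "(\<lambda>n. Re (\<phi> (X n))) \<longlonglongrightarrow> Re (\<phi> x)"
        by (intro tendsto_intros \<phi>.tendsto x)
    qed (use XM in auto)
    have re: "Re (\<phi> y) = M * Re (cinner y x)" for y
    proof -
      define D where "D = Re (\<phi> y) - M * Re (cinner y x)"
      define B where "B = M * (norm y)\<^sup>2 / 2"
      have le: "t * D \<le> B * t\<^sup>2" for t :: real
      proof -
        have "M + t * Re (\<phi> y) \<le> Re (\<phi> (x + t *\<^sub>R y))"
          using phix by (simp add: \<phi>.add \<phi>.scaleR)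
        also have "\<dots> \<le> M * norm (x + t *\<^sub>R y)"
          using M[of "x + t *\<^sub>R y"] complex_Re_le_cmod order_trans by blast
        also have "\<dots> \<le> M * (((norm (x + t *\<^sub>R y))\<^sup>2 + 1) / 2)"
        proof (intro mult_left_mono M0)
          have "0 \<le> (norm (x + t *\<^sub>R y) - 1)\<^sup>2" by simp
          thus "norm (x + t *\<^sub>R y) \<le> ((norm (x + t *\<^sub>R y))\<^sup>2 + 1) / 2"
            by (simp add: power2_eq_square algebra_simps)
        qed
        also have "(norm (x + t *\<^sub>R y))\<^sup>2 = 1 + t\<^sup>2 * (norm y)\<^sup>2 + 2 * t * Re (cinner y x)"
          using cinner_commute[of x y]
          by (simp add: norm_add_square nx cinner_scaleR_right power_mult_distrib)
        finally show ?thesis by (simp add: D_def B_def field_simps)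
      qed
      have "B \<ge> 0" using M0 by (simp add: B_def)
      define t where "t = D / (B + 1)"
      have D: "D = t * (B + 1)" using \<open>B \<ge> 0\<close> by (simp add: t_def)
      have "t * (t * (B + 1)) \<le> B * t\<^sup>2" using le[of t] D by simp
      hence "t\<^sup>2 \<le> 0" by (simp add: algebra_simps power2_eq_square)
      hence "D = 0" using D by simp
      thus ?thesis by (simp add: D_def)
    qed
    have "\<phi> y = cinner y (complex_of_real M *\<^sub>C x)" for y
    proof (rule complex_eqI)
      show "Re (\<phi> y) = Re (cinner y (complex_of_real M *\<^sub>C x))"
        using re by (simp add: cinner_scaleC_right)
      have "Re (\<phi> (\<i> *\<^sub>C y)) = M * Re (cinner (\<i> *\<^sub>C y) x)" by (rule re)
      thus "Im (\<phi> y) = Im (cinner y (complex_of_real M *\<^sub>C x))"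
        by (simp add: hom cinner_scaleC_left cinner_scaleC_right)
    qed
    thus ?thesis by blast
  qed
qed

subsection \<open>Bounded operators and adjoints\<close>

lemma bounded_ops_scaleC: "T \<in> bounded_ops \<Longrightarrow> blinfun_apply T (c *\<^sub>C x) = c *\<^sub>C blinfun_apply T x"
  by (simp add: bounded_ops_def)

lemma bounded_ops_compose: "S \<in> bounded_ops \<Longrightarrow> T \<in> bounded_ops \<Longrightarrow> S o\<^sub>L T \<in> bounded_ops"
  by (simp add: bounded_ops_def)

lemma bounded_ops_add: "S \<in> bounded_ops \<Longrightarrow> T \<in> bounded_ops \<Longrightarrow> S + T \<in> bounded_ops"
  by (simp add: bounded_ops_def plus_blinfun.rep_eq scaleC_add_right)

lemma bounded_ops_minus: "T \<in> bounded_ops \<Longrightarrow> - T \<in> bounded_ops"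
  by (simp add: bounded_ops_def uminus_blinfun.rep_eq)

lemma bounded_ops_diff: "S \<in> bounded_ops \<Longrightarrow> T \<in> bounded_ops \<Longrightarrow> S - T \<in> bounded_ops"
  by (simp add: bounded_ops_def minus_blinfun.rep_eq complex_vector.scale_right_diff_distrib)

lemma bounded_ops_scaleR: "T \<in> bounded_ops \<Longrightarrow> r *\<^sub>R T \<in> bounded_ops"
  by (simp add: bounded_ops_def scaleR_blinfun.rep_eq scaleC_of_real[symmetric]
      complex_vector.scale_left_commute)

lemma bounded_ops_zero: "0 \<in> bounded_ops"
  by (simp add: bounded_ops_def)

lemmas bounded_ops_intros = bounded_ops_compose bounded_ops_add bounded_ops_minus
  bounded_ops_diff bounded_ops_scaleR bounded_ops_zero

lemma adjoint_exists:
  assumes T: "T \<in> bounded_ops"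
  shows "\<exists>S\<in>bounded_ops. \<forall>x y. cinner (blinfun_apply S x) y = cinner x (blinfun_apply T y)"
proof -
  have "\<exists>z. \<forall>y. cinner (blinfun_apply T y) x = cinner y z" for x
    by (rule riesz_representation)
      (auto intro: bounded_linear_compose[OF bounded_linear_cinner_left blinfun.bounded_linear_right]
        simp: bounded_ops_scaleC[OF T] cinner_scaleC_left)
  then obtain S where S: "\<And>x y. cinner (blinfun_apply T y) x = cinner y (S x)" by metis
  have S': "cinner (S x) y = cinner x (blinfun_apply T y)" for x y
    using S by (metis cinner_commute)
  have nS: "norm (S x) \<le> norm x * norm T" for x
  proof (cases "S x = 0")
    case False
    have "(norm (S x))\<^sup>2 = cmod (cinner (S x) (S x))" by (simp add: cinner_self norm_power)
    also have "\<dots> \<le> norm x * norm (blinfun_apply T (S x))"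
      by (simp add: S' cinner_Cauchy_Schwarz)
    also have "\<dots> \<le> norm x * (norm T * norm (S x))"
      by (intro mult_left_mono norm_blinfun) simp
    finally show ?thesis using False by (simp add: power2_eq_square)
  qed simp
  have add: "S (x + y) = S x + S y" for x y
    by (rule cinner_ext) (simp add: S' cinner_add_left)
  have sc: "S (c *\<^sub>C x) = c *\<^sub>C S x" for c x
    by (rule cinner_ext) (simp add: S' cinner_scaleC_left)
  have "bounded_linear S"
    by (rule bounded_linear_intro[where K = "norm T"])
      (use add sc nS in \<open>auto simp: scaleC_of_real[symmetric]\<close>)
  hence "blinfun_apply (Blinfun S) = S" by (rule bounded_linear_Blinfun_apply)
  thus ?thesis
    by (intro bexI[of _ "Blinfun S"]) (auto simp: S' sc bounded_ops_def)
qed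

lemma
  assumes T: "T \<in> bounded_ops"
  shows cinner_cadjoint: "cinner (blinfun_apply (cadjoint T) x) y = cinner x (blinfun_apply T y)"
    and bounded_ops_cadjoint: "cadjoint T \<in> bounded_ops"
proof -
  obtain S where S: "S \<in> bounded_ops"
      "\<forall>x y. cinner (blinfun_apply S x) y = cinner x (blinfun_apply T y)"
    using adjoint_exists[OF T] by blast
  have "cadjoint T = S" unfolding cadjoint_def
  proof (rule the_equality)
    fix S' assume "\<forall>x y. cinner (blinfun_apply S' x) y = cinner x (blinfun_apply T y)"
    thus "S' = S" using S(2) by (intro blinfun_eqI cinner_ext) simp
  qed (use S in simp)
  thus "cinner (blinfun_apply (cadjoint T) x) y = cinner x (blinfun_apply T y)"
      "cadjoint T \<in> bounded_ops"
    using S by auto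
qed

lemma cinner_cadjoint': "T \<in> bounded_ops \<Longrightarrow>
    cinner x (blinfun_apply (cadjoint T) y) = cinner (blinfun_apply T x) y"
  by (metis cinner_cadjoint cinner_commute)

lemma norm_cadjoint_le:
  assumes "T \<in> bounded_ops"
  shows "norm (blinfun_apply (cadjoint T) x) \<le> norm T * norm x"
proof (cases "blinfun_apply (cadjoint T) x = 0")
  case False
  let ?S = "blinfun_apply (cadjoint T)"
  have "(norm (?S x))\<^sup>2 = cmod (cinner (?S x) (?S x))" by (simp add: cinner_self norm_power)
  also have "\<dots> \<le> norm x * norm (blinfun_apply T (?S x))"
    by (simp add: cinner_cadjoint[OF assms] cinner_Cauchy_Schwarz)
  also have "\<dots> \<le> norm x * (norm T * norm (?S x))"
    by (intro mult_left_mono norm_blinfun) simp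
  finally show ?thesis using False by (simp add: power2_eq_square mult_ac)
qed simp

lemma norm_contraction: "norm T \<le> 1 \<Longrightarrow> norm (blinfun_apply T x) \<le> norm x"
  using norm_blinfun[of T x] mult_right_mono[of "norm T" 1 "norm x"] by simp

subsection \<open>Compact operators\<close>

lemma compact_op_iff: "compact_op T \<longleftrightarrow> (\<exists>K. compact K \<and> blinfun_apply T ` cball 0 1 \<subseteq> K)"
proof
  assume "\<exists>K. compact K \<and> blinfun_apply T ` cball 0 1 \<subseteq> K"
  then obtain K where K: "compact K" "blinfun_apply T ` cball 0 1 \<subseteq> K" by blast
  hence "closure (blinfun_apply T ` cball 0 1) \<subseteq> K"
    by (intro closure_minimal compact_imp_closed)
  thus "compact_op T" unfolding compact_op_def
    using K(1) by (metis closed_Int_compact closed_closure inf.absorb1)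
next
  assume "compact_op T"
  thus "\<exists>K. compact K \<and> blinfun_apply T ` cball 0 1 \<subseteq> K"
    unfolding compact_op_def by (intro exI conjI) (assumption, rule closure_subset)
qed

lemma compact_op_diff:
  assumes "compact_op S" "compact_op T"
  shows "compact_op (S - T)"
proof -
  obtain K L where "compact K" "blinfun_apply S ` cball 0 1 \<subseteq> K"
      and "compact L" "blinfun_apply T ` cball 0 1 \<subseteq> L"
    using assms unfolding compact_op_iff by blast
  moreover from this have "compact {x - y |x y. x \<in> K \<and> y \<in> L}" by (intro compact_differences)
  ultimately show ?thesis unfolding compact_op_iff
    by (intro exI[of _ "{x - y |x y. x \<in> K \<and> y \<in> L}"]) (force simp: minus_blinfun.rep_eq)
qed

lemma compact_op_compose_left:
  assumes "compact_op T"
  shows "compact_op (S o\<^sub>L T)"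
proof -
  obtain K where K: "compact K" "blinfun_apply T ` cball 0 1 \<subseteq> K"
    using assms unfolding compact_op_iff by blast
  have "compact (blinfun_apply S ` K)"
    by (intro compact_continuous_image K blinfun.continuous_on continuous_on_id continuous_on_const)
  thus ?thesis unfolding compact_op_iff
    using K(2) by (intro exI[of _ "blinfun_apply S ` K"]) auto
qed

lemma compact_op_compose_right:
  fixes S T :: "'a::complex_hilbert \<Rightarrow>\<^sub>L 'a"
  assumes "compact_op T"
  shows "compact_op (T o\<^sub>L S)"
proof -
  obtain K where K: "compact K" "blinfun_apply T ` cball 0 1 \<subseteq> K"
    using assms unfolding compact_op_iff by blast
  have "blinfun_apply (T o\<^sub>L S) ` cball 0 1 \<subseteq> (\<lambda>x. (norm S + 1) *\<^sub>R x) ` K"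
  proof safe
    fix x :: 'a assume "x \<in> cball 0 1"
    define z where "z = (1 / (norm S + 1)) *\<^sub>R blinfun_apply S x"
    have np: "norm S + 1 > 0" using norm_ge_zero[of S] by linarith
    have "norm (blinfun_apply S x) \<le> norm S * 1"
      using \<open>x \<in> cball 0 1\<close> norm_blinfun[of S x] mult_left_mono[of "norm x" 1 "norm S"] by simp
    hence "norm z \<le> 1" using np by (simp add: z_def)
    hence "blinfun_apply T z \<in> K" using K(2) by auto
    moreover have "blinfun_apply (T o\<^sub>L S) x = (norm S + 1) *\<^sub>R blinfun_apply T z"
      using np by (simp add: z_def blinfun.scaleR_right)
    ultimately show "blinfun_apply (T o\<^sub>L S) x \<in> (\<lambda>x. (norm S + 1) *\<^sub>R x) ` K" by blast
  qed
  moreover have "compact ((\<lambda>x. (norm S + 1) *\<^sub>R x) ` K)" by (rule compact_scaling[OF K(1)])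
  ultimately show ?thesis unfolding compact_op_iff by blast
qed

lemma compact_op_convergent_subseq:
  assumes "compact_op T" and "\<And>n. norm (x n) \<le> 1"
  shows "\<exists>l r. strict_mono (r::nat \<Rightarrow> nat) \<and> (\<lambda>n. blinfun_apply T (x (r n))) \<longlonglongrightarrow> l"
proof -
  obtain K where K: "compact K" "blinfun_apply T ` cball 0 1 \<subseteq> K"
    using assms unfolding compact_op_iff by blast
  have "\<forall>n. blinfun_apply T (x n) \<in> K" using assms(2) K(2) by auto
  then obtain l r where "strict_mono r" "((\<lambda>n. blinfun_apply T (x n)) \<circ> r) \<longlonglongrightarrow> l"
    using K(1)[unfolded compact_def, rule_format, of "\<lambda>n. blinfun_apply T (x n)"] by blast
  thus ?thesis by (auto simp: o_def)
qed

subsection \<open>Orthonormal systems and diagonal operators\<close>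

text \<open>Zero vectors are admitted, so that a finite system, or the part of a system that survives a
  deletion, can still be indexed by all natural numbers.\<close>

definition partial_orthonormal :: "('i \<Rightarrow> 'a::complex_hilbert) \<Rightarrow> bool" where
  "partial_orthonormal e \<longleftrightarrow>
     (\<forall>i j. i \<noteq> j \<longrightarrow> cinner (e i) (e j) = 0) \<and> (\<forall>i. e i = 0 \<or> norm (e i) = 1)"

lemma partial_orthonormal_cinner:
  "partial_orthonormal e \<Longrightarrow> cinner (e i) (e j) = (if i = j \<and> e i \<noteq> 0 then 1 else 0)"
  by (auto simp: partial_orthonormal_def cinner_self)

lemma partial_orthonormal_norm: "partial_orthonormal e \<Longrightarrow> norm (e i) \<le> 1"
  by (metis partial_orthonormal_def norm_zero zero_le_one order_refl)

lemma partial_orthonormal_reindex: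
  "partial_orthonormal e \<Longrightarrow> inj_on \<pi> {i. A i} \<Longrightarrow> partial_orthonormal (\<lambda>i. if A i then e (\<pi> i) else 0)"
  by (auto simp: partial_orthonormal_def inj_on_def)

lemma cinner_sum_orthonormal:
  assumes "partial_orthonormal e" "finite F"
  shows "cinner (\<Sum>i\<in>F. c i *\<^sub>C e i) (e j) = (if j \<in> F \<and> e j \<noteq> 0 then c j else 0)"
proof -
  have "cinner (\<Sum>i\<in>F. c i *\<^sub>C e i) (e j) = (\<Sum>i\<in>F. if i = j then (if e j \<noteq> 0 then c j else 0) else 0)"
    unfolding cinner_sum_left
    by (intro sum.cong) (auto simp: cinner_scaleC_left partial_orthonormal_cinner[OF assms(1)])
  thus ?thesis using assms(2) by simp
qed

lemma norm_sum_orthonormal: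
  assumes "partial_orthonormal e" "finite F"
  shows "(norm (\<Sum>i\<in>F. c i *\<^sub>C e i))\<^sup>2 = (\<Sum>i\<in>F. if e i = 0 then 0 else (cmod (c i))\<^sup>2)"
proof -
  let ?s = "\<Sum>i\<in>F. c i *\<^sub>C e i"
  have "complex_of_real ((norm ?s)\<^sup>2) = (\<Sum>i\<in>F. cnj (c i) * cinner ?s (e i))"
    using cinner_sum_right[of ?s "\<lambda>i. c i *\<^sub>C e i" F]
    by (simp only: cinner_self[symmetric] cinner_scaleC_right)
  also have "\<dots> = (\<Sum>i\<in>F. complex_of_real (if e i = 0 then 0 else (cmod (c i))\<^sup>2))"
    by (intro sum.cong refl)
      (auto simp: cinner_sum_orthonormal[OF assms] complex_norm_square mult.commute simp del: of_real_power)
  finally show ?thesis by (simp only: of_real_sum[symmetric] of_real_eq_iff)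
qed

lemma norm_sum_orthonormal_le:
  assumes "partial_orthonormal e" "finite F"
  shows "(norm (\<Sum>i\<in>F. c i *\<^sub>C e i))\<^sup>2 \<le> (\<Sum>i\<in>F. (cmod (c i))\<^sup>2)"
  unfolding norm_sum_orthonormal[OF assms] by (rule sum_mono) auto

lemma bessel:
  assumes "partial_orthonormal e" "finite F"
  shows "(\<Sum>i\<in>F. (cmod (cinner y (e i)))\<^sup>2) \<le> (norm y)\<^sup>2"
proof -
  let ?S = "\<Sum>i\<in>F. (cmod (cinner y (e i)))\<^sup>2"
  let ?p = "\<Sum>i\<in>F. cinner y (e i) *\<^sub>C e i"
  have 1: "(norm ?p)\<^sup>2 = ?S"
    unfolding norm_sum_orthonormal[OF assms] by (rule sum.cong) auto
  have "cinner y ?p = complex_of_real ?S"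
    unfolding cinner_sum_right of_real_sum
    by (intro sum.cong refl)
      (simp add: cinner_scaleC_right complex_norm_square mult.commute del: of_real_power)
  hence 2: "Re (cinner y ?p) = ?S" by simp
  have "0 \<le> (norm (y - ?p))\<^sup>2" by simp
  thus ?thesis unfolding norm_diff_square 1 2 by simp
qed

lemma bessel_left:
  assumes "partial_orthonormal e" "finite F"
  shows "(\<Sum>i\<in>F. (cmod (cinner (e i) y))\<^sup>2) \<le> (norm y)\<^sup>2"
proof -
  have "cmod (cinner (e i) y) = cmod (cinner y (e i))" for i
    by (metis cinner_commute complex_mod_cnj)
  thus ?thesis using bessel[OF assms] by simp
qed

definition diagonal_op ::
    "(nat \<Rightarrow> complex) \<Rightarrow> (nat \<Rightarrow> 'a::complex_hilbert) \<Rightarrow> (nat \<Rightarrow> 'a) \<Rightarrow> ('a \<Rightarrow>\<^sub>L 'a)" where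
  "diagonal_op d f e = Blinfun (\<lambda>y. \<Sum>n. (d n * cinner y (f n)) *\<^sub>C e n)"

locale diagonal =
  fixes d :: "nat \<Rightarrow> complex" and f e :: "nat \<Rightarrow> 'a::complex_hilbert"
  assumes f: "partial_orthonormal f" and e: "partial_orthonormal e" and d: "bounded (range d)"
begin

lemma norm_partial_sum:
  assumes "finite F" "\<And>n. n \<in> F \<Longrightarrow> cinner y (f n) \<noteq> 0 \<Longrightarrow> cmod (d n) \<le> B"
  shows "(norm (\<Sum>n\<in>F. (d n * cinner y (f n)) *\<^sub>C e n))\<^sup>2
    \<le> B\<^sup>2 * (\<Sum>n\<in>F. (cmod (cinner y (f n)))\<^sup>2)"
proof -
  have "(norm (\<Sum>n\<in>F. (d n * cinner y (f n)) *\<^sub>C e n))\<^sup>2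
      \<le> (\<Sum>n\<in>F. (cmod (d n * cinner y (f n)))\<^sup>2)"
    by (rule norm_sum_orthonormal_le[OF e assms(1)])
  also have "\<dots> \<le> (\<Sum>n\<in>F. B\<^sup>2 * (cmod (cinner y (f n)))\<^sup>2)"
  proof (intro sum_mono)
    fix n assume "n \<in> F"
    show "(cmod (d n * cinner y (f n)))\<^sup>2 \<le> B\<^sup>2 * (cmod (cinner y (f n)))\<^sup>2"
    proof (cases "cinner y (f n) = 0")
      case False
      thus ?thesis using assms(2)[OF \<open>n \<in> F\<close>]
        by (simp add: norm_mult power_mult_distrib mult_right_mono power_mono)
    qed simp
  qed
  finally show ?thesis by (simp add: sum_distrib_left)
qed

lemma summable_coefficients: "summable (\<lambda>n. (cmod (cinner y (f n)))\<^sup>2)"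
  by (rule summableI_nonneg_bounded[where x = "(norm y)\<^sup>2"]) (auto intro: bessel[OF f])

lemma summable_series: "summable (\<lambda>n. (d n * cinner y (f n)) *\<^sub>C e n)"
proof -
  obtain B where B: "B > 0" "\<And>n. cmod (d n) \<le> B"
    using d unfolding bounded_pos by auto
  show ?thesis unfolding summable_Cauchy
  proof (intro allI impI)
    fix \<epsilon> :: real assume "\<epsilon> > 0"
    hence "\<epsilon>\<^sup>2 / B\<^sup>2 > 0" using B(1) by simp
    then obtain M where M: "\<And>m n. m \<ge> M \<Longrightarrow>
        norm (\<Sum>k=m..<n. (cmod (cinner y (f k)))\<^sup>2) < \<epsilon>\<^sup>2 / B\<^sup>2"
      using summable_coefficients[of y] unfolding summable_Cauchy by blast
    have "norm (\<Sum>k=m..<n. (d k * cinner y (f k)) *\<^sub>C e k) < \<epsilon>" if "m \<ge> M" for m n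
    proof -
      have "(norm (\<Sum>k=m..<n. (d k * cinner y (f k)) *\<^sub>C e k))\<^sup>2
          \<le> B\<^sup>2 * (\<Sum>k=m..<n. (cmod (cinner y (f k)))\<^sup>2)"
        by (rule norm_partial_sum) (auto simp: B)
      also have "\<dots> < B\<^sup>2 * (\<epsilon>\<^sup>2 / B\<^sup>2)"
        using M[OF that, of n] B(1) by (intro mult_strict_left_mono) auto
      also have "\<dots> = \<epsilon>\<^sup>2" using B(1) by simp
      finally show ?thesis using \<open>\<epsilon> > 0\<close> by (simp add: power2_less_imp_less)
    qed
    thus "\<exists>M. \<forall>m\<ge>M. \<forall>n. norm (\<Sum>k=m..<n. (d k * cinner y (f k)) *\<^sub>C e k) < \<epsilon>" by blast
  qed
qed

lemma norm_series_le:
  assumes "\<And>n. cinner y (f n) \<noteq> 0 \<Longrightarrow> cmod (d n) \<le> B" "0 \<le> B"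
  shows "norm (\<Sum>n. (d n * cinner y (f n)) *\<^sub>C e n) \<le> B * norm y"
proof (rule LIMSEQ_le_const2)
  show "(\<lambda>m. norm (\<Sum>n<m. (d n * cinner y (f n)) *\<^sub>C e n))
      \<longlonglongrightarrow> norm (\<Sum>n. (d n * cinner y (f n)) *\<^sub>C e n)"
    by (intro tendsto_norm summable_LIMSEQ summable_series)
  have "norm (\<Sum>n<m. (d n * cinner y (f n)) *\<^sub>C e n) \<le> B * norm y" for m
  proof (rule power2_le_imp_le)
    have "(norm (\<Sum>n<m. (d n * cinner y (f n)) *\<^sub>C e n))\<^sup>2
        \<le> B\<^sup>2 * (\<Sum>n<m. (cmod (cinner y (f n)))\<^sup>2)"
      by (rule norm_partial_sum) (use assms in auto)
    also have "\<dots> \<le> B\<^sup>2 * (norm y)\<^sup>2"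
      by (intro mult_left_mono bessel[OF f]) auto
    finally show "(norm (\<Sum>n<m. (d n * cinner y (f n)) *\<^sub>C e n))\<^sup>2 \<le> (B * norm y)\<^sup>2"
      by (simp add: power_mult_distrib)
  qed (use assms in simp)
  thus "\<exists>N. \<forall>m\<ge>N. norm (\<Sum>n<m. (d n * cinner y (f n)) *\<^sub>C e n) \<le> B * norm y" by blast
qed

lemma apply_eq: "blinfun_apply (diagonal_op d f e) y = (\<Sum>n. (d n * cinner y (f n)) *\<^sub>C e n)"
proof -
  obtain B where B: "B > 0" "\<And>n. cmod (d n) \<le> B"
    using d unfolding bounded_pos by auto
  have "bounded_linear (\<lambda>y. \<Sum>n. (d n * cinner y (f n)) *\<^sub>C e n)"
  proof (rule bounded_linear_intro[where K = B])
    fix x y :: 'a and r :: real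
    show "(\<Sum>n. (d n * cinner (x + y) (f n)) *\<^sub>C e n) =
        (\<Sum>n. (d n * cinner x (f n)) *\<^sub>C e n) + (\<Sum>n. (d n * cinner y (f n)) *\<^sub>C e n)"
      by (subst suminf_add[OF summable_series summable_series])
        (simp add: cinner_add_left distrib_left scaleC_add_left)
    show "(\<Sum>n. (d n * cinner (r *\<^sub>R x) (f n)) *\<^sub>C e n) = r *\<^sub>R (\<Sum>n. (d n * cinner x (f n)) *\<^sub>C e n)"
      by (subst suminf_scaleR_right[OF summable_series])
        (simp add: cinner_scaleC_left scaleC_of_real[symmetric] scaleC_scaleC mult_ac)
    show "norm (\<Sum>n. (d n * cinner x (f n)) *\<^sub>C e n) \<le> norm x * B"
      using norm_series_le[of x B] B by (simp add: mult.commute)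
  qed
  thus ?thesis unfolding diagonal_op_def by (simp add: bounded_linear_Blinfun_apply)
qed

lemma sums: "(\<lambda>n. (d n * cinner y (f n)) *\<^sub>C e n) sums blinfun_apply (diagonal_op d f e) y"
  unfolding apply_eq by (rule summable_sums[OF summable_series])

lemma norm_apply_le:
  assumes "\<And>n. cinner y (f n) \<noteq> 0 \<Longrightarrow> cmod (d n) \<le> B" "0 \<le> B"
  shows "norm (blinfun_apply (diagonal_op d f e) y) \<le> B * norm y"
  unfolding apply_eq by (rule norm_series_le) (use assms in auto)

lemma bounded_op: "diagonal_op d f e \<in> bounded_ops"
  unfolding bounded_ops_def
proof (intro CollectI allI)
  fix c :: complex and x :: 'a
  have "(\<lambda>n. c *\<^sub>C ((d n * cinner x (f n)) *\<^sub>C e n)) sums (c *\<^sub>C blinfun_apply (diagonal_op d f e) x)"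
    by (rule bounded_linear.sums[OF bounded_linear_scaleC sums])
  hence "(\<lambda>n. (d n * cinner (c *\<^sub>C x) (f n)) *\<^sub>C e n) sums (c *\<^sub>C blinfun_apply (diagonal_op d f e) x)"
    by (simp add: cinner_scaleC_left scaleC_scaleC mult_ac)
  thus "blinfun_apply (diagonal_op d f e) (c *\<^sub>C x) = c *\<^sub>C blinfun_apply (diagonal_op d f e) x"
    using sums[of "c *\<^sub>C x"] sums_unique2 by blast
qed

lemma apply_basis: "blinfun_apply (diagonal_op d f e) (f m) = (if f m = 0 then 0 else d m *\<^sub>C e m)"
proof (cases "f m = 0")
  case False
  have "(\<lambda>n. (d n * cinner (f m) (f n)) *\<^sub>C e n) sums ((d m * cinner (f m) (f m)) *\<^sub>C e m)"
    by (rule sums_finite[of "{m}", simplified])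
      (auto simp: partial_orthonormal_cinner[OF f])
  thus ?thesis using sums[of "f m"] False sums_unique2
    by (fastforce simp: partial_orthonormal_cinner[OF f])
qed (simp add: blinfun.zero_right)

lemma apply_orthogonal: "(\<And>n. cinner y (f n) = 0) \<Longrightarrow> blinfun_apply (diagonal_op d f e) y = 0"
  by (simp add: apply_eq)

lemma cinner_sums: "(\<lambda>n. d n * cinner y (f n) * cinner (e n) z) sums
    cinner (blinfun_apply (diagonal_op d f e) y) z"
  using bounded_linear.sums[OF bounded_linear_cinner_left sums[of y], of z]
  by (simp add: cinner_scaleC_left)

end

lemma diagonal_cnj: "diagonal d f e \<Longrightarrow> diagonal (\<lambda>n. cnj (d n)) e f"
  unfolding diagonal_def bounded_iff by simp

lemma cinner_diagonal_op_left:
  assumes "diagonal d f e"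
  shows "cinner (blinfun_apply (diagonal_op d f e) y) z
    = cinner y (blinfun_apply (diagonal_op (\<lambda>n. cnj (d n)) e f) z)"
proof -
  have "(\<lambda>n. cnj (cnj (d n) * cinner z (e n) * cinner (f n) y)) sums
      cnj (cinner (blinfun_apply (diagonal_op (\<lambda>n. cnj (d n)) e f) z) y)"
    unfolding sums_cnj by (rule diagonal.cinner_sums[OF diagonal_cnj[OF assms]])
  moreover have "(\<lambda>n. cnj (cnj (d n) * cinner z (e n) * cinner (f n) y))
      = (\<lambda>n. d n * cinner y (f n) * cinner (e n) z)"
    using cinner_commute[of "e _" z] cinner_commute[of y "f _"] by (simp add: mult_ac)
  ultimately show ?thesis
    using sums_unique2[OF diagonal.cinner_sums[OF assms, of y z]]
    by (simp only: cinner_commute[of y, symmetric])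
qed

text \<open>An operator is determined by its values on an orthonormal system and on the orthogonal
  complement of the system; this replaces all direct comparisons of series.\<close>

lemma bounded_op_eqI:
  fixes A B :: "'a::complex_hilbert \<Rightarrow>\<^sub>L 'a" and f :: "nat \<Rightarrow> 'a"
  assumes f: "partial_orthonormal f" and AB: "A \<in> bounded_ops" "B \<in> bounded_ops"
    and basis: "\<And>n. blinfun_apply A (f n) = blinfun_apply B (f n)"
    and orth: "\<And>y. (\<And>n. cinner y (f n) = 0) \<Longrightarrow> blinfun_apply A y = blinfun_apply B y"
  shows "A = B"
proof (rule blinfun_eqI)
  fix y
  interpret P: diagonal "\<lambda>_. 1" f f by unfold_locales (use f in auto)
  let ?P = "blinfun_apply (diagonal_op (\<lambda>_. 1) f f)"
  have app: "(\<lambda>n. cinner y (f n) *\<^sub>C blinfun_apply T (f n)) sums blinfun_apply T (?P y)"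
    if "T \<in> bounded_ops" for T
    using bounded_linear.sums[OF blinfun.bounded_linear_right P.sums[of y], of T]
    by (simp add: bounded_ops_scaleC[OF that])
  have "blinfun_apply A (?P y) = blinfun_apply B (?P y)"
    using app[OF AB(1)] app[OF AB(2)] sums_unique2 by (simp add: basis)
  moreover have "blinfun_apply A (y - ?P y) = blinfun_apply B (y - ?P y)"
  proof (rule orth)
    fix n
    have "cinner (?P y) (f n) = cinner y (?P (f n))"
      using cinner_diagonal_op_left[OF P.diagonal_axioms] by simp
    thus "cinner (y - ?P y) (f n) = 0"
      by (auto simp: cinner_diff_left P.apply_basis split: if_splits)
  qed
  ultimately show "blinfun_apply A y = blinfun_apply B y"
    by (simp add: blinfun.diff_right)
qed

subsection \<open>The spectral theorem for compact self-adjoint operators\<close>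

definition rank_one :: "'a::complex_hilbert \<Rightarrow> ('a \<Rightarrow>\<^sub>L 'a)" where
  "rank_one h = Blinfun (\<lambda>y. cinner y h *\<^sub>C h)"

lemma rank_one_apply [simp]: "blinfun_apply (rank_one h) y = cinner y h *\<^sub>C h"
proof -
  have "bounded_linear (\<lambda>y. cinner y h *\<^sub>C h)"
  proof (rule bounded_linear_intro[where K = "norm h * norm h"])
    fix x y :: 'a and r :: real
    show "cinner (x + y) h *\<^sub>C h = cinner x h *\<^sub>C h + cinner y h *\<^sub>C h"
      by (simp add: cinner_add_left scaleC_add_left)
    show "cinner (r *\<^sub>R x) h *\<^sub>C h = r *\<^sub>R cinner x h *\<^sub>C h"
      by (simp add: cinner_scaleC_left scaleC_of_real[symmetric] scaleC_scaleC)
    show "norm (cinner x h *\<^sub>C h) \<le> norm x * (norm h * norm h)"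
      using mult_right_mono[OF cinner_Cauchy_Schwarz[of x h] norm_ge_zero[of h]]
      by (simp add: mult.assoc)
  qed
  thus ?thesis by (simp add: rank_one_def bounded_linear_Blinfun_apply)
qed

lemma rank_one_bounded_ops: "rank_one h \<in> bounded_ops"
  by (simp add: bounded_ops_def cinner_scaleC_left scaleC_scaleC)

lemma rank_one_compact: "compact_op (rank_one h)"
proof -
  let ?K = "(\<lambda>c. c *\<^sub>C h) ` cball 0 (norm h)"
  have "bounded_linear (\<lambda>c. c *\<^sub>C h)"
    by (rule bounded_linear_intro[where K = "norm h"])
      (simp_all add: scaleC_add_left scaleC_of_real[symmetric] scaleC_scaleC scaleR_conv_of_real)
  hence "compact ?K"
    by (rule compact_continuous_image[OF linear_continuous_on compact_cball])
  moreover have "blinfun_apply (rank_one h) ` cball 0 1 \<subseteq> ?K"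
  proof safe
    fix x :: 'a assume "x \<in> cball 0 1"
    hence "cmod (cinner x h) \<le> norm h"
      using cinner_Cauchy_Schwarz[of x h] mult_right_mono[of "norm x" 1 "norm h"] by simp
    thus "blinfun_apply (rank_one h) x \<in> ?K" by (simp, intro imageI) simp
  qed
  ultimately show ?thesis unfolding compact_op_iff by blast
qed

lemma selfadjoint_op_diff: "selfadjoint_op S \<Longrightarrow> selfadjoint_op T \<Longrightarrow> selfadjoint_op (S - T)"
  by (simp add: selfadjoint_op_def minus_blinfun.rep_eq cinner_diff_left cinner_diff_right)

lemma selfadjoint_op_rank_one: "selfadjoint_op (r *\<^sub>R rank_one h)"
  unfolding selfadjoint_op_def
  by (simp add: scaleR_blinfun.rep_eq cinner_scaleC_left cinner_scaleC_right
      cinner_scaleR_left cinner_scaleR_right cinner_commute[symmetric])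

lemma compact_op_scaleR: "compact_op T \<Longrightarrow> compact_op (r *\<^sub>R T)"
proof -
  assume "compact_op T"
  hence "compact_op ((r *\<^sub>R id_blinfun) o\<^sub>L T)" by (rule compact_op_compose_left)
  moreover have "(r *\<^sub>R id_blinfun) o\<^sub>L T = r *\<^sub>R T"
    by (rule blinfun_eqI) (simp add: scaleR_blinfun.rep_eq)
  ultimately show ?thesis by simp
qed

text \<open>The norm is attained: for unit vectors with \<open>\<parallel>K y\<^sub>n\<parallel> \<rightarrow> \<parallel>K\<parallel>\<close> the vectors
  \<open>K\<^sup>2 y\<^sub>n - \<parallel>K\<parallel>\<^sup>2 y\<^sub>n\<close> tend to zero, so compactness produces an eigenvector of \<open>K\<^sup>2\<close>, and
  \<open>K\<^sup>2 - \<parallel>K\<parallel>\<^sup>2\<close> factors.\<close>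

lemma compact_selfadjoint_eigenvector:
  fixes K :: "'a::complex_hilbert \<Rightarrow>\<^sub>L 'a"
  assumes K: "compact_op K" "selfadjoint_op K" and nz: "K \<noteq> 0"
  shows "\<exists>l h. blinfun_apply K h = l *\<^sub>R h \<and> \<bar>l\<bar> = norm K \<and> norm h = 1"
proof -
  define M where "M = norm K"
  let ?K = "blinfun_apply K"
  have M: "M > 0" using nz by (simp add: M_def)
  have sa: "cinner (?K x) y = cinner x (?K y)" for x y
    using K(2) by (simp add: selfadjoint_op_def)
  have near: "\<exists>x. norm x = 1 \<and> M - 1 / Suc n \<le> norm (?K x)" for n
  proof (rule ccontr)
    assume "\<not> ?thesis"
    hence *: "\<And>x. norm x = 1 \<Longrightarrow> norm (?K x) < M - 1 / Suc n" by force
    have ex: "norm (?K x) \<le> (M - 1 / Suc n) * norm x \<and> 0 \<le> M - 1 / Suc n" if "x \<noteq> 0" for x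
    proof -
      have "norm ((1 / norm x) *\<^sub>R x) = 1" using that by simp
      from *[OF this] have **: "norm (?K x) / norm x < M - 1 / Suc n"
        by (simp add: blinfun.scaleR_right)
      moreover have "0 \<le> norm (?K x) / norm x" by simp
      ultimately have "0 \<le> M - 1 / Suc n" by linarith
      thus ?thesis using ** that by (simp add: field_simps)
    qed
    obtain x0 :: 'a where "x0 \<noteq> 0"
      using nz by (metis blinfun.zero_right blinfun_eqI zero_blinfun.rep_eq)
    have "norm K \<le> M - 1 / Suc n"
    proof (rule norm_blinfun_bound)
      show "0 \<le> M - 1 / Suc n" using ex[OF \<open>x0 \<noteq> 0\<close>] by blast
      show "norm (?K x) \<le> (M - 1 / Suc n) * norm x" for x
        using ex[of x] by (cases "x = 0") (auto simp: blinfun.zero_right)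
    qed
    thus False by (simp add: M_def)
  qed
  obtain X where X: "\<And>n. norm (X n) = 1" and XM: "\<And>n. M - 1 / Suc n \<le> norm (?K (X n))"
    using near by metis
  have XM': "norm (?K (X n)) \<le> M" for n
    using norm_blinfun[of K "X n"] X by (simp add: M_def)
  have lim: "(\<lambda>n. norm (?K (X n))) \<longlonglongrightarrow> M"
  proof (rule real_tendsto_sandwich)
    show "(\<lambda>n. M - 1 / Suc n) \<longlonglongrightarrow> M"
      using tendsto_diff[OF tendsto_const[of M] LIMSEQ_inverse_real_of_nat]
      by (simp add: inverse_eq_divide)
  qed (use XM XM' in auto)
  obtain l r where r: "strict_mono (r :: nat \<Rightarrow> nat)" "(\<lambda>n. ?K (X (r n))) \<longlonglongrightarrow> l"
    using compact_op_convergent_subseq[OF K(1), of X] X by auto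
  have "(\<lambda>n. ?K (?K (X (r n))) - M\<^sup>2 *\<^sub>R X (r n)) \<longlonglongrightarrow> 0"
  proof (rule Lim_null_comparison)
    show "(\<lambda>n. sqrt (M ^ 4 - M\<^sup>2 * (norm (?K (X (r n))))\<^sup>2)) \<longlonglongrightarrow> 0"
    proof -
      have "(\<lambda>n. norm (?K (X (r n)))) \<longlonglongrightarrow> M"
        using LIMSEQ_subseq_LIMSEQ[OF lim r(1)] by (simp add: o_def)
      hence "(\<lambda>n. sqrt (M ^ 4 - M\<^sup>2 * (norm (?K (X (r n))))\<^sup>2)) \<longlonglongrightarrow> sqrt (M ^ 4 - M\<^sup>2 * M\<^sup>2)"
        by (intro tendsto_intros)
      thus ?thesis by (simp add: power2_eq_square power4_eq_xxxx)
    qed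
    have "norm (?K (?K x) - M\<^sup>2 *\<^sub>R x) \<le> sqrt (M ^ 4 - M\<^sup>2 * (norm (?K x))\<^sup>2)" if "norm x = 1" for x
    proof (rule real_le_rsqrt)
      have "cinner (?K (?K x)) x = complex_of_real ((norm (?K x))\<^sup>2)"
        by (simp only: sa cinner_self)
      hence "(norm (?K (?K x) - M\<^sup>2 *\<^sub>R x))\<^sup>2 = (norm (?K (?K x)))\<^sup>2 + M ^ 4 - 2 * (M\<^sup>2 * (norm (?K x))\<^sup>2)"
        by (simp add: norm_diff_square cinner_scaleR_right that power_mult_distrib)
      also have "(norm (?K (?K x)))\<^sup>2 \<le> (M * norm (?K x))\<^sup>2"
        unfolding M_def by (intro power_mono norm_blinfun) simp
      finally show "(norm (?K (?K x) - M\<^sup>2 *\<^sub>R x))\<^sup>2 \<le> M ^ 4 - M\<^sup>2 * (norm (?K x))\<^sup>2"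
        by (simp add: power_mult_distrib)
    qed
    thus "\<forall>\<^sub>F n in sequentially. norm (?K (?K (X (r n))) - M\<^sup>2 *\<^sub>R X (r n))
        \<le> sqrt (M ^ 4 - M\<^sup>2 * (norm (?K (X (r n))))\<^sup>2)"
      using X by simp
  qed
  moreover have KK: "(\<lambda>n. ?K (?K (X (r n)))) \<longlonglongrightarrow> ?K l"
    by (rule blinfun.tendsto[OF tendsto_const r(2)])
  ultimately have "(\<lambda>n. ?K (?K (X (r n))) - (?K (?K (X (r n))) - M\<^sup>2 *\<^sub>R X (r n))) \<longlonglongrightarrow> ?K l - 0"
    by (intro tendsto_diff)
  hence "(\<lambda>n. (1 / M\<^sup>2) *\<^sub>R (M\<^sup>2 *\<^sub>R X (r n))) \<longlonglongrightarrow> (1 / M\<^sup>2) *\<^sub>R ?K l"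
    by (intro tendsto_scaleR tendsto_const) simp
  hence Xr: "(\<lambda>n. X (r n)) \<longlonglongrightarrow> (1 / M\<^sup>2) *\<^sub>R ?K l" using M by simp
  define x where "x = (1 / M\<^sup>2) *\<^sub>R ?K l"
  have nx: "norm x = 1"
    using tendsto_norm[OF Xr] unfolding X x_def LIMSEQ_const_iff by (rule sym)
  have "?K x = l"
    using LIMSEQ_unique[OF blinfun.tendsto[OF tendsto_const Xr] r(2)] by (simp add: x_def)
  hence KKx: "?K (?K x) = (M * M) *\<^sub>R x" using M by (simp add: x_def power2_eq_square)
  show ?thesis
  proof (cases "?K x = - M *\<^sub>R x")
    case True
    thus ?thesis using nx M by (intro exI[of _ "-M"] exI[of _ x]) (simp add: M_def)
  next
    case False
    define z where "z = ?K x + M *\<^sub>R x"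
    have "z \<noteq> 0" using False by (simp add: z_def add_eq_0_iff2)
    moreover have "?K z = M *\<^sub>R z"
      by (simp add: z_def blinfun.add_right blinfun.scaleR_right KKx scaleR_add_right)
    ultimately show ?thesis using M
      by (intro exI[of _ M] exI[of _ "(1 / norm z) *\<^sub>R z"])
        (simp add: M_def blinfun.scaleR_right)
  qed
qed

text \<open>Repeatedly splitting off an eigenvector that attains the norm lists the eigenvalues in
  decreasing order of modulus; compactness forces them to tend to zero, because the images of
  orthonormal eigenvectors stay apart as long as the eigenvalues do not become small.\<close>

theorem spectral_theorem:
  fixes K :: "'a::complex_hilbert \<Rightarrow>\<^sub>L 'a"
  assumes K: "K \<in> bounded_ops" "compact_op K" "selfadjoint_op K"
  obtains l :: "nat \<Rightarrow> real" and h where "partial_orthonormal h" "decseq (\<lambda>n. \<bar>l n\<bar>)"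
    "l \<longlonglongrightarrow> 0" "\<And>n. h n = 0 \<longleftrightarrow> l n = 0" "K = diagonal_op (\<lambda>n. complex_of_real (l n)) h h"
proof -
  define good where "good = (\<lambda>(L :: 'a \<Rightarrow>\<^sub>L 'a, l :: real, h).
      L \<in> bounded_ops \<and> compact_op L \<and> selfadjoint_op L \<and> blinfun_apply L h = l *\<^sub>R h \<and>
      \<bar>l\<bar> = norm L \<and> (if L = 0 then h = 0 else norm h = 1))"
  have extend: "\<exists>l h. good (L, l, h)"
    if "L \<in> bounded_ops" "compact_op L" "selfadjoint_op L" for L
  proof (cases "L = 0")
    case True
    thus ?thesis using that by (intro exI[of _ 0]) (auto simp: good_def)
  next
    case False
    thus ?thesis using that compact_selfadjoint_eigenvector[OF that(2,3) False]
      by (auto simp: good_def)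
  qed
  have "\<exists>F. \<forall>n. (good (F n) \<and> (n = 0 \<longrightarrow> fst (F n) = K)) \<and>
      fst (F (Suc n)) = fst (F n) - fst (snd (F n)) *\<^sub>R rank_one (snd (snd (F n)))"
  proof (rule dependent_nat_choice)
    show "\<exists>x. good x \<and> (0 = 0 \<longrightarrow> fst x = K)"
      using extend[OF K] by force
  next
    fix x and n :: nat
    assume x: "good x \<and> (n = 0 \<longrightarrow> fst x = K)"
    obtain L l h where [simp]: "x = (L, l, h)" by (cases x)
    have "L - l *\<^sub>R rank_one h \<in> bounded_ops" "compact_op (L - l *\<^sub>R rank_one h)"
        "selfadjoint_op (L - l *\<^sub>R rank_one h)"
      using x by (auto simp: good_def intro!: bounded_ops_intros rank_one_bounded_ops compact_op_diff
          compact_op_scaleR rank_one_compact selfadjoint_op_diff selfadjoint_op_rank_one)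
    from extend[OF this] show "\<exists>y. (good y \<and> (Suc n = 0 \<longrightarrow> fst y = K)) \<and>
        fst y = fst x - fst (snd x) *\<^sub>R rank_one (snd (snd x))"
      by force
  qed
  then obtain F where F: "\<And>n. good (F n)" "fst (F 0) = K"
      "\<And>n. fst (F (Suc n)) = fst (F n) - fst (snd (F n)) *\<^sub>R rank_one (snd (snd (F n)))" by blast
  define L l h where "L = (\<lambda>n. fst (F n))" and "l = (\<lambda>n. fst (snd (F n)))"
    and "h = (\<lambda>n. snd (snd (F n)))"
  have L0: "L 0 = K" and LS: "\<And>n. L (Suc n) = L n - l n *\<^sub>R rank_one (h n)"
    using F by (simp_all add: L_def l_def h_def)
  have good: "L n \<in> bounded_ops" "compact_op (L n)" "selfadjoint_op (L n)"
      "blinfun_apply (L n) (h n) = l n *\<^sub>R h n" "\<bar>l n\<bar> = norm (L n)"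
      "L n = 0 \<Longrightarrow> h n = 0" "L n \<noteq> 0 \<Longrightarrow> norm (h n) = 1" for n
    using F(1)[of n] by (auto simp: good_def L_def l_def h_def split: prod.splits if_splits)
  have sa: "cinner (blinfun_apply (L n) x) y = cinner x (blinfun_apply (L n) y)" for n x y
    using good(3)[of n] by (simp add: selfadjoint_op_def)
  have h0: "h n = 0 \<longleftrightarrow> l n = 0" for n
    using good(5-7)[of n] by (cases "L n = 0") auto
  have nh: "norm (h n) \<le> 1" for n using good(6,7)[of n] by (cases "L n = 0") auto
  have LSa: "blinfun_apply (L (Suc n)) y = blinfun_apply (L n) y - (l n * cinner y (h n)) *\<^sub>C h n" for n y
    by (simp add: LS minus_blinfun.rep_eq scaleR_blinfun.rep_eq scaleC_of_real[symmetric] scaleC_scaleC)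
  have kill: "blinfun_apply (L n) (h i) = 0" if "i < n" for i n
    using that
  proof (induction n)
    case (Suc n)
    show ?case
    proof (cases "i = n")
      case True
      have "l n * cinner (h n) (h n) = l n"
        using good(6,7)[of n] h0[of n] by (cases "L n = 0") (auto simp: cinner_self)
      thus ?thesis using True by (simp only: LSa good(4) scaleC_of_real) simp
    next
      case False
      hence "blinfun_apply (L n) (h i) = 0" using Suc by simp
      hence "cinner (h i) (l n *\<^sub>R h n) = 0" using sa[of n "h i" "h n"] by (simp add: good(4))
      thus ?thesis using \<open>blinfun_apply (L n) (h i) = 0\<close>
        by (simp add: LSa cinner_scaleR_right)
    qed
  qed simp
  have orth: "cinner (h i) (h n) = 0" if "i < n" for i n
  proof (cases "l n = 0")
    case False
    have "cinner (h i) (l n *\<^sub>R h n) = 0"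
      using sa[of n "h i" "h n"] kill[OF that] by (simp add: good(4))
    thus ?thesis using False by (simp add: cinner_scaleR_right)
  next
    case True
    hence "h n = 0" using h0 by blast
    thus ?thesis by simp
  qed
  have po: "partial_orthonormal h"
    unfolding partial_orthonormal_def
  proof (intro conjI allI impI)
    fix i j :: nat assume "i \<noteq> j"
    thus "cinner (h i) (h j) = 0"
      using orth[of i j] orth[of j i] cinner_commute[of "h i" "h j"] by (cases "i < j") auto
  next
    show "h i = 0 \<or> norm (h i) = 1" for i using good(6,7)[of i] by blast
  qed
  have dec: "decseq (\<lambda>n. \<bar>l n\<bar>)"
  proof (rule decseq_SucI)
    fix n
    have "norm (L (Suc n)) \<le> norm (L n)"
    proof (rule norm_blinfun_bound)
      fix y
      have "blinfun_apply (L (Suc n)) y = blinfun_apply (L n) (y - cinner y (h n) *\<^sub>C h n)"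
        by (simp add: LSa blinfun.diff_right bounded_ops_scaleC good(1,4) scaleC_of_real[symmetric]
            scaleC_scaleC mult.commute)
      hence 1: "norm (blinfun_apply (L (Suc n)) y) \<le> norm (L n) * norm (y - cinner y (h n) *\<^sub>C h n)"
        by (simp add: norm_blinfun)
      have "(norm (y - cinner y (h n) *\<^sub>C h n))\<^sup>2
          = (norm y)\<^sup>2 + (cmod (cinner y (h n)) * norm (h n))\<^sup>2 - 2 * (cmod (cinner y (h n)))\<^sup>2"
      proof -
        have "cnj (cinner y (h n)) * cinner y (h n) = complex_of_real ((cmod (cinner y (h n)))\<^sup>2)"
          by (simp add: complex_norm_square mult.commute del: of_real_power)
        thus ?thesis by (simp add: norm_diff_square cinner_scaleC_right)
      qed
      also have "(cmod (cinner y (h n)) * norm (h n))\<^sup>2 \<le> (cmod (cinner y (h n)) * 1)\<^sup>2"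
        by (intro power_mono mult_left_mono nh) auto
      finally have "(norm (y - cinner y (h n) *\<^sub>C h n))\<^sup>2
          \<le> (norm y)\<^sup>2 + (cmod (cinner y (h n)) * 1)\<^sup>2 - 2 * (cmod (cinner y (h n)))\<^sup>2"
        by simp
      hence "(norm (y - cinner y (h n) *\<^sub>C h n))\<^sup>2 \<le> (norm y)\<^sup>2"
        using zero_le_power2[of "cmod (cinner y (h n))"] unfolding mult_1_right by linarith
      hence "norm (y - cinner y (h n) *\<^sub>C h n) \<le> norm y" by (rule power2_le_imp_le) simp
      hence "norm (L n) * norm (y - cinner y (h n) *\<^sub>C h n) \<le> norm (L n) * norm y"
        by (rule mult_left_mono) simp
      thus "norm (blinfun_apply (L (Suc n)) y) \<le> norm (L n) * norm y" using 1 by linarith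
    qed simp
    thus "\<bar>l (Suc n)\<bar> \<le> \<bar>l n\<bar>" by (simp add: good(5))
  qed
  have Kh: "blinfun_apply K y = blinfun_apply (L n) y" if "\<And>i. i < n \<Longrightarrow> cinner y (h i) = 0" for y n
    using that by (induction n) (auto simp: L0 LSa)
  have eig: "blinfun_apply K (h n) = l n *\<^sub>R h n" for n
    using Kh[of n "h n"] orth cinner_commute[of "h n"] by (simp add: good(4))
  have lim: "l \<longlonglongrightarrow> 0"
  proof (rule ccontr)
    assume "\<not> l \<longlonglongrightarrow> 0"
    then obtain \<epsilon> where \<epsilon>: "\<epsilon> > 0" "\<And>n. \<exists>m\<ge>n. \<epsilon> \<le> \<bar>l m\<bar>"
      unfolding LIMSEQ_def by (auto simp: not_less)
    have big: "\<epsilon> \<le> \<bar>l n\<bar>" for n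
      using \<epsilon>(2)[of n] dec unfolding decseq_def by (metis order_trans)
    obtain v r where r: "strict_mono (r :: nat \<Rightarrow> nat)" "(\<lambda>n. blinfun_apply K (h (r n))) \<longlonglongrightarrow> v"
      using compact_op_convergent_subseq[OF K(2), of h] nh by auto
    hence "Cauchy (\<lambda>n. blinfun_apply K (h (r n)))" using LIMSEQ_imp_Cauchy by blast
    from metric_CauchyD[OF this \<epsilon>(1)] obtain N where N: "\<And>m n. m \<ge> N \<Longrightarrow> n \<ge> N \<Longrightarrow>
        dist (blinfun_apply K (h (r m))) (blinfun_apply K (h (r n))) < \<epsilon>"
      by auto
    define p q where "p = r N" and "q = r (Suc N)"
    have pq: "p < q" using r(1) by (simp add: p_def q_def strict_mono_def)
    have n1: "norm (h p) = 1"
      using good(6,7)[of p] h0[of p] big[of p] \<epsilon>(1) by auto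
    have "(norm (blinfun_apply K (h p) - blinfun_apply K (h q)))\<^sup>2
        = (norm (l p *\<^sub>R h p))\<^sup>2 + (norm (l q *\<^sub>R h q))\<^sup>2"
      unfolding eig norm_diff_square by (simp add: cinner_scaleR_left cinner_scaleR_right orth[OF pq])
    also have "\<dots> \<ge> \<epsilon>\<^sup>2"
    proof -
      have "\<epsilon>\<^sup>2 \<le> \<bar>l p\<bar>\<^sup>2" using \<epsilon>(1) big[of p] by (intro power_mono) auto
      thus ?thesis by (simp add: n1 add_increasing2)
    qed
    finally have "\<epsilon> \<le> norm (blinfun_apply K (h p) - blinfun_apply K (h q))"
      by (rule power2_le_imp_le) simp
    thus False using N[of N "Suc N"] by (simp add: p_def q_def dist_norm)
  qed
  have bd: "bounded (range (\<lambda>n. complex_of_real (l n)))"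
    using dec by (intro boundedI[of _ "\<bar>l 0\<bar>"]) (auto simp: decseq_def)
  interpret D: diagonal "\<lambda>n. complex_of_real (l n)" h h by unfold_locales (use po bd in auto)
  have "K = diagonal_op (\<lambda>n. complex_of_real (l n)) h h"
  proof (rule bounded_op_eqI[OF po K(1) D.bounded_op])
    show "blinfun_apply K (h n) = blinfun_apply (diagonal_op (\<lambda>n. complex_of_real (l n)) h h) (h n)" for n
      by (simp add: eig D.apply_basis scaleC_of_real)
  next
    fix y assume y: "\<And>n. cinner y (h n) = 0"
    have "norm (blinfun_apply K y) \<le> \<bar>l n\<bar> * norm y" for n
      using Kh[of n y] y norm_blinfun[of "L n" y] by (simp add: good(5))
    moreover have "(\<lambda>n. \<bar>l n\<bar> * norm y) \<longlonglongrightarrow> 0"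
      using tendsto_mult_left_zero[OF tendsto_rabs_zero[OF lim]] by simp
    ultimately have "norm (blinfun_apply K y) \<le> 0"
      by (intro LIMSEQ_le_const[of _ 0]) auto
    thus "blinfun_apply K y = blinfun_apply (diagonal_op (\<lambda>n. complex_of_real (l n)) h h) y"
      using y by (simp add: D.apply_orthogonal)
  qed
  with po dec lim h0 show ?thesis by (intro that) auto
qed

section \<open>Decreasing rearrangements and symmetric norms\<close>

text \<open>\<open>vanishing c\<close> is convergence to zero for a non-negative family, in the form in which it is
  used: only finitely many members exceed a given positive level.\<close>

definition vanishing :: "('i \<Rightarrow> real) \<Rightarrow> bool" where
  "vanishing c \<longleftrightarrow> (\<forall>i. 0 \<le> c i) \<and> (\<forall>t>0. finite {i. t < c i})"

definition rearr :: "('i \<Rightarrow> real) \<Rightarrow> nat \<Rightarrow> real" where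
  "rearr c = decreasing_enumeration (\<lambda>s. card {i. c i = s})"

lemma vanishing_iff_tendsto: "vanishing c \<longleftrightarrow> (\<forall>n. 0 \<le> c n) \<and> c \<longlonglongrightarrow> 0" for c :: "nat \<Rightarrow> real"
proof -
  have "c \<longlonglongrightarrow> 0" if v: "vanishing c"
  proof (rule LIMSEQ_I)
    fix r :: real assume "0 < r"
    hence "finite {n. r / 2 < c n}" using v unfolding vanishing_def by (meson half_gt_zero)
    then obtain k where "\<forall>n\<in>{n. r / 2 < c n}. n < k" unfolding finite_nat_set_iff_bounded by blast
    hence "\<forall>n\<ge>k. c n \<le> r / 2" by (metis leD mem_Collect_eq not_le)
    moreover have "\<forall>n. 0 \<le> c n" using v by (simp add: vanishing_def)
    ultimately have "\<forall>n\<ge>k. norm (c n - 0) < r" using \<open>0 < r\<close> by fastforce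
    thus "\<exists>k. \<forall>n\<ge>k. norm (c n - 0) < r" by blast
  qed
  moreover have "finite {n. t < c n}" if ct: "c \<longlonglongrightarrow> 0" "0 < t" for t
  proof -
    obtain k where "\<forall>n\<ge>k. c n < t"
      using order_tendstoD(2)[OF ct] unfolding eventually_sequentially by blast
    hence "{n. t < c n} \<subseteq> {..<k}" by (auto simp: not_le[symmetric])
    thus ?thesis by (rule finite_subset) simp
  qed
  ultimately show ?thesis unfolding vanishing_def by blast
qed

lemma vanishing_inj:
  assumes "vanishing c" "inj_on \<pi> {i. d i \<noteq> 0}" "\<And>i. 0 \<le> d i" "\<And>i. d i \<noteq> 0 \<Longrightarrow> d i \<le> c (\<pi> i)"
  shows "vanishing d"
  unfolding vanishing_def
proof (intro conjI allI impI assms(3))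
  fix t :: real assume "t > 0"
  have "inj_on \<pi> {i. t < d i}" by (rule inj_on_subset[OF assms(2)]) (use \<open>t > 0\<close> in auto)
  moreover have "t < c (\<pi> i)" if "t < d i" for i
    using assms(4)[of i] \<open>0 < t\<close> that by linarith
  hence "\<pi> ` {i. t < d i} \<subseteq> {i. t < c i}" by blast
  moreover have "finite {i. t < c i}" using assms(1) \<open>t > 0\<close> by (simp add: vanishing_def)
  ultimately show "finite {i. t < d i}" by (meson finite_imageD finite_subset)
qed

text \<open>The counting function has no mass just below a positive level, because only finitely many
  values lie above half of that level.\<close>

lemma vanishing_gap:
  assumes "vanishing c" "0 < s"
  obtains t where "0 < t" "t < s" "\<And>i. t < c i \<Longrightarrow> s \<le> c i"
proof -
  let ?V = "insert (s / 2) (c ` {i. s / 2 < c i \<and> c i < s})"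
  have "finite {i. s / 2 < c i}" using assms unfolding vanishing_def by (meson half_gt_zero)
  hence "finite {i. s / 2 < c i \<and> c i < s}" by (rule rev_finite_subset) blast
  hence fin: "finite ?V" by simp
  have "Max ?V \<in> ?V" using fin by (intro Max_in) auto
  hence "0 < Max ?V" "Max ?V < s" using assms(2) by auto
  moreover have "s \<le> c i" if "Max ?V < c i" for i
  proof (rule ccontr)
    assume "\<not> s \<le> c i"
    moreover have "s / 2 < c i" using that fin by simp
    ultimately have "c i \<in> ?V" by auto
    thus False using that fin Max_ge[of ?V "c i"] by linarith
  qed
  ultimately show ?thesis using that by blast
qed

text \<open>The multiplicities of the positive values and the counting function above positive levels
  determine each other. The counting function is the one that can be compared and inverted.\<close>

lemma enumeration_spec_iff:
  assumes c: "vanishing c"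
  shows "(decseq f \<and> (\<forall>n. 0 \<le> f n) \<and>
        (\<forall>s>0. finite {n. f n = s} \<and> card {n. f n = s} = card {i. c i = s}))
    \<longleftrightarrow> ((\<forall>n. 0 \<le> f n) \<and> (\<forall>t>0. \<forall>n. t < f n \<longleftrightarrow> n < card {i. t < c i}))" (is "?L \<longleftrightarrow> ?R")
proof
  assume L: ?L
  show ?R
  proof (intro conjI allI impI)
    fix t :: real and n :: nat assume t: "t > 0"
    define V where "V = c ` {i. t < c i}"
    have finV: "finite V" using c t by (simp add: V_def vanishing_def)
    have fin: "finite {i. c i = s}" if "s \<in> V" for s
      using c t that by (intro finite_subset[OF _ c[unfolded vanishing_def, THEN conjunct2, rule_format, OF t]])
        (auto simp: V_def)
    have eq: "{n. t < f n} = (\<Union>s\<in>V. {n. f n = s})"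
    proof safe
      fix n assume n: "t < f n"
      hence "f n > 0" using t by simp
      hence "card {i. c i = f n} = card {m. f m = f n}" "finite {m. f m = f n}" using L by auto
      moreover have "{m. f m = f n} \<noteq> {}" by auto
      ultimately have "card {i. c i = f n} \<noteq> 0" by (metis card_0_eq)
      hence "{i. c i = f n} \<noteq> {}" by (metis card.empty)
      then obtain i where "c i = f n" by auto
      hence "f n \<in> V" using n unfolding V_def by (metis imageI mem_Collect_eq)
      thus "n \<in> (\<Union>s\<in>V. {n. f n = s})" by simp
    qed (auto simp: V_def)
    have ffin: "finite {n. f n = s}" "card {n. f n = s} = card {i. c i = s}" if "s \<in> V" for s
      using L that t by (auto simp: V_def)
    have finf: "finite {n. t < f n}" unfolding eq using finV ffin by auto
    have "card {n. t < f n} = (\<Sum>s\<in>V. card {n. f n = s})"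
      unfolding eq using finV ffin by (intro card_UN_disjoint) auto
    also have "\<dots> = (\<Sum>s\<in>V. card {i. c i = s})" using ffin by simp
    also have "\<dots> = card (\<Union>s\<in>V. {i. c i = s})"
      using finV fin by (intro card_UN_disjoint[symmetric]) auto
    also have "(\<Union>s\<in>V. {i. c i = s}) = {i. t < c i}" by (auto simp: V_def)
    finally have card: "card {n. t < f n} = card {i. t < c i}" .
    have "{n. t < f n} = {..<card {n. t < f n}}"
    proof -
      obtain k where k: "{n. t < f n} = {..<k}"
      proof -
        define k where "k = (LEAST n. \<not> t < f n)"
        have ex: "\<exists>n. \<not> t < f n"
        proof (rule ccontr)
          assume "\<not> ?thesis"
          hence "{n. t < f n} = UNIV" by simp
          thus False using finf by simp
        qed
        have "\<not> t < f k" unfolding k_def using LeastI_ex[OF ex] .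
        have "m < k" if "t < f m" for m
        proof (rule ccontr)
          assume "\<not> m < k"
          hence "f m \<le> f k" using L unfolding decseq_def by simp
          thus False using \<open>\<not> t < f k\<close> that by linarith
        qed
        moreover have "t < f m" if "m < k" for m
          using not_less_Least[of m "\<lambda>n. \<not> t < f n"] that by (auto simp: k_def)
        ultimately have "{n. t < f n} = {..<k}" by auto
        thus ?thesis using that by blast
      qed
      thus ?thesis by simp
    qed
    thus "t < f n \<longleftrightarrow> n < card {i. t < c i}" using card by auto
  qed (use L in auto)
next
  assume R: ?R
  hence lt: "t < f n \<longleftrightarrow> n < card {i. t < c i}" if "t > 0" for t n using that by blast
  show ?L
  proof (intro conjI allI impI)
    show "decseq f"
    proof (rule decseq_SucI, rule ccontr)
      fix n assume "\<not> f (Suc n) \<le> f n"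
      moreover have "0 \<le> f n" using R by simp
      ultimately obtain t where "0 < t" "t < f (Suc n)" "f n < t" by (meson dense le_less_trans not_le)
      thus False using lt[of t n] lt[of t "Suc n"] by simp
    qed
  next
    fix s :: real assume s: "s > 0"
    obtain t where t: "0 < t" "t < s" "\<And>i. t < c i \<Longrightarrow> s \<le> c i"
      using vanishing_gap[OF c s] by blast
    have fin: "finite {i. t < c i}" using c t(1) by (simp add: vanishing_def)
    have ge: "t < f n \<longleftrightarrow> s \<le> f n" for n
    proof
      assume "t < f n"
      show "s \<le> f n"
      proof (rule dense_le_bounded[OF t(2)])
        fix w assume "t < w" "w < s"
        hence "{i. w < c i} = {i. t < c i}" using t(3) by force
        thus "w \<le> f n" using lt[of w n] lt[of t n] t(1) \<open>t < w\<close> \<open>t < f n\<close> by auto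
      qed
    qed (use t(2) in simp)
    have "f n = s \<longleftrightarrow> n < card {i. t < c i} \<and> \<not> n < card {i. s < c i}" for n
      using lt[OF t(1), of n] lt[OF s, of n] ge[of n] by linarith
    hence eqf: "{n. f n = s} = {..<card {i. t < c i}} - {..<card {i. s < c i}}"
      by (intro set_eqI) (simp only: mem_Collect_eq Diff_iff lessThan_iff)
    have "c i = s \<longleftrightarrow> t < c i \<and> \<not> s < c i" for i using t(2) t(3)[of i] by linarith
    hence "{i. c i = s} = {i. t < c i} - {i. s < c i}"
      by (intro set_eqI) (simp only: mem_Collect_eq Diff_iff)
    moreover have "{i. s < c i} \<subseteq> {i. t < c i}" using t(2) by auto
    ultimately have "card {i. c i = s} = card {i. t < c i} - card {i. s < c i}"
      using fin by (simp add: card_Diff_subset finite_subset)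
    moreover have "card {i. s < c i} \<le> card {i. t < c i}"
      using fin t(2) by (intro card_mono) auto
    ultimately show "card {n. f n = s} = card {i. c i = s}"
      unfolding eqf by (subst card_Diff_subset) auto
    show "finite {n. f n = s}" unfolding eqf by simp
  qed (use R in auto)
qed

lemma enumeration_unique:
  fixes f g :: "nat \<Rightarrow> real"
  assumes "\<forall>n. 0 \<le> f n" "\<forall>n. 0 \<le> g n" "\<And>t n. 0 < t \<Longrightarrow> t < f n \<Longrightarrow> t < g n"
  shows "f n \<le> g n"
proof (rule ccontr)
  assume "\<not> f n \<le> g n"
  then obtain t where "g n < t" "t < f n" by (meson dense not_le)
  moreover from this have "0 < t" using assms(2) by (metis le_less_trans)
  ultimately show False using assms(3)[of t n] by simp
qed

text \<open>The generalized inverse of the counting function.\<close>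

lemma enumeration_exists:
  assumes c: "vanishing c"
  shows "\<exists>f. (\<forall>n. 0 \<le> f n) \<and> (\<forall>t>0. \<forall>n. t < f n \<longleftrightarrow> n < card {i. t < (c i :: real)})"
proof -
  define A where "A n = {t. 0 < t \<and> card {i. t < c i} \<le> n}" for n
  have bdd: "bdd_below (A n)" for n by (rule bdd_belowI[of _ 0]) (auto simp: A_def)
  have ne: "A n \<noteq> {}" for n
  proof -
    let ?V = "insert 1 (c ` {i. 1 < c i})"
    have fin: "finite ?V" using c by (simp add: vanishing_def)
    have "{i. Max ?V < c i} = {}"
    proof (intro equals0I, safe)
      fix i assume i: "Max ?V < c i"
      moreover have "1 \<le> Max ?V" using fin by simp
      ultimately have "c i \<in> ?V" by auto
      thus False using i fin Max_ge[of ?V "c i"] by linarith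
    qed
    moreover have "0 < Max ?V" using fin by (intro less_le_trans[OF zero_less_one Max_ge]) auto
    ultimately have "Max ?V \<in> A n" by (simp add: A_def)
    thus ?thesis by blast
  qed
  have "0 \<le> Inf (A n)" for n using ne by (intro cInf_greatest) (auto simp: A_def)
  moreover have "t < Inf (A n) \<longleftrightarrow> n < card {i. t < c i}" if t: "t > 0" for t n
  proof
    assume "t < Inf (A n)"
    hence "t \<notin> A n" using cInf_lower[OF _ bdd] by (metis not_le)
    thus "n < card {i. t < c i}" using t by (simp add: A_def)
  next
    assume n: "n < card {i. t < c i}"
    have fin: "finite {i. t < c i}" using c t by (simp add: vanishing_def)
    have ne': "{i. t < c i} \<noteq> {}" using n by force
    define m where "m = Min (c ` {i. t < c i})"
    have m: "t < m" "\<And>i. t < c i \<Longrightarrow> m \<le> c i"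
      using fin ne' by (auto simp: m_def)
    have "m \<le> Inf (A n)"
    proof (rule cInf_greatest[OF ne])
      fix u assume u: "u \<in> A n"
      show "m \<le> u"
      proof (rule ccontr)
        assume "\<not> m \<le> u"
        hence "{i. t < c i} \<subseteq> {i. u < c i}" using m(2) by force
        moreover have "finite {i. u < c i}" using u c by (simp add: A_def vanishing_def)
        ultimately have "card {i. t < c i} \<le> card {i. u < c i}" by (intro card_mono)
        thus False using u n by (simp add: A_def)
      qed
    qed
    thus "t < Inf (A n)" using m(1) by simp
  qed
  ultimately show ?thesis by (intro exI[of _ "\<lambda>n. Inf (A n)"]) auto
qed

lemma rearr_eqI:
  assumes "vanishing c" "\<forall>n. 0 \<le> f n" "\<And>t n. 0 < t \<Longrightarrow> t < f n \<longleftrightarrow> n < card {i. t < c i}"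
  shows "rearr c = f"
  unfolding rearr_def decreasing_enumeration_def enumeration_spec_iff[OF assms(1)]
proof (rule the_equality)
  fix g assume "(\<forall>n. 0 \<le> g n) \<and> (\<forall>t>0. \<forall>n. t < g n \<longleftrightarrow> n < card {i. t < c i})"
  thus "g = f" using assms(2,3) enumeration_unique[of f g] enumeration_unique[of g f]
    by (intro ext antisym) auto
qed (use assms in auto)

lemma
  assumes "vanishing c"
  shows rearr_nonneg: "0 \<le> rearr c n"
    and rearr_gt_iff: "0 < t \<Longrightarrow> t < rearr c n \<longleftrightarrow> n < card {i. t < c i}"
    and rearr_decseq: "decseq (rearr c)"
    and card_rearr_eq: "0 < s \<Longrightarrow> card {n. rearr c n = s} = card {i. c i = s}"
proof -
  obtain f where f: "(\<forall>n. 0 \<le> f n) \<and> (\<forall>t>0. \<forall>n. t < f n \<longleftrightarrow> n < card {i. t < c i})"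
    using enumeration_exists[OF assms] by blast
  hence "rearr c = f" by (intro rearr_eqI[OF assms]) auto
  thus "0 \<le> rearr c n" "0 < t \<Longrightarrow> t < rearr c n \<longleftrightarrow> n < card {i. t < c i}" "decseq (rearr c)"
      "0 < s \<Longrightarrow> card {n. rearr c n = s} = card {i. c i = s}"
    using f enumeration_spec_iff[OF assms, of f] by auto
qed

lemma card_rearr_gt: "vanishing c \<Longrightarrow> 0 < t \<Longrightarrow> card {n. t < rearr c n} = card {i. t < c i}"
  by (simp add: rearr_gt_iff)

lemma vanishing_rearr: "vanishing c \<Longrightarrow> vanishing (rearr c)"
  by (simp add: vanishing_def rearr_nonneg rearr_gt_iff[unfolded vanishing_def])

lemma rearr_mono:
  assumes "vanishing c" "vanishing d" "\<And>t. 0 < t \<Longrightarrow> card {i. t < c i} \<le> card {j. t < d j}"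
  shows "rearr c n \<le> rearr d n"
  by (rule enumeration_unique)
    (use assms in \<open>auto simp: rearr_nonneg rearr_gt_iff intro: less_le_trans\<close>)

lemma card_gt_inj:
  assumes "vanishing c" "inj_on \<pi> {i. d i \<noteq> 0}" "\<And>i. d i \<noteq> 0 \<Longrightarrow> d i \<le> c (\<pi> i)" "0 < t"
  shows "card {i. t < (d i :: real)} \<le> card {i. t < c i}"
proof (rule card_inj_on_le)
  show "inj_on \<pi> {i. t < d i}" by (rule inj_on_subset[OF assms(2)]) (use assms(4) in auto)
  have "t < c (\<pi> i)" if "t < d i" for i using assms(3)[of i] assms(4) that by linarith
  thus "\<pi> ` {i. t < d i} \<subseteq> {i. t < c i}" by blast
  show "finite {i. t < c i}" using assms(1,4) by (simp add: vanishing_def)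
qed

lemma rearr_decseq_eq:
  assumes "vanishing f" "decseq f"
  shows "rearr f = f"
proof (rule rearr_eqI[OF assms(1)])
  show "\<forall>n. 0 \<le> f n" using assms(1) by (simp add: vanishing_def)
  fix t :: real and n assume "0 < t"
  hence fin: "finite {i. t < f i}" using assms(1) by (simp add: vanishing_def)
  show "t < f n \<longleftrightarrow> n < card {i. t < f i}"
  proof
    assume "t < f n"
    hence "{..n} \<subseteq> {i. t < f i}" using assms(2) unfolding decseq_def by (auto intro: less_le_trans)
    from card_mono[OF fin this] show "n < card {i. t < f i}" by simp
  next
    assume n: "n < card {i. t < f i}"
    show "t < f n"
    proof (rule ccontr)
      assume "\<not> t < f n"
      moreover have "f i \<le> f n" if "n \<le> i" for i using assms(2) that by (simp add: decseq_def)
      ultimately have "i < n" if "t < f i" for i using that by (meson le_less_trans less_le_trans not_le)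
      hence "{i. t < f i} \<subseteq> {..<n}" by blast
      from card_mono[OF _ this] show False using n by simp
    qed
  qed
qed

text \<open>At every positive level the family and its rearrangement have the same finite number of members, so
  that the level sets can be matched.\<close>

lemma rearr_matching:
  assumes "vanishing c"
  obtains \<pi> where "bij_betw \<pi> {n. rearr c n \<noteq> 0} {i. c i \<noteq> 0}"
    "\<And>n. rearr c n \<noteq> 0 \<Longrightarrow> c (\<pi> n) = rearr c n"
proof -
  have "\<exists>p. bij_betw p {n. rearr c n = s} {i. c i = s}" if "0 < s" for s
  proof (rule finite_same_card_bij)
    have "{n. rearr c n = s} \<subseteq> {n. s / 2 < rearr c n}" "{i. c i = s} \<subseteq> {i. s / 2 < c i}"
      using that by auto
    thus "finite {n. rearr c n = s}" "finite {i. c i = s}"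
      using assms vanishing_rearr[OF assms] that finite_subset
      unfolding vanishing_def by (metis half_gt_zero)+
    show "card {n. rearr c n = s} = card {i. c i = s}" by (rule card_rearr_eq[OF assms that])
  qed
  then obtain p where p: "\<And>s. 0 < s \<Longrightarrow> bij_betw (p s) {n. rearr c n = s} {i. c i = s}" by metis
  define \<pi> where "\<pi> n = p (rearr c n) n" for n
  have pos: "0 < rearr c n" if "rearr c n \<noteq> 0" for n
    using rearr_nonneg[OF assms, of n] that by simp
  have val: "c (\<pi> n) = rearr c n" if "rearr c n \<noteq> 0" for n
    using p[OF pos[OF that]] by (auto simp: \<pi>_def bij_betw_def)
  have "inj_on \<pi> {n. rearr c n \<noteq> 0}"
  proof (rule inj_onI)
    fix m n assume mn: "m \<in> {n. rearr c n \<noteq> 0}" "n \<in> {n. rearr c n \<noteq> 0}" and eq: "\<pi> m = \<pi> n"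
    hence "rearr c m = rearr c n" using val[of m] val[of n] by simp
    thus "m = n" using eq p[OF pos, of n] mn by (auto simp: \<pi>_def bij_betw_def inj_on_def)
  qed
  moreover have "\<pi> ` {n. rearr c n \<noteq> 0} = {i. c i \<noteq> 0}"
  proof (intro equalityI subsetI)
    fix i assume "i \<in> {i. c i \<noteq> 0}"
    hence ci: "0 < c i" using assms by (simp add: vanishing_def less_le)
    hence "i \<in> p (c i) ` {n. rearr c n = c i}" using p[OF ci] by (auto simp: bij_betw_def)
    then obtain n where n: "i = p (c i) n" "rearr c n = c i" by blast
    hence "i = \<pi> n" "rearr c n \<noteq> 0" using ci by (auto simp: \<pi>_def)
    thus "i \<in> \<pi> ` {n. rearr c n \<noteq> 0}" by blast
  qed (auto simp: val)
  ultimately have "bij_betw \<pi> {n. rearr c n \<noteq> 0} {i. c i \<noteq> 0}" by (simp add: bij_betw_def)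
  thus ?thesis using that val by blast
qed

subsection \<open>Symmetric norms\<close>

lemma decreasing_rearrangement_eq: "decreasing_rearrangement x = rearr (\<lambda>n. cmod (x n))"
  by (simp add: decreasing_rearrangement_def rearr_def)

lemma c0_iff_vanishing: "x \<in> c0 \<longleftrightarrow> vanishing (\<lambda>n. cmod (x n))"
  unfolding c0_def vanishing_iff_tendsto by (simp add: tendsto_norm_zero_iff)

locale symmetric_norm =
  fixes E :: "(nat \<Rightarrow> complex) set" and N :: "(nat \<Rightarrow> complex) \<Rightarrow> real"
  assumes sn: "symmetrically_normed E N"
begin

text \<open>All sequences that have to be compared are real; the two definitions carry \<open>E\<close> and its norm over
  to real sequences and thereby keep the embedding into the complex numbers out of the estimates.\<close>

definition inE :: "(nat \<Rightarrow> real) \<Rightarrow> bool" where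
  "inE x \<longleftrightarrow> (\<lambda>n. complex_of_real (x n)) \<in> E"

definition NN :: "(nat \<Rightarrow> real) \<Rightarrow> real" where
  "NN x = N (\<lambda>n. complex_of_real (x n))"

lemma inE_vanishing: "inE x \<Longrightarrow> vanishing (\<lambda>n. \<bar>x n\<bar>)"
  using sn c0_iff_vanishing[of "\<lambda>n. complex_of_real (x n)"]
  unfolding symmetrically_normed_def inE_def by auto

lemma NN_nonneg: "inE x \<Longrightarrow> 0 \<le> NN x"
  using sn unfolding symmetrically_normed_def inE_def NN_def by auto

lemma
  assumes "inE x" "inE y"
  shows inE_add: "inE (\<lambda>n. x n + y n)" and NN_add: "NN (\<lambda>n. x n + y n) \<le> NN x + NN y"
  using sn assms unfolding symmetrically_normed_def inE_def NN_def by auto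

lemma
  assumes "inE x"
  shows inE_scale: "inE (\<lambda>n. r * x n)" and NN_scale: "NN (\<lambda>n. r * x n) = \<bar>r\<bar> * NN x"
  using sn assms unfolding symmetrically_normed_def inE_def NN_def by auto

lemma inE_zero: "inE (\<lambda>n. 0)" and NN_zero: "NN (\<lambda>n. 0) = 0"
  using sn unfolding symmetrically_normed_def inE_def NN_def by auto

lemma
  assumes "\<And>i. i \<in> I \<Longrightarrow> inE (x i)" "finite I"
  shows inE_sum: "inE (\<lambda>n. \<Sum>i\<in>I. x i n)" and NN_sum: "NN (\<lambda>n. \<Sum>i\<in>I. x i n) \<le> (\<Sum>i\<in>I. NN (x i))"
proof -
  have "inE (\<lambda>n. \<Sum>i\<in>I. x i n) \<and> NN (\<lambda>n. \<Sum>i\<in>I. x i n) \<le> (\<Sum>i\<in>I. NN (x i))"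
    using assms(2,1)
  proof (induction I rule: finite_induct)
    case empty
    thus ?case by (simp add: inE_zero NN_zero)
  next
    case (insert i I)
    hence IH: "inE (\<lambda>n. \<Sum>j\<in>I. x j n)" "NN (\<lambda>n. \<Sum>j\<in>I. x j n) \<le> (\<Sum>j\<in>I. NN (x j))" "inE (x i)"
      by auto
    show ?case using inE_add[OF IH(3,1)] NN_add[OF IH(3,1)] IH(2) insert.hyps by simp
  qed
  thus "inE (\<lambda>n. \<Sum>i\<in>I. x i n)" "NN (\<lambda>n. \<Sum>i\<in>I. x i n) \<le> (\<Sum>i\<in>I. NN (x i))" by auto
qed

lemma
  assumes "inE x" "vanishing (\<lambda>n. \<bar>y n\<bar>)" "\<And>t. 0 < t \<Longrightarrow> card {n. t < \<bar>y n\<bar>} \<le> card {n. t < \<bar>x n\<bar>}"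
  shows inE_card: "inE y" and NN_card: "NN y \<le> NN x"
proof -
  have "\<forall>n. decreasing_rearrangement (\<lambda>n. complex_of_real (y n)) n
      \<le> decreasing_rearrangement (\<lambda>n. complex_of_real (x n)) n"
    unfolding decreasing_rearrangement_eq using rearr_mono[OF assms(2) inE_vanishing[OF assms(1)] assms(3)]
    by simp
  moreover have "(\<lambda>n. complex_of_real (y n)) \<in> c0" using assms(2) by (simp add: c0_iff_vanishing)
  ultimately show "inE y" "NN y \<le> NN x"
    using sn assms(1) unfolding symmetrically_normed_def inE_def NN_def by blast+
qed

text \<open>An injection of the support along which the values increase can only increase the counting
  function. All comparisons of norms below are made in this way or through the counting function.\<close>

lemma
  assumes "inE x" "inj_on \<pi> {n. y n \<noteq> 0}" "\<And>n. y n \<noteq> 0 \<Longrightarrow> \<bar>y n\<bar> \<le> \<bar>x (\<pi> n)\<bar>"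
  shows inE_inj: "inE y" and NN_inj: "NN y \<le> NN x"
proof -
  have *: "inj_on \<pi> {n. \<bar>y n\<bar> \<noteq> 0}" using assms(2) by simp
  have v: "vanishing (\<lambda>n. \<bar>y n\<bar>)"
    by (rule vanishing_inj[OF inE_vanishing[OF assms(1)] *]) (use assms(3) in auto)
  have c: "card {n. t < \<bar>y n\<bar>} \<le> card {n. t < \<bar>x n\<bar>}" if "0 < t" for t
    by (rule card_gt_inj[OF inE_vanishing[OF assms(1)] * _ that]) (use assms(3) in auto)
  show "inE y" "NN y \<le> NN x"
    using inE_card[OF assms(1) v c] NN_card[OF assms(1) v c] by auto
qed

lemma
  assumes "inE x" "\<And>n. \<bar>y n\<bar> \<le> \<bar>x n\<bar>"
  shows inE_mono: "inE y" and NN_mono: "NN y \<le> NN x"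
  using inE_inj[OF assms(1), of "\<lambda>n. n" y] NN_inj[OF assms(1), of "\<lambda>n. n" y] assms(2) by auto

lemma
  assumes "vanishing (\<lambda>n. \<bar>x n\<bar>)"
  shows inE_rearr: "inE (rearr (\<lambda>n. \<bar>x n\<bar>)) \<longleftrightarrow> inE x"
    and NN_rearr: "inE x \<Longrightarrow> NN (rearr (\<lambda>n. \<bar>x n\<bar>)) = NN x"
proof -
  let ?r = "rearr (\<lambda>n. \<bar>x n\<bar>)"
  have [simp]: "\<bar>?r n\<bar> = ?r n" for n using rearr_nonneg[OF assms] by simp
  have v: "vanishing (\<lambda>n. \<bar>?r n\<bar>)" using vanishing_rearr[OF assms] by simp
  have c: "0 < t \<Longrightarrow> card {n. t < \<bar>?r n\<bar>} = card {n. t < \<bar>x n\<bar>}" for t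
    using card_rearr_gt[OF assms] by simp
  show "inE ?r \<longleftrightarrow> inE x" using inE_card[OF _ v, of x] inE_card[OF _ assms, of ?r] c by auto
  thus "inE x \<Longrightarrow> NN ?r = NN x"
    using NN_card[OF _ v, of x] NN_card[OF _ assms, of ?r] c by force
qed

end

section \<open>Uniform majorization\<close>

text \<open>By induction, the difference of the weighted sums up to \<open>k\<close> is at least \<open>a k\<close> times the difference
  of the partial sums.\<close>

lemma abel_summation_le:
  fixes a A B :: "nat \<Rightarrow> real"
  assumes part: "\<And>j. j \<le> L \<Longrightarrow> (\<Sum>l<j. A l) \<le> (\<Sum>l<j. B l)"
    and dec: "\<And>j. Suc j < L \<Longrightarrow> a (Suc j) \<le> a j" and pos: "\<And>j. j < L \<Longrightarrow> 0 \<le> a j"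
  shows "(\<Sum>l<L. a l * A l) \<le> (\<Sum>l<L. a l * B l)"
proof (cases L)
  case (Suc K)
  have "a k * ((\<Sum>l<Suc k. B l) - (\<Sum>l<Suc k. A l)) \<le> (\<Sum>l<Suc k. a l * B l) - (\<Sum>l<Suc k. a l * A l)"
    if "k < L" for k
    using that
  proof (induction k)
    case (Suc k)
    let ?D = "(\<Sum>l<Suc k. B l) - (\<Sum>l<Suc k. A l)"
    have "a (Suc k) * ?D \<le> a k * ?D"
      using part[of "Suc k"] dec[OF Suc.prems] Suc.prems by (intro mult_right_mono) auto
    also have "\<dots> \<le> (\<Sum>l<Suc k. a l * B l) - (\<Sum>l<Suc k. a l * A l)" using Suc by simp
    finally show ?case by (simp add: algebra_simps)
  qed (simp add: algebra_simps)
  from this[of K] have "a K * ((\<Sum>l<L. B l) - (\<Sum>l<L. A l)) \<le> (\<Sum>l<L. a l * B l) - (\<Sum>l<L. a l * A l)"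
    using Suc by simp
  moreover have "0 \<le> a K * ((\<Sum>l<L. B l) - (\<Sum>l<L. A l))"
    using part[of L] pos[of K] Suc by simp
  ultimately show ?thesis by simp
qed simp

lemma sum_subset_le_initial:
  fixes y :: "nat \<Rightarrow> real"
  assumes "S \<subseteq> {..<d}" "\<And>j k. j \<le> k \<Longrightarrow> k < d \<Longrightarrow> y k \<le> y j"
  shows "(\<Sum>j\<in>S. y j) \<le> (\<Sum>j<card S. y j)"
  using assms(1)
proof (induction "card S" arbitrary: S)
  case 0
  thus ?case by (metis card_0_eq finite_lessThan finite_subset lessThan_0 order_refl sum.empty)
next
  case (Suc m)
  have fin: "finite S" using Suc.prems finite_subset by blast
  have ne: "S \<noteq> {}" using Suc.hyps(2) by auto
  let ?k = "Max S"
  have k: "?k \<in> S" using fin ne by (rule Max_in)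
  have "S \<subseteq> {..?k}" using fin by auto
  hence "card S \<le> card {..?k}" by (intro card_mono) auto
  hence "m \<le> ?k" using Suc.hyps(2) by simp
  moreover have "?k < d" using k Suc.prems by auto
  ultimately have "y ?k \<le> y m" by (rule assms(2))
  moreover have c: "m = card (S - {?k})" using Suc.hyps(2) k fin by simp
  have "(\<Sum>j\<in>S - {?k}. y j) \<le> (\<Sum>j<card (S - {?k}). y j)"
    by (rule Suc.hyps(1)[OF c]) (use Suc.prems in auto)
  ultimately show ?case
    using sum.remove[OF fin k, of y] c by (simp add: Suc.hyps(2)[symmetric])
qed

text \<open>Against a fixed non-negative weight the best arrangement of \<open>Z\<close> puts large values where the
  weight is large, and there Abel summation exploits the majorization.\<close>

lemma weighted_rearrangement:
  fixes f y Z :: "nat \<Rightarrow> real"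
  assumes maj: "\<And>m. m \<le> d \<Longrightarrow> (\<Sum>j<m. y j) \<le> (\<Sum>j<m. Z j)"
    and dec: "\<And>j k. j \<le> k \<Longrightarrow> k < d \<Longrightarrow> y k \<le> y j" and pos: "\<And>k. k < d \<Longrightarrow> 0 \<le> f k"
  shows "\<exists>\<sigma>. bij_betw \<sigma> {..<d} {..<d} \<and> (\<Sum>k<d. f k * y k) \<le> (\<Sum>k<d. f k * Z (\<sigma> k))"
proof -
  define xs where "xs = sort_key (\<lambda>i. - f i) [0..<d]"
  define p where "p j = xs ! j" for j
  have xs: "length xs = d" "distinct xs" "set xs = {..<d}" "sorted (map (\<lambda>i. - f i) xs)"
    by (auto simp: xs_def)
  have p: "bij_betw p {..<d} {..<d}"
    unfolding p_def by (rule bij_betw_nth[OF xs(2)]) (simp_all only: xs(1,3))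
  have fdec: "f (p k) \<le> f (p j)" if "j \<le> k" "k < d" for j k
    using sorted_nth_mono[OF xs(4), of j k] that xs(1) by (simp add: p_def)
  have "(\<Sum>k<d. f k * y k) = (\<Sum>j<d. f (p j) * y (p j))"
    by (rule sum.reindex_bij_betw[OF p, symmetric])
  also have "\<dots> \<le> (\<Sum>j<d. f (p j) * Z j)"
  proof (rule abel_summation_le)
    fix m assume m: "m \<le> d"
    have inj: "inj_on p {..<m}" using p m by (auto simp: bij_betw_def intro: inj_on_subset)
    have "(\<Sum>j<m. y (p j)) = (\<Sum>j\<in>p ` {..<m}. y j)" by (simp add: sum.reindex[OF inj])
    also have "\<dots> \<le> (\<Sum>j<card (p ` {..<m}). y j)"
    proof (rule sum_subset_le_initial[OF _ dec])
      show "p ` {..<m} \<subseteq> {..<d}" using p m by (force simp: bij_betw_def)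
    qed
    also have "\<dots> = (\<Sum>j<m. y j)" by (simp add: card_image[OF inj])
    also have "\<dots> \<le> (\<Sum>j<m. Z j)" by (rule maj[OF m])
    finally show "(\<Sum>j<m. y (p j)) \<le> (\<Sum>j<m. Z j)" .
  next
    fix j assume "j < d"
    hence "p j < d" using p by (auto simp: bij_betw_def)
    thus "0 \<le> f (p j)" by (rule pos)
  qed (use fdec in simp)
  also have "\<dots> = (\<Sum>j<d. f (p j) * Z (inv_into {..<d} p (p j)))"
    using p by (intro sum.cong) (simp_all add: bij_betw_inv_into_left)
  also have "\<dots> = (\<Sum>k<d. f k * Z (inv_into {..<d} p k))"
    by (rule sum.reindex_bij_betw[OF p])
  finally show ?thesis using bij_betw_inv_into[OF p] by blast
qed

text \<open>The rearrangements are chosen greedily: each one is optimal against the positive part of the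
  current deficit, so that the squared length of that part grows only linearly in \<open>M\<close>. After division
  by \<open>M\<close> the error \<open>sqrt (d / M) * Z 0\<close> depends on the two vectors only through \<open>d\<close> and \<open>Z 0\<close>.\<close>

lemma average_of_rearrangements:
  fixes y Z :: "nat \<Rightarrow> real" and M d :: nat
  assumes maj: "\<And>m. m \<le> d \<Longrightarrow> (\<Sum>j<m. y j) \<le> (\<Sum>j<m. Z j)"
    and dec: "\<And>j k. j \<le> k \<Longrightarrow> k < d \<Longrightarrow> y k \<le> y j"
    and y0: "\<And>k. k < d \<Longrightarrow> 0 \<le> y k" and Z: "\<And>k. k < d \<Longrightarrow> 0 \<le> Z k \<and> Z k \<le> Z 0"
  shows "\<exists>\<sigma>. (\<forall>q<M. bij_betw (\<sigma> q) {..<d} {..<d}) \<and>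
    (\<forall>k<d. M * y k \<le> (\<Sum>q<M. Z (\<sigma> q k)) + sqrt (M * d) * Z 0)"
proof -
  have "\<exists>\<sigma>. (\<forall>q<M. bij_betw (\<sigma> q) {..<d} {..<d}) \<and>
      (\<Sum>k<d. (max 0 (\<Sum>q<M. y k - Z (\<sigma> q k)))\<^sup>2) \<le> M * d * (Z 0)\<^sup>2"
  proof (induction M)
    case (Suc M)
    then obtain \<sigma> where \<sigma>: "\<forall>q<M. bij_betw (\<sigma> q) {..<d} {..<d}"
        "(\<Sum>k<d. (max 0 (\<Sum>q<M. y k - Z (\<sigma> q k)))\<^sup>2) \<le> M * d * (Z 0)\<^sup>2" by blast
    define r where "r k = (\<Sum>q<M. y k - Z (\<sigma> q k))" for k
    obtain \<tau> where \<tau>: "bij_betw \<tau> {..<d} {..<d}"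
        "(\<Sum>k<d. max 0 (r k) * y k) \<le> (\<Sum>k<d. max 0 (r k) * Z (\<tau> k))"
      using weighted_rearrangement[where f = "\<lambda>k. max 0 (r k)", OF maj dec] by auto
    have step: "(max 0 (r k + (y k - Z (\<tau> k))))\<^sup>2
        \<le> (max 0 (r k))\<^sup>2 + 2 * (max 0 (r k) * y k - max 0 (r k) * Z (\<tau> k)) + (Z 0)\<^sup>2"
      if k: "k < d" for k
    proof -
      have "\<tau> k < d" using \<tau>(1) k by (auto simp: bij_betw_def)
      have "y k \<le> y 0" using dec[of 0 k] k by simp
      also have "y 0 \<le> Z 0" using maj[of 1] k by simp
      finally have "\<bar>y k - Z (\<tau> k)\<bar> \<le> Z 0"
        using y0[OF k] Z[OF \<open>\<tau> k < d\<close>] by (simp add: abs_le_iff)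
      hence g: "(y k - Z (\<tau> k))\<^sup>2 \<le> (Z 0)\<^sup>2" by (metis abs_ge_zero power2_abs power_mono)
      have "(max 0 (r k + (y k - Z (\<tau> k))))\<^sup>2 \<le> (max 0 (r k) + (y k - Z (\<tau> k)))\<^sup>2"
      proof (cases "r k + (y k - Z (\<tau> k)) \<le> 0")
        case False
        thus ?thesis by (intro power_mono) auto
      qed simp
      also have "\<dots> = (max 0 (r k))\<^sup>2 + 2 * (max 0 (r k) * y k - max 0 (r k) * Z (\<tau> k)) + (y k - Z (\<tau> k))\<^sup>2"
        by (simp add: power2_eq_square algebra_simps)
      finally show ?thesis using g by linarith
    qed
    have "(\<Sum>k<d. (max 0 (\<Sum>q<Suc M. y k - Z ((\<sigma>(M := \<tau>)) q k)))\<^sup>2)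
        = (\<Sum>k<d. (max 0 (r k + (y k - Z (\<tau> k))))\<^sup>2)"
      by (simp add: r_def)
    also have "\<dots> \<le> (\<Sum>k<d. (max 0 (r k))\<^sup>2 + 2 * (max 0 (r k) * y k - max 0 (r k) * Z (\<tau> k)) + (Z 0)\<^sup>2)"
      by (intro sum_mono step) simp
    also have "\<dots> = (\<Sum>k<d. (max 0 (r k))\<^sup>2)
        + 2 * ((\<Sum>k<d. max 0 (r k) * y k) - (\<Sum>k<d. max 0 (r k) * Z (\<tau> k))) + d * (Z 0)\<^sup>2"
      by (simp add: sum.distrib sum_subtractf sum_distrib_left)
    also have "\<dots> \<le> M * d * (Z 0)\<^sup>2 + d * (Z 0)\<^sup>2" using \<tau>(2) \<sigma>(2) by (simp add: r_def)
    finally have "(\<Sum>k<d. (max 0 (\<Sum>q<Suc M. y k - Z ((\<sigma>(M := \<tau>)) q k)))\<^sup>2) \<le> Suc M * d * (Z 0)\<^sup>2"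
      by (simp add: algebra_simps)
    moreover have "\<forall>q<Suc M. bij_betw ((\<sigma>(M := \<tau>)) q) {..<d} {..<d}" using \<sigma>(1) \<tau>(1) by auto
    ultimately show ?case by blast
  qed simp
  then obtain \<sigma> where \<sigma>: "\<forall>q<M. bij_betw (\<sigma> q) {..<d} {..<d}"
      "(\<Sum>k<d. (max 0 (\<Sum>q<M. y k - Z (\<sigma> q k)))\<^sup>2) \<le> M * d * (Z 0)\<^sup>2" by blast
  have "M * y k \<le> (\<Sum>q<M. Z (\<sigma> q k)) + sqrt (M * d) * Z 0" if k: "k < d" for k
  proof -
    let ?r = "\<Sum>q<M. y k - Z (\<sigma> q k)"
    have "(max 0 ?r)\<^sup>2 \<le> (\<Sum>k<d. (max 0 (\<Sum>q<M. y k - Z (\<sigma> q k)))\<^sup>2)"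
      using k by (intro member_le_sum) auto
    also have "\<dots> \<le> (sqrt (M * d) * Z 0)\<^sup>2" using \<sigma>(2) by (simp add: power_mult_distrib)
    finally have "max 0 ?r \<le> sqrt (M * d) * Z 0"
      by (rule power2_le_imp_le) (use Z[of 0] k in auto)
    thus ?thesis by (simp add: sum_subtractf)
  qed
  thus ?thesis using \<sigma>(1) by blast
qed

context symmetric_norm
begin

text \<open>Majorization inside infinitely many blocks of bounded length. Block \<open>i\<close> consists of \<open>d i\<close>
  cells of equal size \<open>c i\<close>; on the cells the sequence \<open>r\<close> lies below \<open>y i\<close>, while \<open>w\<close> lies above
  \<open>Z i\<close>. The number of rearrangements needed is the same in all blocks, so that they combine into
  finitely many rearrangements of \<open>w\<close>, and the triangle inequality applies without completeness.\<close>

lemma blockwise_majorization: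
  fixes y Z :: "nat \<Rightarrow> nat \<Rightarrow> real" and c d :: "nat \<Rightarrow> nat" and w r :: "nat \<Rightarrow> real"
    and loc :: "nat \<times> nat \<times> nat \<Rightarrow> nat" and bl jj off :: "nat \<Rightarrow> nat"
  assumes w: "inE w" "\<And>n. 0 \<le> w n"
    and maj: "\<And>i m. m \<le> d i \<Longrightarrow> (\<Sum>j<m. y i j) \<le> (\<Sum>j<m. Z i j)"
    and dec: "\<And>i j k. j \<le> k \<Longrightarrow> k < d i \<Longrightarrow> y i k \<le> y i j"
    and y0: "\<And>i k. k < d i \<Longrightarrow> 0 \<le> y i k" and Z: "\<And>i k. k < d i \<Longrightarrow> 0 \<le> Z i k \<and> Z i k \<le> Z i 0"
    and dD: "\<And>i. d i \<le> D"
    and loc: "inj_on loc {(i, j, k). j < d i \<and> k < c i}"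
      "\<And>i j k. j < d i \<Longrightarrow> k < c i \<Longrightarrow> Z i j \<le> w (loc (i, j, k))"
    and pos: "inj_on (\<lambda>n. (bl n, jj n, off n)) {n. r n \<noteq> 0}"
      "\<And>n. r n \<noteq> 0 \<Longrightarrow> jj n < d (bl n) \<and> off n < c (bl n) \<and> r n \<le> y (bl n) (jj n)"
    and r0: "\<And>n. 0 \<le> r n"
  shows "inE r" and "NN r \<le> NN w"
proof -
  \<comment> \<open>The greedy averages leave an error proportional to \<open>Z i 0\<close> on all cells of block \<open>i\<close>. It is a sum
    of \<open>D\<close> sequences that each use one cell per block and are therefore dominated by \<open>w\<close>.\<close>
  define h where "h l n = (if r n \<noteq> 0 \<and> jj n = l then Z (bl n) 0 else 0)" for l n
  have h0: "0 \<le> h l n" for l n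
    using pos(2)[of n] Z[of 0 "bl n"] by (auto simp: h_def)
  have h: "inE (h l)" "NN (h l) \<le> NN w" for l
  proof -
    have inj: "inj_on (\<lambda>n. loc (bl n, 0, off n)) {n. h l n \<noteq> 0}"
    proof (rule inj_onI)
      fix m n assume mn: "m \<in> {n. h l n \<noteq> 0}" "n \<in> {n. h l n \<noteq> 0}"
        and eq: "loc (bl m, 0, off m) = loc (bl n, 0, off n)"
      have m: "r m \<noteq> 0" "jj m = l" and n: "r n \<noteq> 0" "jj n = l"
        using mn by (auto simp: h_def split: if_splits)
      have "(bl m, 0::nat, off m) = (bl n, 0, off n)"
        by (rule inj_onD[OF loc(1) eq]) (use pos(2)[OF m(1)] pos(2)[OF n(1)] in auto)
      thus "m = n" using inj_onD[OF pos(1), of m n] m n by simp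
    qed
    have "\<bar>h l n\<bar> \<le> \<bar>w (loc (bl n, 0, off n))\<bar>" if "h l n \<noteq> 0" for n
    proof -
      have rn: "r n \<noteq> 0" using that by (auto simp: h_def split: if_splits)
      have "h l n \<le> Z (bl n) 0" using that by (auto simp: h_def split: if_splits)
      also have "\<dots> \<le> w (loc (bl n, 0, off n))"
        by (rule loc(2)) (use pos(2)[OF rn] in auto)
      finally show ?thesis using h0[of l n] by simp
    qed
    thus "inE (h l)" "NN (h l) \<le> NN w" using inE_inj[OF w(1) inj] NN_inj[OF w(1) inj] by auto
  qed
  have main: "inE r \<and> NN r \<le> NN w + sqrt (D / M) * (D * NN w)" if M: "0 < M" for M :: nat
  proof -
    have "\<exists>\<sigma>. \<forall>i. (\<forall>q<M. bij_betw (\<sigma> i q) {..<d i} {..<d i}) \<and>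
        (\<forall>k<d i. M * y i k \<le> (\<Sum>q<M. Z i (\<sigma> i q k)) + sqrt (M * d i) * Z i 0)"
      by (intro choice allI average_of_rearrangements) (use maj dec y0 Z in auto)
    then obtain \<sigma> where \<sigma>: "\<And>i q. q < M \<Longrightarrow> bij_betw (\<sigma> i q) {..<d i} {..<d i}"
        "\<And>i k. k < d i \<Longrightarrow> M * y i k \<le> (\<Sum>q<M. Z i (\<sigma> i q k)) + sqrt (M * d i) * Z i 0" by blast
    define z where "z q n = (if r n \<noteq> 0 then Z (bl n) (\<sigma> (bl n) q (jj n)) else 0)" for q n
    have \<sigma>d: "\<sigma> i q j < d i" if "q < M" "j < d i" for i q j
      using \<sigma>(1)[OF that(1), of i] that(2) by (auto simp: bij_betw_def)
    have z: "inE (z q)" "NN (z q) \<le> NN w" if q: "q < M" for q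
    proof -
      let ?\<pi> = "\<lambda>n. loc (bl n, \<sigma> (bl n) q (jj n), off n)"
      have inj: "inj_on ?\<pi> {n. z q n \<noteq> 0}"
      proof (rule inj_onI)
        fix m n assume mn: "m \<in> {n. z q n \<noteq> 0}" "n \<in> {n. z q n \<noteq> 0}" and eq: "?\<pi> m = ?\<pi> n"
        have m: "r m \<noteq> 0" and n: "r n \<noteq> 0"
          using mn by (auto simp: z_def split: if_splits)
        have eq': "(bl m, \<sigma> (bl m) q (jj m), off m) = (bl n, \<sigma> (bl n) q (jj n), off n)"
          by (rule inj_onD[OF loc(1) eq]) (use pos(2)[OF m] pos(2)[OF n] \<sigma>d[OF q] in auto)
        hence "\<sigma> (bl n) q (jj m) = \<sigma> (bl n) q (jj n)" by auto
        hence "jj m = jj n"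
          using inj_onD[OF bij_betw_imp_inj_on[OF \<sigma>(1)[OF q, of "bl n"]]] pos(2)[OF m] pos(2)[OF n] eq'
          by auto
        thus "m = n" using inj_onD[OF pos(1), of m n] m n eq' by simp
      qed
      have "\<bar>z q n\<bar> \<le> \<bar>w (?\<pi> n)\<bar>" if "z q n \<noteq> 0" for n
      proof -
        have rn: "r n \<noteq> 0" using that by (auto simp: z_def split: if_splits)
        have *: "\<sigma> (bl n) q (jj n) < d (bl n)" using \<sigma>d[OF q] pos(2)[OF rn] by blast
        have "z q n = Z (bl n) (\<sigma> (bl n) q (jj n))" using rn by (simp add: z_def)
        moreover have "\<dots> \<le> w (?\<pi> n)" by (rule loc(2)[OF *]) (use pos(2)[OF rn] in auto)
        ultimately show ?thesis using Z[OF *] by simp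
      qed
      thus "inE (z q)" "NN (z q) \<le> NN w" using inE_inj[OF w(1) inj] NN_inj[OF w(1) inj] by auto
    qed
    define u where "u n = (\<Sum>q<M. z q n)" for n
    define v where "v n = (\<Sum>l<D. h l n)" for n
    have u: "inE u" "NN u \<le> M * NN w"
      using inE_sum[of "{..<M}" z] NN_sum[of "{..<M}" z] sum_mono[of "{..<M}" "\<lambda>q. NN (z q)" "\<lambda>_. NN w"] z
      by (auto simp: u_def[abs_def] intro: order_trans)
    have v: "inE v" "NN v \<le> D * NN w"
      using inE_sum[of "{..<D}" h] NN_sum[of "{..<D}" h] sum_mono[of "{..<D}" "\<lambda>q. NN (h q)" "\<lambda>_. NN w"] h
      by (auto simp: v_def[abs_def] intro: order_trans)
    define x where "x n = (1 / M) * u n + sqrt (D / M) * v n" for n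
    have x: "inE x" unfolding x_def by (intro inE_add inE_scale u v)
    have "NN x \<le> NN (\<lambda>n. (1 / M) * u n) + NN (\<lambda>n. sqrt (D / M) * v n)"
      unfolding x_def by (intro NN_add inE_scale u v)
    also have "\<dots> = (1 / M) * NN u + sqrt (D / M) * NN v"
      by (simp only: NN_scale[OF u(1)] NN_scale[OF v(1)]) simp
    also have "\<dots> \<le> (1 / M) * (M * NN w) + sqrt (D / M) * (D * NN w)"
      by (intro add_mono mult_left_mono u v) auto
    finally have Nx: "NN x \<le> NN w + sqrt (D / M) * (D * NN w)" using M by simp
    have "\<bar>r n\<bar> \<le> \<bar>x n\<bar>" for n
    proof (cases "r n = 0")
      case False
      let ?i = "bl n" and ?j = "jj n"
      have j: "?j < d ?i" using pos(2)[OF False] by blast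
      have "?j < D" using j dD[of ?i] by simp
      have Z0: "0 \<le> Z ?i 0" using Z[OF j] by linarith
      have "M * r n \<le> M * y ?i ?j" using pos(2)[OF False] by (intro mult_left_mono) auto
      also have "\<dots> \<le> (\<Sum>q<M. Z ?i (\<sigma> ?i q ?j)) + sqrt (M * d ?i) * Z ?i 0" by (rule \<sigma>(2)[OF j])
      also have "(\<Sum>q<M. Z ?i (\<sigma> ?i q ?j)) = u n" using False by (simp add: u_def z_def)
      also have "sqrt (M * d ?i) * Z ?i 0 \<le> sqrt (M * D) * v n"
      proof (intro mult_mono)
        have "h ?j n \<le> v n" unfolding v_def using \<open>?j < D\<close> h0 by (intro member_le_sum) auto
        thus "Z ?i 0 \<le> v n" using False by (simp add: h_def)
        show "sqrt (M * d ?i) \<le> sqrt (M * D)" using dD[of ?i] by (simp add: mult_left_mono)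
      qed (use Z0 in auto)
      finally have "M * r n \<le> u n + sqrt (M * D) * v n" by simp
      hence "r n \<le> (u n + sqrt (M * D) * v n) / M" using M by (simp add: field_simps)
      also have "\<dots> = x n"
      proof -
        have *: "sqrt (M * D) / M = sqrt (D / M)"
          using M by (simp add: real_sqrt_divide real_sqrt_mult field_simps)
        have "(u n + sqrt (M * D) * v n) / M = (1 / M) * u n + (sqrt (M * D) / M) * v n"
          by (simp add: add_divide_distrib)
        thus ?thesis by (simp only: * x_def)
      qed
      finally show ?thesis using r0[of n] by simp
    qed simp
    thus ?thesis using inE_mono[OF x] NN_mono[OF x] Nx by (meson order_trans)
  qed
  show "inE r" using main[of 1] by simp
  show "NN r \<le> NN w"
  proof (rule LIMSEQ_le_const)
    have inv: "(\<lambda>n. 1 / real (Suc n)) \<longlonglongrightarrow> 0"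
      using LIMSEQ_inverse_real_of_nat by (simp add: inverse_eq_divide)
    have "(\<lambda>n. NN w + sqrt (D * (1 / Suc n)) * (D * NN w)) \<longlonglongrightarrow> NN w + sqrt (D * (0::real)) * (D * NN w)"
      by (rule tendsto_add[OF tendsto_const tendsto_mult[OF
            tendsto_real_sqrt[OF tendsto_mult[OF tendsto_const inv]] tendsto_const]])
    thus "(\<lambda>n. NN w + sqrt (D * (1 / Suc n)) * (D * NN w)) \<longlonglongrightarrow> NN w" by simp
    show "\<exists>K. \<forall>n\<ge>K. NN r \<le> NN w + sqrt (D * (1 / Suc n)) * (D * NN w)"
    proof (intro exI[of _ 0] allI impI)
      fix n :: nat
      show "NN r \<le> NN w + sqrt (D * (1 / Suc n)) * (D * NN w)" using main[of "Suc n"] by simp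
    qed
  qed
qed

end

text \<open>The order of magnitude in base 9. In a block that starts at \<open>c\<close> the majorization is used with
  \<open>n = 2 c\<close>, and on cells of length \<open>c\<close>; it then controls \<open>s\<close> from \<open>4 n + c = 9 c\<close> on. With base 9
  exactly one order of magnitude is lost in each block.\<close>

definition level :: "nat \<Rightarrow> nat" where
  "level x = (LEAST l. x < 9 ^ Suc l)"

lemma less_level: "x < 9 ^ Suc (level x)"
proof -
  have "x < 9 ^ Suc x" using power_gt_expt[of 9 "Suc x"] by simp
  thus ?thesis unfolding level_def by (rule LeastI)
qed

lemma le_level_iff:
  assumes "0 < x"
  shows "l \<le> level x \<longleftrightarrow> 9 ^ l \<le> x"
proof
  assume l: "l \<le> level x"
  show "9 ^ l \<le> x"
  proof (cases l)
    case (Suc k)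
    hence "k < level x" using l by simp
    thus ?thesis using not_less_Least[of k "\<lambda>l. x < 9 ^ Suc l"] Suc by (simp add: level_def)
  qed (use assms in simp)
next
  assume "9 ^ l \<le> x"
  hence "(9::nat) ^ l < 9 ^ Suc (level x)" using less_level[of x] by linarith
  from power_less_imp_less_exp[OF _ this] show "l \<le> level x" by simp
qed

lemma level_less_iff: "0 < x \<Longrightarrow> level x < l \<longleftrightarrow> x < 9 ^ l"
  using le_level_iff[of x l] by linarith

lemma level_block:
  assumes "9 ^ (P * i + p) \<le> x" "x < 9 ^ (P * i + p + P)"
  shows "(level x - p) div P = i"
proof -
  have x: "0 < x" using assms(1) by (metis less_le_trans zero_less_power zero_less_numeral)
  have "P * i + p \<le> level x" "level x < P * i + p + P"
    using le_level_iff[OF x] level_less_iff[OF x] assms by auto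
  hence "P * i \<le> level x - p" "level x - p < P * Suc i" by auto
  thus ?thesis by (metis div_nat_eqI mult.commute)
qed

context symmetric_norm
begin

text \<open>Fix \<open>P\<close> and a phase \<open>p < P\<close>, and cut the index set at the numbers \<open>9\<^bsup>P i + p\<^esup>\<close>. Within a block the sequence \<open>s\<close> is
  controlled except on the first of its \<open>P\<close> levels. Averaging over all phases loses only a factor
  \<open>(P - 1) / P\<close>, since each index is lost in exactly one phase.\<close>

lemma uniform_majorization_phase:
  fixes s w :: "nat \<Rightarrow> real"
  assumes s: "decseq s" "\<And>n. 0 \<le> s n" and w: "decseq w" "\<And>n. 0 \<le> w n" "inE w"
    and maj: "\<And>n m. (\<Sum>k<m. s (4 * n + k)) \<le> (\<Sum>k<m. w (n + k))" and p: "p < P"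
  defines "r \<equiv> (\<lambda>k. if level k mod P = p then 0 else s k)"
  shows "inE r \<and> NN r \<le> NN w"
proof -
  \<comment> \<open>Block \<open>0\<close> is the initial segment below \<open>9\<^sup>p\<close>, with cells of length one. In block \<open>Suc i\<close>, with
    \<open>c = 9\<^bsup>P i + p\<^esup>\<close>, the cell number \<open>j\<close> of \<open>s\<close> starts at \<open>(9 + j) c\<close> and that of \<open>w\<close> ends at
    \<open>(2 + j) c\<close>; the values of \<open>s\<close> and \<open>w\<close> at these points serve as \<open>y\<close> and \<open>Z\<close>.\<close>
  define c :: "nat \<Rightarrow> nat" where "c i = (case i of 0 \<Rightarrow> 1 | Suc i \<Rightarrow> 9 ^ (P * i + p))" for i
  define d :: "nat \<Rightarrow> nat" where "d i = (case i of 0 \<Rightarrow> 9 ^ p | Suc i \<Rightarrow> 9 ^ P - 1)" for i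
  define y where "y i j = (case i of 0 \<Rightarrow> s j | Suc i' \<Rightarrow> s ((9 + j) * c i))" for i j :: nat
  define Z where "Z i j = (case i of 0 \<Rightarrow> w j | Suc i' \<Rightarrow> w ((2 + j) * c i))" for i j :: nat
  define loc :: "nat \<times> nat \<times> nat \<Rightarrow> nat"
    where "loc = (\<lambda>(i, j, k). case i of 0 \<Rightarrow> j | Suc i' \<Rightarrow> (1 + j) * c i + k)"
  define bl where "bl k = (if k < 9 ^ p then 0 else Suc ((level k - p) div P))" for k
  define jj where "jj k = (if k < 9 ^ p then k else k div c (bl k) - 9)" for k
  define off where "off k = (if k < 9 ^ p then 0 else k mod c (bl k))" for k
  have c0: "0 < c i" for i by (simp add: c_def split: nat.split)
  have sd: "s n \<le> s m" if "m \<le> n" for m n using s(1) that by (simp add: decseq_def)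
  have wd: "w n \<le> w m" if "m \<le> n" for m n using w(1) that by (simp add: decseq_def)
  have maj': "(\<Sum>j<m. y i j) \<le> (\<Sum>j<m. Z i j)" for i m
  proof (cases i)
    case 0
    thus ?thesis using maj[where n = 0 and m = m] by (simp add: y_def Z_def)
  next
    case (Suc i')
    let ?c = "c i"
    have grp: "(\<Sum>k<m * ?c. g k) = (\<Sum>j<m. \<Sum>k<?c. g (j * ?c + k))" for g :: "nat \<Rightarrow> real"
    proof -
      have "(\<Sum>k=j * ?c..<j * ?c + ?c. g k) = (\<Sum>k<?c. g (j * ?c + k))" for j
        using sum.shift_bounds_nat_ivl[of g 0 "j * ?c" ?c] by (simp add: atLeast0LessThan add.commute)
      thus ?thesis using sum.nat_group[of g ?c m] by simp
    qed
    have "?c * (\<Sum>j<m. y i j) = (\<Sum>j<m. \<Sum>k<?c. y i j)" by (simp add: sum_distrib_left)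
    also have "\<dots> \<le> (\<Sum>j<m. \<Sum>k<?c. s (4 * (2 * ?c) + (j * ?c + k)))"
      by (intro sum_mono) (auto simp: y_def Suc algebra_simps intro!: sd)
    also have "\<dots> = (\<Sum>k<m * ?c. s (4 * (2 * ?c) + k))" by (simp add: grp)
    also have "\<dots> \<le> (\<Sum>k<m * ?c. w (2 * ?c + k))" by (rule maj)
    also have "\<dots> = (\<Sum>j<m. \<Sum>k<?c. w (2 * ?c + (j * ?c + k)))" by (rule grp)
    also have "\<dots> \<le> (\<Sum>j<m. \<Sum>k<?c. Z i j)"
      by (intro sum_mono) (auto simp: Z_def Suc algebra_simps intro!: wd)
    also have "\<dots> = ?c * (\<Sum>j<m. Z i j)" by (simp add: sum_distrib_left)
    finally show ?thesis using c0[of i] by simp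
  qed
  have locblock: "9 ^ (P * i' + p) \<le> loc (Suc i', j, k) \<and> loc (Suc i', j, k) < 9 ^ (P * i' + p + P)"
    if "j < d (Suc i')" "k < c (Suc i')" for i' j k
  proof
    let ?c = "c (Suc i')"
    have c: "?c = 9 ^ (P * i' + p)" by (simp add: c_def)
    show "9 ^ (P * i' + p) \<le> loc (Suc i', j, k)" by (simp add: loc_def c[symmetric])
    have "loc (Suc i', j, k) < (2 + j) * ?c" using that(2) by (simp add: loc_def algebra_simps)
    also have "\<dots> \<le> 9 ^ P * ?c" using that(1) by (intro mult_right_mono) (auto simp: d_def)
    finally show "loc (Suc i', j, k) < 9 ^ (P * i' + p + P)" by (simp add: c power_add mult.commute)
  qed
  have blloc: "bl (loc (i, j, k)) = i" if "j < d i" "k < c i" for i j k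
  proof (cases i)
    case 0
    thus ?thesis using that by (simp add: bl_def loc_def d_def)
  next
    case (Suc i')
    have 1: "9 ^ (P * i' + p) \<le> loc (i, j, k)" "loc (i, j, k) < 9 ^ (P * i' + p + P)"
      using locblock[of j i' k] that Suc by auto
    have "(9::nat) ^ p \<le> 9 ^ (P * i' + p)" by (intro power_increasing) auto
    hence "\<not> loc (i, j, k) < 9 ^ p" using 1(1) by linarith
    thus ?thesis using level_block[OF 1] Suc by (simp add: bl_def)
  qed
  have "inj_on loc {(i, j, k). j < d i \<and> k < c i}"
  proof (rule inj_onI)
    fix u v assume uv: "u \<in> {(i, j, k). j < d i \<and> k < c i}" "v \<in> {(i, j, k). j < d i \<and> k < c i}"
      and loc_eq: "loc u = loc v"
    obtain i j k i' j' k' where [simp]: "u = (i, j, k)" "v = (i', j', k')" by (cases u, cases v)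
    have a: "j < d i" "k < c i" "j' < d i'" "k' < c i'" and eq: "loc (i, j, k) = loc (i', j', k')"
      using uv loc_eq by auto
    have i: "i = i'" using blloc[OF a(1,2)] blloc[OF a(3,4)] eq by simp
    have "i = i' \<and> j = j' \<and> k = k'"
    proof (cases i)
      case 0
      thus ?thesis using i eq a by (simp add: loc_def c_def)
    next
      case (Suc n)
      hence eq': "(1 + j) * c i + k = (1 + j') * c i + k'" using eq i by (simp add: loc_def)
      have "((1 + j) * c i + k) div c i = 1 + j" "((1 + j') * c i + k') div c i = 1 + j'"
        using a(2,4) i by (auto intro!: div_nat_eqI simp: algebra_simps)
      hence "1 + j = 1 + j'" by (simp only: eq')
      hence "j = j'" by simp
      thus ?thesis using eq' i by simp
    qed
    thus "u = v" by simp
  qed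
  moreover have "Z i j \<le> w (loc (i, j, k))" if "j < d i" "k < c i" for i j k
    using that by (cases i) (auto simp: Z_def loc_def algebra_simps intro!: wd)
  moreover have pos: "jj k < d (bl k) \<and> off k < c (bl k) \<and> r k \<le> y (bl k) (jj k) \<and>
      k = (if k < 9 ^ p then jj k else (9 + jj k) * c (bl k) + off k)" if rk: "r k \<noteq> 0" for k
  proof (cases "k < 9 ^ p")
    case True
    thus ?thesis using rk by (auto simp: jj_def bl_def off_def d_def c_def y_def r_def)
  next
    case False
    have k0: "0 < k" using False by (metis not_gr_zero zero_less_numeral zero_less_power)
    define l where "l = level k"
    define i where "i = (l - p) div P"
    have lp: "p \<le> l" using le_level_iff[OF k0] False by (simp add: l_def)
    have lmod: "l mod P \<noteq> p" using rk by (auto simp: r_def l_def split: if_splits)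
    have bl: "bl k = Suc i" using False by (simp add: bl_def i_def l_def)
    have c: "c (bl k) = 9 ^ (P * i + p)" by (simp add: bl c_def)
    have split: "l - p = P * i + (l - p) mod P" by (simp add: i_def)
    have "(l - p) mod P \<noteq> 0"
    proof
      assume "(l - p) mod P = 0"
      hence "l = p + P * i" using split lp by simp
      thus False using lmod p by simp
    qed
    hence l1: "P * i + p + 1 \<le> l" using split lp by linarith
    have "(l - p) mod P < P" using p by simp
    hence l2: "l < P * i + p + P" using split lp by linarith
    have "9 * c (bl k) \<le> k" using le_level_iff[OF k0, of "P * i + p + 1"] l1 by (simp add: c l_def)
    hence d9: "9 \<le> k div c (bl k)" using c0[of "bl k"] by (simp add: less_eq_div_iff_mult_less_eq)
    have "k < 9 ^ P * c (bl k)"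
      using level_less_iff[OF k0, of "P * i + p + P"] l2 by (simp add: c l_def power_add mult.commute)
    hence "k div c (bl k) < 9 ^ P" using c0[of "bl k"] by (simp add: div_less_iff_less_mult)
    hence j: "jj k < d (bl k)" using d9 False by (simp add: jj_def d_def bl)
    have e: "(9 + jj k) * c (bl k) = k div c (bl k) * c (bl k)" using d9 False by (simp add: jj_def)
    hence "(9 + jj k) * c (bl k) \<le> k" by (simp only: div_times_less_eq_dividend)
    hence "r k \<le> y (bl k) (jj k)" using sd s(2) by (auto simp: r_def y_def bl split: if_splits)
    moreover have "k = (9 + jj k) * c (bl k) + off k"
      by (simp only: off_def False if_False e div_mult_mod_eq)
    ultimately show ?thesis using j c0[of "bl k"] False by (simp add: off_def)
  qed
  moreover have "inj_on (\<lambda>n. (bl n, jj n, off n)) {n. r n \<noteq> 0}"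
  proof (rule inj_onI)
    fix m n assume "m \<in> {n. r n \<noteq> 0}" "n \<in> {n. r n \<noteq> 0}" "(bl m, jj m, off m) = (bl n, jj n, off n)"
    moreover from this have "m < 9 ^ p \<longleftrightarrow> n < 9 ^ p" by (auto simp: bl_def split: if_splits)
    ultimately show "m = n" using pos[of m] pos[of n] by (auto split: if_splits)
  qed
  moreover have "d i \<le> 9 ^ P" for i
    using p power_increasing[of p P "9::nat"] by (auto simp: d_def split: nat.split)
  moreover have "y i k \<le> y i j" if "j \<le> k" for i j k
    using that by (auto simp: y_def intro!: sd split: nat.split)
  moreover have "0 \<le> Z i k \<and> Z i k \<le> Z i 0" for i k
    by (auto simp: Z_def w(2) intro!: wd split: nat.split)
  moreover have "0 \<le> y i k" for i k by (auto simp: y_def s(2) split: nat.split)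
  moreover have "0 \<le> r k" for k by (simp add: r_def s(2))
  ultimately show ?thesis
    using blockwise_majorization[where y = y and Z = Z and d = d and c = c and D = "9 ^ P" and loc = loc
        and bl = bl and jj = jj and off = off and r = r, OF w(3,2) maj'] by blast
qed

text \<open>The average over the \<open>P\<close> phases bounds \<open>(P - 1) s\<close> by a sum of \<open>P\<close> sequences of norm at most that
  of \<open>w\<close>; then \<open>P\<close> tends to infinity.\<close>

theorem uniform_majorization:
  fixes s w :: "nat \<Rightarrow> real"
  assumes s: "decseq s" "\<And>n. 0 \<le> s n" and w: "decseq w" "\<And>n. 0 \<le> w n" "inE w"
    and maj: "\<And>n m. (\<Sum>k<m. s (4 * n + k)) \<le> (\<Sum>k<m. w (n + k))"
  shows "inE s" and "NN s \<le> NN w"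
proof -
  have main: "inE s \<and> P * NN s \<le> Suc P * NN w" if P: "0 < P" for P :: nat
  proof -
    define r where "r p = (\<lambda>k. if level k mod Suc P = p then 0 else s k)" for p
    have r: "inE (r p)" "NN (r p) \<le> NN w" if "p \<in> {..<Suc P}" for p
      using uniform_majorization_phase[OF s w maj, of p "Suc P"] that by (auto simp: r_def)
    have sum: "(\<lambda>k. \<Sum>p<Suc P. r p k) = (\<lambda>k. P * s k)"
    proof
      fix k
      have "(\<Sum>p<Suc P. r p k) = (\<Sum>p<Suc P. s k - (if p = level k mod Suc P then s k else 0))"
        by (intro sum.cong) (auto simp: r_def)
      also have "\<dots> = Suc P * s k - (\<Sum>p<Suc P. if p = level k mod Suc P then s k else 0)"
        by (simp only: sum_subtractf) simp
      also have "(\<Sum>p<Suc P. if p = level k mod Suc P then s k else 0) = s k"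
        using mod_less_divisor[of "Suc P" "level k"] by (subst sum.delta) simp_all
      finally show "(\<Sum>p<Suc P. r p k) = P * s k" by (simp add: algebra_simps)
    qed
    have Ps: "inE (\<lambda>k. P * s k)" using inE_sum[of "{..<Suc P}" r] r by (simp only: sum) simp
    have "NN (\<lambda>k. P * s k) \<le> (\<Sum>p<Suc P. NN (r p))"
      using NN_sum[of "{..<Suc P}" r] r by (simp only: sum) simp
    also have "\<dots> \<le> (\<Sum>p<Suc P. NN w)" by (intro sum_mono r)
    finally have *: "NN (\<lambda>k. P * s k) \<le> Suc P * NN w" by simp
    have sE: "inE s" using inE_scale[OF Ps, of "1 / P"] P by simp
    show ?thesis using * sE by (simp add: NN_scale)
  qed
  show "inE s" using main[of 1] by simp
  show "NN s \<le> NN w"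
  proof (rule LIMSEQ_le_const)
    have inv: "(\<lambda>n. 1 / real (Suc n)) \<longlonglongrightarrow> 0"
      using LIMSEQ_inverse_real_of_nat by (simp add: inverse_eq_divide)
    have "(\<lambda>n. NN w + (1 / Suc n) * NN w) \<longlonglongrightarrow> NN w + 0 * NN w"
      by (rule tendsto_add[OF tendsto_const tendsto_mult[OF inv tendsto_const]])
    thus "(\<lambda>n. NN w + (1 / Suc n) * NN w) \<longlonglongrightarrow> NN w" by simp
    have "NN s \<le> NN w + (1 / Suc n) * NN w" for n
      using main[of "Suc n"] by (simp add: field_simps)
    thus "\<exists>K. \<forall>n\<ge>K. NN s \<le> NN w + (1 / Suc n) * NN w" by blast
  qed
qed

end

section \<open>Singular values\<close>

subsection \<open>Positive operators and their square roots\<close>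

text \<open>Over the complex numbers the quadratic form is real at \<open>x + y\<close> and at \<open>x + \<i> y\<close>, which together
  determine the sesquilinear form.\<close>

lemma positive_op_selfadjoint:
  assumes "positive_op S"
  shows "cinner (blinfun_apply S x) y = cinner x (blinfun_apply S y)"
proof -
  let ?S = "blinfun_apply S"
  have S: "S \<in> bounded_ops" and real: "cinner (?S x) x \<in> \<real>\<^sub>\<ge>\<^sub>0" for x
    using assms by (auto simp: positive_op_def)
  have im: "Im (cinner (?S x) x) = 0" for x
    using real[of x] by (auto simp: complex_nonneg_Reals_iff)
  define u v where "u = cinner (?S x) y" and "v = cinner (?S y) x"
  have "Im (cinner (?S (x + y)) (x + y)) = Im (u + v)"
    using im[of x] im[of y]
    by (simp add: u_def v_def blinfun.add_right cinner_add_left cinner_add_right)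
  hence 1: "Im (u + v) = 0" using im by simp
  have "Im (cinner (?S (x + \<i> *\<^sub>C y)) (x + \<i> *\<^sub>C y)) = Re (v - u)"
    using im[of x] im[of y]
    by (simp add: u_def v_def blinfun.add_right cinner_add_left cinner_add_right
        bounded_ops_scaleC[OF S] cinner_scaleC_left cinner_scaleC_right)
  hence 2: "Re (v - u) = 0" using im by simp
  have "u = cnj v" using 1 2 by (simp add: complex_eq_iff)
  thus ?thesis using cinner_commute[of x "?S y"] by (simp add: u_def v_def)
qed

definition diag :: "(nat \<Rightarrow> real) \<Rightarrow> (nat \<Rightarrow> 'a::complex_hilbert) \<Rightarrow> ('a \<Rightarrow>\<^sub>L 'a)" where
  "diag c h = diagonal_op (\<lambda>n. complex_of_real (c n)) h h"

locale compact_diagonal =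
  fixes c :: "nat \<Rightarrow> real" and h :: "nat \<Rightarrow> 'a::complex_hilbert"
  assumes h: "partial_orthonormal h" and c: "vanishing (\<lambda>n. \<bar>c n\<bar>)"
    and supp: "\<And>n. c n \<noteq> 0 \<Longrightarrow> h n \<noteq> 0"
begin

lemma diagonal_of_real: "diagonal (\<lambda>n. complex_of_real (c n)) h h"
proof
  have "c \<longlonglongrightarrow> 0" using c unfolding vanishing_iff_tendsto by (simp add: tendsto_rabs_zero_iff)
  hence "bounded (range c)" by (intro convergent_imp_bounded convergentI)
  thus "bounded (range (\<lambda>n. complex_of_real (c n)))" by (simp add: bounded_iff)
qed (use h in auto)

sublocale D: diagonal "\<lambda>n. complex_of_real (c n)" h h by (rule diagonal_of_real)

lemma diag_bounded_op: "diag c h \<in> bounded_ops"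
  unfolding diag_def by (rule D.bounded_op)

lemma diag_apply_basis: "blinfun_apply (diag c h) (h n) = c n *\<^sub>R h n"
  unfolding diag_def D.apply_basis by (simp add: scaleC_of_real)

lemma diag_apply_orthogonal: "(\<And>n. c n \<noteq> 0 \<Longrightarrow> cinner y (h n) = 0) \<Longrightarrow> blinfun_apply (diag c h) y = 0"
proof -
  assume "\<And>n. c n \<noteq> 0 \<Longrightarrow> cinner y (h n) = 0"
  hence *: "(complex_of_real (c n) * cinner y (h n)) *\<^sub>C h n = 0" for n by (cases "c n = 0") auto
  show ?thesis unfolding diag_def D.apply_eq by (simp only: * suminf_zero)
qed

lemma diag_selfadjoint: "cinner (blinfun_apply (diag c h) x) y = cinner x (blinfun_apply (diag c h) y)"
  unfolding diag_def using cinner_diagonal_op_left[OF diagonal_of_real] by simp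

lemma diag_norm_le:
  assumes "\<And>n. cinner y (h n) \<noteq> 0 \<Longrightarrow> \<bar>c n\<bar> \<le> B" "0 \<le> B"
  shows "norm (blinfun_apply (diag c h) y) \<le> B * norm y"
  unfolding diag_def by (rule D.norm_apply_le) (use assms in auto)

lemma diag_positive:
  assumes "\<And>n. 0 \<le> c n"
  shows "positive_op (diag c h)"
  unfolding positive_op_def
proof (intro conjI allI diag_bounded_op)
  fix y
  have "(\<lambda>n. complex_of_real (c n) * cinner y (h n) * cinner (h n) y) sums
      cinner (blinfun_apply (diag c h) y) y"
    unfolding diag_def by (rule D.cinner_sums)
  moreover have "complex_of_real (c n) * cinner y (h n) * cinner (h n) y
      = complex_of_real (c n * (cmod (cinner y (h n)))\<^sup>2)" for n
    by (subst cinner_commute[of "h n" y])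
      (simp add: complex_norm_square mult.assoc del: of_real_power)
  ultimately have *: "(\<lambda>n. complex_of_real (c n * (cmod (cinner y (h n)))\<^sup>2)) sums
      cinner (blinfun_apply (diag c h) y) y" by simp
  have "(\<lambda>n. 0) sums Im (cinner (blinfun_apply (diag c h) y) y)" using sums_Im[OF *] by simp
  hence "Im (cinner (blinfun_apply (diag c h) y) y) = 0" using sums_zero sums_unique2 by blast
  moreover have "0 \<le> Re (cinner (blinfun_apply (diag c h) y) y)"
    using sums_le[OF _ sums_zero sums_Re[OF *]] assms by simp
  ultimately show "cinner (blinfun_apply (diag c h) y) y \<in> \<real>\<^sub>\<ge>\<^sub>0"
    by (simp add: complex_nonneg_Reals_iff)
qed

lemma eqI_diag:
  assumes "T \<in> bounded_ops" "\<And>n. blinfun_apply T (h n) = c n *\<^sub>R h n"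
    "\<And>y. (\<And>n. cinner y (h n) = 0) \<Longrightarrow> blinfun_apply T y = 0"
  shows "T = diag c h"
  by (rule bounded_op_eqI[OF h assms(1) diag_bounded_op])
    (simp_all add: assms diag_apply_basis diag_apply_orthogonal)

end

lemma compact_diagonal_modify:
  assumes "compact_diagonal c h" "\<And>n. \<bar>d n\<bar> \<le> \<bar>c n\<bar>"
  shows "compact_diagonal d h"
proof -
  interpret compact_diagonal c h by fact
  show ?thesis
  proof
    show "vanishing (\<lambda>n. \<bar>d n\<bar>)"
      by (rule vanishing_inj[OF c, of "\<lambda>n. n"]) (use assms(2) in auto)
    show "h n \<noteq> 0" if "d n \<noteq> 0" for n
    proof (rule supp)
      show "c n \<noteq> 0" using assms(2)[of n] that by auto
    qed
  qed (rule h)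
qed

lemma compact_diagonal_square:
  assumes "compact_diagonal c h"
  shows "compact_diagonal (\<lambda>n. (c n)\<^sup>2) h"
proof -
  interpret compact_diagonal c h by fact
  show ?thesis
  proof
    have "c \<longlonglongrightarrow> 0" using c unfolding vanishing_iff_tendsto by (simp add: tendsto_rabs_zero_iff)
    hence "(\<lambda>n. (c n)\<^sup>2) \<longlonglongrightarrow> 0\<^sup>2" by (rule tendsto_power)
    thus "vanishing (\<lambda>n. \<bar>(c n)\<^sup>2\<bar>)" unfolding vanishing_iff_tendsto by simp
  qed (use h supp in auto)
qed

lemma diag_compose_self:
  assumes "compact_diagonal c h"
  shows "diag c h o\<^sub>L diag c h = diag (\<lambda>n. (c n)\<^sup>2) h"
proof -
  interpret compact_diagonal c h by fact
  interpret sq: compact_diagonal "\<lambda>n. (c n)\<^sup>2" h by (rule compact_diagonal_square) fact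
  show ?thesis
    by (rule sq.eqI_diag)
      (auto simp: bounded_ops_intros diag_bounded_op diag_apply_basis blinfun.scaleR_right
        diag_apply_orthogonal blinfun.zero_right power2_eq_square)
qed

text \<open>On an eigenvector of \<open>S\<^sup>2\<close> for \<open>c\<^sup>2\<close> the vector \<open>S v - c v\<close> would be an eigenvector of the
  positive operator \<open>S\<close> for \<open>- c\<close>.\<close>

lemma positive_square_root_unique:
  assumes "compact_diagonal c h" "\<And>n. 0 \<le> c n"
    and S: "positive_op S" "S o\<^sub>L S = diag (\<lambda>n. (c n)\<^sup>2) h"
  shows "S = diag c h"
proof -
  interpret compact_diagonal c h by fact
  interpret sq: compact_diagonal "\<lambda>n. (c n)\<^sup>2" h by (rule compact_diagonal_square) fact
  let ?S = "blinfun_apply S"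
  have SS: "?S (?S y) = blinfun_apply (diag (\<lambda>n. (c n)\<^sup>2) h) y" for y
    using S(2) by (metis blinfun_apply_blinfun_compose)
  have ker: "?S y = 0" if "?S (?S y) = 0" for y
  proof -
    have "cinner (?S y) (?S y) = 0"
      using positive_op_selfadjoint[OF S(1), of "?S y" y] that by simp
    thus ?thesis by (simp add: cinner_self)
  qed
  show ?thesis
  proof (rule eqI_diag)
    show "S \<in> bounded_ops" using S(1) by (simp add: positive_op_def)
    fix n
    show "?S (h n) = c n *\<^sub>R h n"
    proof (cases "c n = 0")
      case True
      thus ?thesis using ker[of "h n"] by (simp add: SS sq.diag_apply_basis)
    next
      case False
      define z where "z = ?S (h n) - c n *\<^sub>R h n"
      have "?S z = - c n *\<^sub>R z"
        unfolding z_def blinfun.diff_right blinfun.scaleR_right SS sq.diag_apply_basis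
        by (simp add: power2_eq_square algebra_simps)
      hence "cinner (?S z) z = complex_of_real (- c n * (norm z)\<^sup>2)"
        by (simp add: cinner_scaleR_left cinner_self scaleR_conv_of_real)
      moreover have "cinner (?S z) z \<in> \<real>\<^sub>\<ge>\<^sub>0" using S(1) by (simp add: positive_op_def)
      ultimately have "0 \<le> - c n * (norm z)\<^sup>2" by (simp only: nonneg_Reals_of_real_iff)
      moreover have "0 < c n" using False assms(2)[of n] by simp
      ultimately have "z = 0" by (auto simp: mult_le_0_iff zero_le_mult_iff)
      thus ?thesis by (simp add: z_def)
    qed
  next
    fix y assume y: "\<And>n. cinner y (h n) = 0"
    show "?S y = 0" by (rule ker) (simp add: SS sq.diag_apply_orthogonal y)
  qed
qed

lemma abs_op_eq_diag:
  assumes "compact_diagonal c h" "\<And>n. 0 \<le> c n" "cadjoint T o\<^sub>L T = diag (\<lambda>n. (c n)\<^sup>2) h"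
  shows "abs_op T = diag c h"
  unfolding abs_op_def assms(3)
proof (rule the_equality)
  show "positive_op (diag c h) \<and> diag c h o\<^sub>L diag c h = diag (\<lambda>n. (c n)\<^sup>2) h"
    using compact_diagonal.diag_positive[OF assms(1,2)] diag_compose_self[OF assms(1)] by blast
qed (use positive_square_root_unique[OF assms(1,2)] in blast)

subsection \<open>Singular values as rearranged eigenvalues\<close>

text \<open>After subtracting its components along the \<open>h n\<close> with \<open>c n = s\<close>, an eigenvector for \<open>s\<close> is
  orthogonal to the whole system, hence lies in the kernel as well as in the eigenspace.\<close>

lemma dim_eigenspace_diag:
  assumes "compact_diagonal c h" "s \<noteq> 0"
  shows "complex_vector.dim {x. blinfun_apply (diag c h) x = complex_of_real s *\<^sub>C x} = card {n. c n = s}"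
proof -
  interpret compact_diagonal c h by fact
  let ?A = "{n. c n = s}" and ?V = "{x. blinfun_apply (diag c h) x = complex_of_real s *\<^sub>C x}"
  have fin: "finite ?A"
  proof (rule finite_subset)
    show "finite {n. \<bar>s\<bar> / 2 < \<bar>c n\<bar>}" using c assms(2) unfolding vanishing_def
      by (meson half_gt_zero zero_less_abs_iff)
    show "?A \<subseteq> {n. \<bar>s\<bar> / 2 < \<bar>c n\<bar>}" using assms(2) by auto
  qed
  have hA: "h n \<noteq> 0" if "n \<in> ?A" for n using supp[of n] that assms(2) by auto
  have inj: "inj_on h ?A"
  proof (rule inj_onI, rule ccontr)
    fix m n assume "m \<in> ?A" "n \<in> ?A" "h m = h n" "m \<noteq> n"
    thus False using hA[of m] partial_orthonormal_cinner[OF h, of m n]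
      by (simp add: partial_orthonormal_cinner[OF h])
  qed
  have ind: "\<not> complex_vector.dependent (h ` ?A)"
  proof (rule complex_vector.independent_if_scalars_zero)
    fix f x assume sum: "(\<Sum>x\<in>h ` ?A. f x *\<^sub>C x) = 0" and "x \<in> h ` ?A"
    then obtain n where n: "n \<in> ?A" "x = h n" by blast
    have "(\<Sum>i\<in>?A. f (h i) *\<^sub>C h i) = 0" using sum by (simp add: sum.reindex[OF inj])
    hence "cinner (\<Sum>i\<in>?A. f (h i) *\<^sub>C h i) (h n) = 0" by simp
    thus "f x = 0"
      unfolding cinner_sum_orthonormal[OF h fin] using n hA[OF n(1)] by simp
  qed (use fin in simp)
  have "?V = complex_vector.span (h ` ?A)"
  proof (intro equalityI subsetI)
    fix x assume x: "x \<in> ?V"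
    define z where "z = x - (\<Sum>i\<in>?A. cinner x (h i) *\<^sub>C h i)"
    have "blinfun_apply (diag c h) (\<Sum>i\<in>?A. cinner x (h i) *\<^sub>C h i)
        = (\<Sum>i\<in>?A. complex_of_real s *\<^sub>C (cinner x (h i) *\<^sub>C h i))"
      unfolding blinfun.sum_right
      by (intro sum.cong refl)
        (auto simp: bounded_ops_scaleC[OF diag_bounded_op] diag_apply_basis scaleC_of_real[symmetric]
          scaleC_scaleC mult.commute)
    hence z: "blinfun_apply (diag c h) z = complex_of_real s *\<^sub>C z"
      using x by (simp add: z_def blinfun.diff_right complex_vector.scale_right_diff_distrib
          complex_vector.scale_sum_right)
    have "cinner z (h n) = 0" for n
    proof (cases "n \<in> ?A")
      case True
      thus ?thesis using hA[OF True]
        by (simp add: z_def cinner_diff_left cinner_sum_orthonormal[OF h fin])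
    next
      case False
      have "complex_of_real s * cinner z (h n) = complex_of_real (c n) * cinner z (h n)"
        using diag_selfadjoint[of z "h n"]
        by (simp add: z diag_apply_basis cinner_scaleC_left cinner_scaleR_right scaleR_conv_of_real)
      thus ?thesis using False by simp
    qed
    hence "complex_of_real s *\<^sub>C z = 0" using z diag_apply_orthogonal[of z] by simp
    hence "z = 0" using assms(2) by simp
    hence "x = (\<Sum>i\<in>?A. cinner x (h i) *\<^sub>C h i)" by (simp add: z_def)
    moreover have "(\<Sum>i\<in>?A. cinner x (h i) *\<^sub>C h i) \<in> complex_vector.span (h ` ?A)"
      by (intro complex_vector.span_sum complex_vector.span_scale complex_vector.span_base) auto
    ultimately show "x \<in> complex_vector.span (h ` ?A)" by simp
  next
    fix x assume "x \<in> complex_vector.span (h ` ?A)"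
    thus "x \<in> ?V"
    proof (induction rule: complex_vector.span_induct_alt)
      case (step k y z)
      thus ?case
        by (auto simp: blinfun.add_right bounded_ops_scaleC[OF diag_bounded_op] diag_apply_basis
            scaleC_add_right scaleC_of_real[symmetric] complex_vector.scale_left_commute)
    qed (simp add: blinfun.zero_right)
  qed
  thus ?thesis
    by (simp only: complex_vector.dim_span_eq_card_independent[OF ind] card_image[OF inj])
qed

lemma decreasing_enumeration_cong:
  "(\<And>s. 0 < s \<Longrightarrow> m s = m' s) \<Longrightarrow> decreasing_enumeration m = decreasing_enumeration m'"
  unfolding decreasing_enumeration_def by (rule arg_cong[of _ _ The]) auto

lemma singular_values_eq_rearr:
  assumes "compact_diagonal c h" "\<And>n. 0 \<le> c n" "cadjoint T o\<^sub>L T = diag (\<lambda>n. (c n)\<^sup>2) h"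
  shows "singular_values T = rearr c"
  unfolding singular_values_def rearr_def abs_op_eq_diag[OF assms]
  by (rule decreasing_enumeration_cong) (simp add: dim_eigenspace_diag[OF assms(1)])

lemma cadjoint_selfadjoint:
  assumes "T \<in> bounded_ops" "\<And>x y. cinner (blinfun_apply T x) y = cinner x (blinfun_apply T y)"
  shows "cadjoint T = T"
  by (rule blinfun_eqI, rule cinner_ext) (simp add: cinner_cadjoint[OF assms(1)] assms(2))

lemma singular_values_diag:
  assumes "compact_diagonal c h"
  shows "singular_values (diag c h) = rearr (\<lambda>n. \<bar>c n\<bar>)"
proof -
  interpret compact_diagonal c h by fact
  have "cadjoint (diag c h) = diag c h"
    by (rule cadjoint_selfadjoint) (simp_all add: diag_bounded_op diag_selfadjoint)
  moreover have "compact_diagonal (\<lambda>n. \<bar>c n\<bar>) h" by (rule compact_diagonal_modify) (use assms in auto)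
  ultimately show ?thesis
    by (intro singular_values_eq_rearr) (simp_all add: diag_compose_self[OF assms])
qed

text \<open>The vectors \<open>h n\<close> are right singular vectors: \<open>T\<^sup>* T\<close> is diagonal with respect to them.\<close>

locale singular_system =
  fixes T :: "'a::complex_hilbert \<Rightarrow>\<^sub>L 'a" and h :: "nat \<Rightarrow> 'a"
  assumes T: "T \<in> bounded_ops" and h: "partial_orthonormal h"
    and supp: "\<And>n. h n = 0 \<longleftrightarrow> singular_values T n = 0"
    and vanish: "vanishing (singular_values T)" and dec: "decseq (singular_values T)"
    and gram: "cadjoint T o\<^sub>L T = diag (\<lambda>n. (singular_values T n)\<^sup>2) h"

lemma singular_system_exists:
  assumes T: "T \<in> bounded_ops" "compact_op T"
  obtains h where "singular_system T h"
proof -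
  let ?K = "cadjoint T o\<^sub>L T"
  have K: "?K \<in> bounded_ops" "compact_op ?K" "selfadjoint_op ?K"
    using T by (auto simp: bounded_ops_intros bounded_ops_cadjoint compact_op_compose_left
        selfadjoint_op_def cinner_cadjoint cinner_cadjoint')
  obtain l h where l: "partial_orthonormal h" "decseq (\<lambda>n. \<bar>l n\<bar>)" "l \<longlonglongrightarrow> 0"
      "\<And>n. h n = 0 \<longleftrightarrow> l n = 0" "?K = diagonal_op (\<lambda>n. complex_of_real (l n)) h h"
    using spectral_theorem[OF K] by blast
  have cl: "compact_diagonal l h"
    by unfold_locales (use l in \<open>auto simp: vanishing_iff_tendsto tendsto_rabs_zero\<close>)
  interpret L: compact_diagonal l h by (rule cl)
  have Kd: "?K = diag l h" using l(5) by (simp add: diag_def)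
  have l0: "0 \<le> l n" for n
  proof (cases "h n = 0")
    case False
    hence "norm (h n) = 1" using l(1) by (auto simp: partial_orthonormal_def)
    have "complex_of_real (l n) = cinner (blinfun_apply ?K (h n)) (h n)"
      unfolding Kd L.diag_apply_basis
      by (simp add: cinner_scaleR_left cinner_self \<open>norm (h n) = 1\<close> scaleR_conv_of_real)
    also have "\<dots> = complex_of_real ((norm (blinfun_apply T (h n)))\<^sup>2)"
      using cinner_self[of "blinfun_apply T (h n)"] by (simp add: cinner_cadjoint[OF T(1)])
    finally have "l n = (norm (blinfun_apply T (h n)))\<^sup>2" by (simp only: of_real_eq_iff)
    thus ?thesis by simp
  qed (use l(4) in simp)
  define c where "c n = sqrt (l n)" for n
  have c0: "0 \<le> c n" for n using l0 by (simp add: c_def)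
  have cv: "vanishing c"
    unfolding vanishing_iff_tendsto c_def using l0 tendsto_real_sqrt[OF l(3)] by simp
  have cc: "compact_diagonal c h"
  proof
    show "vanishing (\<lambda>n. \<bar>c n\<bar>)" using cv c0 by simp
    show "h n \<noteq> 0" if "c n \<noteq> 0" for n using that l(4)[of n] by (auto simp: c_def)
  qed (rule l(1))
  have lc: "l = (\<lambda>n. (c n)\<^sup>2)" using l0 by (simp add: c_def)
  have cdec: "decseq c" using l(2) l0 by (simp add: decseq_def c_def)
  have sv: "singular_values T = c"
    using singular_values_eq_rearr[OF cc c0] Kd lc rearr_decseq_eq[OF cv cdec] by simp
  have "singular_system T h"
    unfolding singular_system_def sv
  proof (intro conjI allI)
    show "h n = 0 \<longleftrightarrow> c n = 0" for n using l(4)[of n] by (simp add: c_def)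
    show "?K = diag (\<lambda>n. (c n)\<^sup>2) h" using Kd unfolding lc .
  qed (rule T(1) l(1) cv cdec)+
  thus ?thesis by (rule that)
qed

lemma
  assumes "T \<in> bounded_ops" "compact_op T"
  shows singular_values_vanishing: "vanishing (singular_values T)"
    and singular_values_decseq: "decseq (singular_values T)"
proof -
  obtain h where "singular_system T h" using singular_system_exists[OF assms] .
  thus "vanishing (singular_values T)" "decseq (singular_values T)"
    by (rule singular_system.vanish, rule singular_system.dec)
qed

context singular_system
begin

lemma nonneg: "0 \<le> singular_values T n"
  using vanish by (simp add: vanishing_def)

lemma mono: "m \<le> n \<Longrightarrow> singular_values T n \<le> singular_values T m"
  using dec by (simp add: decseq_def)

sublocale sq: compact_diagonal "\<lambda>n. (singular_values T n)\<^sup>2" h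
  by (rule compact_diagonal_square, unfold_locales) (use h vanish supp nonneg in auto)

lemma cinner_apply:
  "cinner (blinfun_apply T x) (blinfun_apply T y)
    = cinner (blinfun_apply (diag (\<lambda>n. (singular_values T n)\<^sup>2) h) x) y"
  unfolding gram[symmetric] by (simp add: cinner_cadjoint[OF T])

lemma norm_apply_le:
  assumes "\<And>i. i < n \<Longrightarrow> cinner y (h i) = 0"
  shows "norm (blinfun_apply T y) \<le> singular_values T n * norm y"
proof (rule power2_le_imp_le)
  let ?s = "singular_values T n"
  have "complex_of_real ((norm (blinfun_apply T y))\<^sup>2)
      = cinner (blinfun_apply (diag (\<lambda>n. (singular_values T n)\<^sup>2) h) y) y"
    unfolding cinner_self[symmetric] by (rule cinner_apply)
  hence "(norm (blinfun_apply T y))\<^sup>2 \<le> cmod (cinner (blinfun_apply (diag (\<lambda>n. (singular_values T n)\<^sup>2) h) y) y)"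
    by (metis abs_ge_self norm_of_real)
  also have "\<dots> \<le> norm (blinfun_apply (diag (\<lambda>n. (singular_values T n)\<^sup>2) h) y) * norm y"
    by (rule cinner_Cauchy_Schwarz)
  also have "\<dots> \<le> (?s\<^sup>2 * norm y) * norm y"
  proof (intro mult_right_mono sq.diag_norm_le)
    fix k assume "cinner y (h k) \<noteq> 0"
    hence "n \<le> k" using assms[of k] by (meson not_le)
    thus "\<bar>(singular_values T k)\<^sup>2\<bar> \<le> ?s\<^sup>2" using mono[of n k] nonneg[of k] by (simp add: power_mono)
  qed auto
  finally show "(norm (blinfun_apply T y))\<^sup>2 \<le> (?s * norm y)\<^sup>2" by (simp add: power2_eq_square mult_ac)
qed (use nonneg in simp)

lemma norm_apply_ge:
  assumes "finite J" "\<And>j. j \<in> J \<Longrightarrow> j \<le> n"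
  shows "singular_values T n * norm (\<Sum>j\<in>J. c j *\<^sub>C h j) \<le> norm (blinfun_apply T (\<Sum>j\<in>J. c j *\<^sub>C h j))"
proof (rule power2_le_imp_le)
  let ?s = "singular_values T" and ?y = "\<Sum>j\<in>J. c j *\<^sub>C h j"
  have Dy: "blinfun_apply (diag (\<lambda>n. (?s n)\<^sup>2) h) ?y = (\<Sum>j\<in>J. (complex_of_real ((?s j)\<^sup>2) * c j) *\<^sub>C h j)"
    unfolding blinfun.sum_right
    by (intro sum.cong refl)
      (simp add: bounded_ops_scaleC[OF sq.diag_bounded_op] sq.diag_apply_basis scaleC_of_real[symmetric]
          scaleC_scaleC mult.commute del: of_real_power)
  have "complex_of_real ((norm (blinfun_apply T ?y))\<^sup>2) = cinner (blinfun_apply (diag (\<lambda>n. (?s n)\<^sup>2) h) ?y) ?y"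
    unfolding cinner_self[symmetric] by (rule cinner_apply)
  also have "\<dots> = (\<Sum>j\<in>J. cnj (c j) * cinner (blinfun_apply (diag (\<lambda>n. (?s n)\<^sup>2) h) ?y) (h j))"
    by (simp only: cinner_sum_right cinner_scaleC_right)
  also have "\<dots> = (\<Sum>j\<in>J. complex_of_real (if h j = 0 then 0 else (?s j)\<^sup>2 * (cmod (c j))\<^sup>2))"
    unfolding Dy
    by (intro sum.cong refl)
      (auto simp: cinner_sum_orthonormal[OF h assms(1)] complex_norm_square mult_ac simp del: of_real_power)
  finally have "(norm (blinfun_apply T ?y))\<^sup>2 = (\<Sum>j\<in>J. if h j = 0 then 0 else (?s j)\<^sup>2 * (cmod (c j))\<^sup>2)"
    by (simp only: of_real_sum[symmetric] of_real_eq_iff)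
  also have "\<dots> \<ge> (\<Sum>j\<in>J. (?s n)\<^sup>2 * (if h j = 0 then 0 else (cmod (c j))\<^sup>2))"
    using mono[OF assms(2)] nonneg by (intro sum_mono) (auto intro!: mult_right_mono power_mono)
  also have "(\<Sum>j\<in>J. (?s n)\<^sup>2 * (if h j = 0 then 0 else (cmod (c j))\<^sup>2)) = (?s n * norm ?y)\<^sup>2"
    by (simp add: power_mult_distrib norm_sum_orthonormal[OF h assms(1)] sum_distrib_left)
  finally show "(?s n * norm ?y)\<^sup>2 \<le> (norm (blinfun_apply T ?y))\<^sup>2" .
qed simp

end

text \<open>Elimination of one unknown by means of one equation.\<close>

lemma homogeneous_system_solution:
  fixes A :: "'i \<Rightarrow> 'j \<Rightarrow> complex"
  assumes "finite I" "finite J" "card I < card J"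
  shows "\<exists>c. (\<exists>j\<in>J. c j \<noteq> 0) \<and> (\<forall>i\<in>I. (\<Sum>j\<in>J. A i j * c j) = 0)"
  using assms
proof (induction I arbitrary: J A rule: finite_induct)
  case empty
  then obtain j where "j \<in> J" by fastforce
  thus ?case by (intro exI[of _ "\<lambda>_. 1"]) auto
next
  case (insert i I)
  show ?case
  proof (cases "\<forall>p\<in>J. A i p = 0")
    case True
    from insert.IH[of J A] insert.prems insert.hyps obtain c
      where "\<exists>j\<in>J. c j \<noteq> 0" "\<forall>i\<in>I. (\<Sum>j\<in>J. A i j * c j) = 0" by auto
    thus ?thesis using True by (intro exI[of _ c]) auto
  next
    case False
    then obtain p where p: "p \<in> J" "A i p \<noteq> 0" by blast
    define B where "B k j = A k j - A k p * A i j / A i p" for k j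
    have "card I < card (J - {p})" using insert p by simp
    from insert.IH[of "J - {p}" B] this insert.prems(1) obtain c
      where c: "\<exists>j\<in>J - {p}. c j \<noteq> 0" "\<forall>k\<in>I. (\<Sum>j\<in>J - {p}. B k j * c j) = 0" by auto
    define S where "S k = (\<Sum>j\<in>J - {p}. A k j * c j)" for k
    define c' where "c' = c(p := - S i / A i p)"
    have sum: "(\<Sum>j\<in>J. A k j * c' j) = A k p * (- S i / A i p) + S k" for k
    proof -
      have "(\<Sum>j\<in>J. A k j * c' j) = A k p * c' p + (\<Sum>j\<in>J - {p}. A k j * c' j)"
        using insert.prems(1) p(1) by (simp add: sum.remove)
      also have "(\<Sum>j\<in>J - {p}. A k j * c' j) = S k" unfolding S_def by (intro sum.cong) (auto simp: c'_def)
      finally show ?thesis by (simp add: c'_def)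
    qed
    have "(\<Sum>j\<in>J. A k j * c' j) = 0" if "k \<in> insert i I" for k
    proof (cases "k = i")
      case True
      thus ?thesis using p(2) by (simp add: sum)
    next
      case False
      hence "(\<Sum>j\<in>J - {p}. B k j * c j) = 0" using c(2) that by auto
      moreover have "(\<Sum>j\<in>J - {p}. B k j * c j) = S k - A k p / A i p * S i"
        unfolding S_def B_def sum_distrib_left sum_subtractf[symmetric]
        by (intro sum.cong refl) (simp add: algebra_simps)
      ultimately show ?thesis by (simp add: sum)
    qed
    moreover have "\<exists>j\<in>J. c' j \<noteq> 0" using c(1) by (auto simp: c'_def)
    ultimately show ?thesis by (intro exI[of _ c']) auto
  qed
qed

text \<open>The minimax principle, in the form of a lower bound for one singular value: among more than
  \<open>r + n\<close> orthonormal vectors some combination satisfies \<open>r\<close> prescribed linear conditions and is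
  orthogonal to the first \<open>n\<close> singular vectors.\<close>

lemma singular_value_ge:
  fixes T :: "'a::complex_hilbert \<Rightarrow>\<^sub>L 'a" and z :: "nat \<Rightarrow> 'a"
  assumes T: "T \<in> bounded_ops" "compact_op T" and f: "partial_orthonormal f"
    and J: "finite J" "\<And>j. j \<in> J \<Longrightarrow> f j \<noteq> 0" "r + n < card J"
    and bound: "\<And>c. (\<And>i. i < r \<Longrightarrow> cinner (\<Sum>j\<in>J. c j *\<^sub>C f j) (z i) = 0) \<Longrightarrow>
      t * norm (\<Sum>j\<in>J. c j *\<^sub>C f j) \<le> norm (blinfun_apply T (\<Sum>j\<in>J. c j *\<^sub>C f j))"
  shows "t \<le> singular_values T n"
proof -
  obtain h where "singular_system T h" using singular_system_exists[OF T] .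
  then interpret singular_system T h .
  define u where "u i = (if i < r then z i else h (i - r))" for i
  obtain c where c: "\<exists>j\<in>J. c j \<noteq> 0" "\<forall>i\<in>{..<r + n}. (\<Sum>j\<in>J. cinner (f j) (u i) * c j) = 0"
    using homogeneous_system_solution[OF finite_lessThan J(1), of "r + n" "\<lambda>i j. cinner (f j) (u i)"] J(3)
    by auto
  let ?y = "\<Sum>j\<in>J. c j *\<^sub>C f j"
  have u: "cinner ?y (u i) = 0" if "i < r + n" for i
    using c(2) that by (simp add: cinner_sum_left cinner_scaleC_left mult.commute)
  have "(norm ?y)\<^sup>2 = (\<Sum>j\<in>J. (cmod (c j))\<^sup>2)"
    unfolding norm_sum_orthonormal[OF f J(1)] by (rule sum.cong) (use J(2) in auto)
  also have "\<dots> \<noteq> 0" using c(1) J(1) by (simp add: sum_nonneg_eq_0_iff)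
  finally have y: "norm ?y > 0" by simp
  have "t * norm ?y \<le> norm (blinfun_apply T ?y)"
  proof (rule bound)
    fix i assume "i < r"
    thus "cinner ?y (z i) = 0" using u[of i] by (simp add: u_def)
  qed
  also have "\<dots> \<le> singular_values T n * norm ?y"
  proof (rule norm_apply_le)
    fix i assume "i < n"
    thus "cinner ?y (h i) = 0" using u[of "r + i"] by (simp add: u_def)
  qed
  finally show ?thesis using y by simp
qed

text \<open>On the span of the first \<open>r + n + 1\<close> singular vectors \<open>T\<close> is bounded below by its singular value
  number \<open>r + n\<close>, and \<open>S\<close> inherits this where the \<open>r\<close> conditions hold.\<close>

lemma singular_values_shift:
  fixes S T :: "'a::complex_hilbert \<Rightarrow>\<^sub>L 'a" and z :: "nat \<Rightarrow> 'a"
  assumes T: "T \<in> bounded_ops" "compact_op T" and S: "S \<in> bounded_ops" "compact_op S"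
    and eq: "\<And>y. (\<And>i. i < r \<Longrightarrow> cinner y (z i) = 0) \<Longrightarrow> blinfun_apply T y = blinfun_apply S y"
  shows "singular_values T (r + n) \<le> singular_values S n"
proof (cases "singular_values T (r + n) = 0")
  case True
  thus ?thesis using singular_values_vanishing[OF S] by (simp add: vanishing_def)
next
  case False
  obtain h where "singular_system T h" using singular_system_exists[OF T] .
  then interpret singular_system T h .
  show ?thesis
  proof (rule singular_value_ge[OF S h, of "{..r + n}" r])
    fix j assume "j \<in> {..r + n}"
    hence "singular_values T j \<noteq> 0" using mono[of j "r + n"] nonneg[of "r + n"] False by auto
    thus "h j \<noteq> 0" using supp by simp
  next
    fix c assume "\<And>i. i < r \<Longrightarrow> cinner (\<Sum>j\<le>r + n. c j *\<^sub>C h j) (z i) = 0"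
    thus "singular_values T (r + n) * norm (\<Sum>j\<le>r + n. c j *\<^sub>C h j)
        \<le> norm (blinfun_apply S (\<Sum>j\<le>r + n. c j *\<^sub>C h j))"
      using norm_apply_ge[of "{..r + n}" "r + n" c] eq by simp
  qed auto
qed

lemma singular_values_scaleR_le:
  fixes T :: "'a::complex_hilbert \<Rightarrow>\<^sub>L 'a"
  assumes T: "T \<in> bounded_ops" "compact_op T" and r: "0 < r"
  shows "singular_values (r *\<^sub>R T) n \<le> r * singular_values T n"
proof (cases "singular_values (r *\<^sub>R T) n = 0")
  case True
  thus ?thesis using singular_values_vanishing[OF T] r by (simp add: vanishing_def)
next
  case False
  obtain h where "singular_system (r *\<^sub>R T) h"
    using singular_system_exists[OF bounded_ops_scaleR[OF T(1)] compact_op_scaleR[OF T(2)]] .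
  then interpret S: singular_system "r *\<^sub>R T" h .
  have "singular_values (r *\<^sub>R T) n / r \<le> singular_values T n"
  proof (rule singular_value_ge[OF T S.h, of "{..n}" 0])
    fix j assume "j \<in> {..n}"
    hence "singular_values (r *\<^sub>R T) j \<noteq> 0" using S.mono[of j n] S.nonneg[of n] False by auto
    thus "h j \<noteq> 0" using S.supp by simp
  next
    fix c
    have "singular_values (r *\<^sub>R T) n * norm (\<Sum>j\<le>n. c j *\<^sub>C h j)
        \<le> r * norm (blinfun_apply T (\<Sum>j\<le>n. c j *\<^sub>C h j))"
      using S.norm_apply_ge[of "{..n}" n c] r by (simp add: scaleR_blinfun.rep_eq)
    thus "singular_values (r *\<^sub>R T) n / r * norm (\<Sum>j\<le>n. c j *\<^sub>C h j)
        \<le> norm (blinfun_apply T (\<Sum>j\<le>n. c j *\<^sub>C h j))"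
      using r by (simp add: field_simps)
  qed auto
  thus ?thesis using r by (simp add: field_simps)
qed

subsection \<open>Positive and negative parts\<close>

text \<open>Positions with eigenvalue zero carry no vector, so that only the supports of the two sequences
  have to be matched.\<close>

lemma diag_reindex:
  assumes l: "compact_diagonal l f" and inj: "inj_on \<pi> {n. t n \<noteq> 0}"
    and val: "\<And>n. t n \<noteq> 0 \<Longrightarrow> l (\<pi> n) = t n"
    and surj: "\<And>i. l i \<noteq> 0 \<Longrightarrow> \<exists>n. t n \<noteq> 0 \<and> \<pi> n = i"
  defines "h \<equiv> (\<lambda>n. if t n \<noteq> 0 then f (\<pi> n) else 0)"
  shows "compact_diagonal t h" and "diag l f = diag t h" and "\<And>n. h n = 0 \<longleftrightarrow> t n = 0"
proof -
  interpret l: compact_diagonal l f by fact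
  show h0: "h n = 0 \<longleftrightarrow> t n = 0" for n using l.supp[of "\<pi> n"] val[of n] by (auto simp: h_def)
  show t: "compact_diagonal t h"
  proof
    show "partial_orthonormal h" unfolding h_def by (rule partial_orthonormal_reindex[OF l.h inj])
    have "inj_on \<pi> {n. \<bar>t n\<bar> \<noteq> 0}" using inj by simp
    thus "vanishing (\<lambda>n. \<bar>t n\<bar>)" by (rule vanishing_inj[OF l.c]) (use val in auto)
  qed (use h0 in blast)
  interpret t: compact_diagonal t h by fact
  show "diag l f = diag t h"
  proof (rule t.eqI_diag[OF l.diag_bounded_op])
    show "blinfun_apply (diag l f) (h n) = t n *\<^sub>R h n" for n
      using val[of n] by (auto simp: h_def l.diag_apply_basis blinfun.zero_right)
  next
    fix y assume y: "\<And>n. cinner y (h n) = 0"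
    show "blinfun_apply (diag l f) y = 0"
    proof (rule l.diag_apply_orthogonal)
      fix i assume "l i \<noteq> 0"
      then obtain n where "t n \<noteq> 0" "\<pi> n = i" using surj by blast
      thus "cinner y (f i) = 0" using y[of n] by (simp add: h_def)
    qed
  qed
qed

lemma diag_add:
  assumes "compact_diagonal c h" "compact_diagonal d h" "compact_diagonal (\<lambda>n. c n + d n) h"
  shows "diag (\<lambda>n. c n + d n) h = diag c h + diag d h"
proof -
  interpret c: compact_diagonal c h by fact
  interpret d: compact_diagonal d h by fact
  interpret s: compact_diagonal "\<lambda>n. c n + d n" h by fact
  show ?thesis
    by (rule s.eqI_diag[symmetric])
      (simp_all add: bounded_ops_add c.diag_bounded_op d.diag_bounded_op plus_blinfun.rep_eq
        c.diag_apply_basis d.diag_apply_basis c.diag_apply_orthogonal d.diag_apply_orthogonal scaleR_add_left)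
qed

lemma diag_minus:
  assumes "compact_diagonal c h"
  shows "diag (\<lambda>n. - c n) h = - diag c h"
proof -
  interpret c: compact_diagonal c h by fact
  interpret m: compact_diagonal "\<lambda>n. - c n" h by (rule compact_diagonal_modify) (use assms in auto)
  show ?thesis
    by (rule m.eqI_diag[symmetric])
      (simp_all add: bounded_ops_minus c.diag_bounded_op uminus_blinfun.rep_eq
        c.diag_apply_basis c.diag_apply_orthogonal)
qed

text \<open>If \<open>a = p - m\<close> with \<open>p m = 0\<close>, then \<open>(p + m)\<^sup>2 = a\<^sup>2\<close>, so that \<open>p + m\<close> is the unique positive
  square root of \<open>a\<^sup>2\<close>, which determines \<open>p\<close> and \<open>m\<close>.\<close>

lemma pos_neg_decomposition_unique:
  assumes l: "compact_diagonal l h" and dec: "pos_neg_decomposition (diag l h) p m"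
  shows "p + m = diag (\<lambda>n. \<bar>l n\<bar>) h"
proof (rule positive_square_root_unique)
  show "compact_diagonal (\<lambda>n. \<bar>l n\<bar>) h" by (rule compact_diagonal_modify) (use l in auto)
  have pm: "diag l h = p - m" "positive_op p" "positive_op m" "p o\<^sub>L m = 0"
    using dec by (auto simp: pos_neg_decomposition_def)
  have 0: "blinfun_apply p (blinfun_apply m y) = 0" for y
    using pm(4) by (metis blinfun_apply_blinfun_compose zero_blinfun.rep_eq)
  have 1: "blinfun_apply m (blinfun_apply p y) = 0" for y
  proof (rule cinner_eq_zero_all)
    fix z
    show "cinner (blinfun_apply m (blinfun_apply p y)) z = 0"
      using positive_op_selfadjoint[OF pm(3)] positive_op_selfadjoint[OF pm(2)] 0 by simp
  qed
  have "(p + m) o\<^sub>L (p + m) = diag l h o\<^sub>L diag l h"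
    unfolding pm(1)
    by (rule blinfun_eqI)
      (simp add: plus_blinfun.rep_eq minus_blinfun.rep_eq blinfun.add_right blinfun.diff_right 0 1)
  thus "(p + m) o\<^sub>L (p + m) = diag (\<lambda>n. \<bar>l n\<bar>\<^sup>2) h" by (simp add: diag_compose_self[OF l])
  show "positive_op (p + m)"
    using pm(2,3) unfolding positive_op_def
    by (auto simp: bounded_ops_add plus_blinfun.rep_eq cinner_add_left nonneg_Reals_add_I)
qed simp

lemma
  assumes l: "compact_diagonal l h"
  shows pos_op_diag: "pos_op (diag l h) = diag (\<lambda>n. max (l n) 0) h"
    and neg_op_diag: "neg_op (diag l h) = diag (\<lambda>n. max (- l n) 0) h"
proof -
  let ?p = "diag (\<lambda>n. max (l n) 0) h" and ?m = "diag (\<lambda>n. max (- l n) 0) h"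
  have p: "compact_diagonal (\<lambda>n. max (l n) 0) h" and m: "compact_diagonal (\<lambda>n. max (- l n) 0) h"
    by (rule compact_diagonal_modify[OF l], simp)+
  interpret p: compact_diagonal "\<lambda>n. max (l n) 0" h by (rule p)
  interpret m: compact_diagonal "\<lambda>n. max (- l n) 0" h by (rule m)
  interpret l: compact_diagonal l h by (rule l)
  have sub: "diag l h = ?p - ?m"
  proof -
    have "?p - ?m = diag l h"
    proof (rule l.eqI_diag)
      fix n
      have "max (l n) 0 - max (- l n) 0 = l n" by simp
      thus "blinfun_apply (?p - ?m) (h n) = l n *\<^sub>R h n"
        by (simp add: minus_blinfun.rep_eq p.diag_apply_basis m.diag_apply_basis
            scaleR_diff_left[symmetric])
    qed (simp_all add: bounded_ops_diff p.diag_bounded_op m.diag_bounded_op minus_blinfun.rep_eq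
        p.diag_apply_orthogonal m.diag_apply_orthogonal)
    thus ?thesis by simp
  qed
  have "?p o\<^sub>L ?m = 0"
  proof (rule bounded_op_eqI[OF l.h])
    fix n
    have "max (l n) 0 * max (- l n) 0 = 0" by (simp add: max_def)
    thus "blinfun_apply (?p o\<^sub>L ?m) (h n) = blinfun_apply 0 (h n)"
      by (auto simp: m.diag_apply_basis p.diag_apply_basis blinfun.scaleR_right)
  qed (simp_all add: bounded_ops_intros p.diag_bounded_op m.diag_bounded_op
      m.diag_apply_orthogonal blinfun.zero_right)
  hence dec: "pos_neg_decomposition (diag l h) ?p ?m"
    using sub p.diag_positive m.diag_positive by (simp add: pos_neg_decomposition_def)
  have uniq: "p' = ?p \<and> m' = ?m" if "pos_neg_decomposition (diag l h) p' m'" for p' m'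
  proof -
    have "p' + m' = ?p + ?m"
      using pos_neg_decomposition_unique[OF l that] pos_neg_decomposition_unique[OF l dec] by simp
    moreover have "p' - m' = ?p - ?m" using that sub by (simp add: pos_neg_decomposition_def)
    ultimately have "p' + m' + (p' - m') = ?p + ?m + (?p - ?m)" by (simp only:)
    hence "2 *\<^sub>R p' = 2 *\<^sub>R ?p" by (simp add: scaleR_2)
    hence "p' = ?p" by simp
    thus ?thesis using \<open>p' + m' = ?p + ?m\<close> by simp
  qed
  show "pos_op (diag l h) = ?p" unfolding pos_op_def using dec uniq by (intro the_equality) blast+
  show "neg_op (diag l h) = ?m" unfolding neg_op_def using dec uniq by (intro the_equality) blast+
qed

text \<open>Even positions carry one sign and odd positions the other. This is the arrangement in which
  the direct sum of sequences interleaves its summands.\<close>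

definition interleave :: "(nat \<Rightarrow> 'b) \<Rightarrow> (nat \<Rightarrow> 'b) \<Rightarrow> nat \<Rightarrow> 'b" where
  "interleave f g n = (if even n then f (n div 2) else g (n div 2))"

lemma interleave_simps [simp]:
  "interleave f g (2 * k) = f k" "interleave f g (Suc (2 * k)) = g k"
  by (simp_all add: interleave_def)

text \<open>The rearranged positive eigenvalues and the rearranged negative ones are matched with the
  eigenvectors separately; the parity of the position records the sign, so the two matchings do not
  interfere.\<close>

lemma signed_spectral_representation:
  fixes a :: "'a::complex_hilbert \<Rightarrow>\<^sub>L 'a"
  assumes a: "a \<in> bounded_ops" "compact_op a" "selfadjoint_op a"
  defines "t \<equiv> interleave (singular_values (pos_op a)) (\<lambda>k. - singular_values (neg_op a) k)"
  obtains h where "compact_diagonal t h" "a = diag t h"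
    "\<And>k. 0 \<le> singular_values (pos_op a) k" "decseq (singular_values (pos_op a))"
    "\<And>k. 0 \<le> singular_values (neg_op a) k" "decseq (singular_values (neg_op a))"
proof -
  obtain l f where l: "partial_orthonormal f" "decseq (\<lambda>n. \<bar>l n\<bar>)" "l \<longlonglongrightarrow> 0"
      "\<And>n. f n = 0 \<longleftrightarrow> l n = 0" "a = diagonal_op (\<lambda>n. complex_of_real (l n)) f f"
    using spectral_theorem[OF a] by blast
  have cl: "compact_diagonal l f"
    by unfold_locales (use l in \<open>auto simp: vanishing_iff_tendsto tendsto_rabs_zero\<close>)
  have al: "a = diag l f" using l(5) by (simp add: diag_def)
  let ?p = "\<lambda>n. max (l n) 0" and ?m = "\<lambda>n. max (- l n) 0"
  have p: "compact_diagonal ?p f" and m: "compact_diagonal ?m f"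
    by (rule compact_diagonal_modify[OF cl], simp)+
  have vp: "vanishing ?p" and vm: "vanishing ?m"
    using compact_diagonal.c[OF p] compact_diagonal.c[OF m] by simp_all
  have sp: "singular_values (pos_op a) = rearr ?p" and sm: "singular_values (neg_op a) = rearr ?m"
    unfolding al pos_op_diag[OF cl] neg_op_diag[OF cl] singular_values_diag[OF p] singular_values_diag[OF m]
    by simp_all
  obtain \<pi> where \<pi>: "bij_betw \<pi> {n. rearr ?p n \<noteq> 0} {i. ?p i \<noteq> 0}"
      "\<And>n. rearr ?p n \<noteq> 0 \<Longrightarrow> ?p (\<pi> n) = rearr ?p n" using rearr_matching[OF vp] by blast
  obtain \<rho> where \<rho>: "bij_betw \<rho> {n. rearr ?m n \<noteq> 0} {i. ?m i \<noteq> 0}"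
      "\<And>n. rearr ?m n \<noteq> 0 \<Longrightarrow> ?m (\<rho> n) = rearr ?m n" using rearr_matching[OF vm] by blast
  have t: "t = interleave (rearr ?p) (\<lambda>k. - rearr ?m k)" by (simp add: t_def sp sm)
  define ix where "ix = interleave \<pi> \<rho>"
  have val: "l (ix n) = t n" if "t n \<noteq> 0" for n
    using that \<pi>(2)[of "n div 2"] \<rho>(2)[of "n div 2"]
    by (auto simp: t ix_def interleave_def max_def split: if_splits)
  have sign: "even n \<longleftrightarrow> 0 < t n" if "t n \<noteq> 0" for n
    using that rearr_nonneg[OF vp, of "n div 2"] rearr_nonneg[OF vm, of "n div 2"]
    by (auto simp: t interleave_def)
  have inj: "inj_on ix {n. t n \<noteq> 0}"
  proof (rule inj_onI)
    fix j k assume jk: "j \<in> {n. t n \<noteq> 0}" "k \<in> {n. t n \<noteq> 0}" and eq: "ix j = ix k"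
    have "t j = t k" using val[of j] val[of k] jk eq by simp
    hence par: "even j \<longleftrightarrow> even k" using sign[of j] sign[of k] jk by simp
    have "j div 2 = k div 2"
    proof (cases "even j")
      case True
      thus ?thesis using jk eq par inj_onD[OF bij_betw_imp_inj_on[OF \<pi>(1)], of "j div 2" "k div 2"]
        by (auto simp: ix_def t interleave_def)
    next
      case False
      thus ?thesis using jk eq par inj_onD[OF bij_betw_imp_inj_on[OF \<rho>(1)], of "j div 2" "k div 2"]
        by (auto simp: ix_def t interleave_def)
    qed
    thus "j = k" using par by (metis dvd_mult_div_cancel odd_two_times_div_two_succ)
  qed
  have surj: "\<exists>n. t n \<noteq> 0 \<and> ix n = i" if "l i \<noteq> 0" for i
  proof (cases "0 < l i")
    case True
    hence "i \<in> \<pi> ` {n. rearr ?p n \<noteq> 0}" using \<pi>(1) by (auto simp: bij_betw_def)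
    then obtain k where "rearr ?p k \<noteq> 0" "i = \<pi> k" by blast
    thus ?thesis by (intro exI[of _ "2 * k"]) (simp add: t ix_def)
  next
    case False
    hence "?m i \<noteq> 0" using that by auto
    hence "i \<in> \<rho> ` {n. rearr ?m n \<noteq> 0}" using \<rho>(1) by (auto simp: bij_betw_def)
    then obtain k where "rearr ?m k \<noteq> 0" "i = \<rho> k" by blast
    thus ?thesis by (intro exI[of _ "Suc (2 * k)"]) (simp add: t ix_def)
  qed
  show ?thesis
    by (rule that[OF diag_reindex(1)[OF cl inj val surj] trans[OF al diag_reindex(2)[OF cl inj val surj]]])
      (simp_all only: not_False_eq_True sp sm rearr_nonneg[OF vp] rearr_nonneg[OF vm] rearr_decseq[OF vp] rearr_decseq[OF vm])
qed

subsection \<open>Truncation\<close>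

definition truncated :: "nat set \<Rightarrow> (nat \<Rightarrow> real) \<Rightarrow> nat \<Rightarrow> real" where
  "truncated A c n = (if n \<in> A then c n else 0)"

context compact_diagonal
begin

lemma restrict_diagonal: "compact_diagonal (truncated A c) h"
  by (rule compact_diagonal_modify, unfold_locales) (simp add: truncated_def)

lemma diag_split: "diag c h = diag (truncated A c) h + diag (truncated (- A) c) h"
proof -
  have eq: "(\<lambda>n. truncated A c n + truncated (- A) c n) = c" by (auto simp: truncated_def)
  have "compact_diagonal c h" by unfold_locales
  thus ?thesis
    using diag_add[OF restrict_diagonal[of A] restrict_diagonal[of "- A"]] unfolding eq by simp
qed

text \<open>Truncation is composition with the projection onto the span of the \<open>h n\<close> with \<open>n \<in> A\<close>.\<close>

lemma compact_restrict:
  assumes "compact_op (diag c h)"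
  shows "compact_op (diag (truncated A c) h)"
proof -
  interpret P: diagonal "indicator A" h h
  proof
    show "bounded (range (indicator A :: nat \<Rightarrow> complex))"
      by (rule boundedI[of _ 1]) (auto simp: indicator_def)
  qed (use h in auto)
  interpret R: compact_diagonal "truncated A c" h by (rule restrict_diagonal)
  have "diag c h o\<^sub>L diagonal_op (indicator A) h h = diag (truncated A c) h"
  proof (rule R.eqI_diag)
    fix n
    show "blinfun_apply (diag c h o\<^sub>L diagonal_op (indicator A) h h) (h n) = truncated A c n *\<^sub>R h n"
      by (cases "n \<in> A")
        (auto simp: P.apply_basis blinfun.zero_right diag_apply_basis truncated_def)
  qed (simp_all add: bounded_ops_intros diag_bounded_op P.bounded_op P.apply_orthogonal blinfun.zero_right)
  thus ?thesis using compact_op_compose_right[OF assms] by metis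
qed

lemma cinner_diag_approx:
  assumes F: "finite F" and small: "\<And>n. n \<notin> F \<Longrightarrow> \<bar>c n\<bar> \<le> \<epsilon>" "0 \<le> \<epsilon>"
  shows "cmod (cinner (blinfun_apply (diag c h) y) z - (\<Sum>n\<in>F. c n * cinner y (h n) * cinner (h n) z))
    \<le> \<epsilon> * norm y * norm z"
proof -
  interpret F: compact_diagonal "truncated F c" h by (rule restrict_diagonal)
  interpret G: compact_diagonal "truncated (- F) c" h by (rule restrict_diagonal)
  have "(\<lambda>n. truncated F c n * cinner y (h n) * cinner (h n) z) sums
      (\<Sum>n\<in>F. truncated F c n * cinner y (h n) * cinner (h n) z)"
    by (rule sums_finite[OF F]) (simp add: truncated_def)
  hence "cinner (blinfun_apply (diag (truncated F c) h) y) z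
      = (\<Sum>n\<in>F. truncated F c n * cinner y (h n) * cinner (h n) z)"
    unfolding diag_def using F.D.cinner_sums sums_unique2 by blast
  also have "\<dots> = (\<Sum>n\<in>F. c n * cinner y (h n) * cinner (h n) z)"
    by (intro sum.cong) (auto simp: truncated_def)
  finally have diff: "cinner (blinfun_apply (diag c h) y) z - (\<Sum>n\<in>F. c n * cinner y (h n) * cinner (h n) z)
      = cinner (blinfun_apply (diag (truncated (- F) c) h) y) z"
    by (subst diag_split[of F]) (simp add: plus_blinfun.rep_eq cinner_add_left)
  have 1: "cmod (cinner (blinfun_apply (diag (truncated (- F) c) h) y) z)
      \<le> norm (blinfun_apply (diag (truncated (- F) c) h) y) * norm z"
    by (rule cinner_Cauchy_Schwarz)
  have "norm (blinfun_apply (diag (truncated (- F) c) h) y) \<le> \<epsilon> * norm y"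
    by (rule G.diag_norm_le) (use small in \<open>auto simp: truncated_def\<close>)
  hence 2: "norm (blinfun_apply (diag (truncated (- F) c) h) y) * norm z \<le> \<epsilon> * norm y * norm z"
    by (rule mult_right_mono) simp
  show ?thesis unfolding diff by (rule order_trans[OF 1 2])
qed

end

section \<open>The upper bound\<close>

lemma sum_unit_ramp:
  assumes "0 \<le> P"
  shows "(\<Sum>j<J. max 0 (min 1 (P - real j))) = min P (real J)"
proof (induction J)
  case (Suc J)
  thus ?case by (auto simp: min_def max_def)
qed (use assms in simp)

text \<open>Among weights in \<open>[0, 1]\<close> of total mass at most \<open>P\<close>, a decreasing sequence prefers those that
  fill up the initial positions.\<close>

lemma decreasing_weighted_sum_le:
  fixes \<alpha> A :: "nat \<Rightarrow> real"
  assumes "\<And>j. \<alpha> (Suc j) \<le> \<alpha> j" "\<And>j. 0 \<le> \<alpha> j" "\<And>j. 0 \<le> A j \<and> A j \<le> 1" "(\<Sum>j<J. A j) \<le> P"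
  shows "(\<Sum>j<J. \<alpha> j * A j) \<le> (\<Sum>j<J. \<alpha> j * max 0 (min 1 (P - real j)))"
proof (rule abel_summation_le)
  fix m assume "m \<le> J"
  have P: "0 \<le> P" using assms(3,4) by (meson order_trans sum_nonneg)
  have "(\<Sum>j<m. A j) \<le> (\<Sum>j<J. A j)" using assms(3) \<open>m \<le> J\<close> by (intro sum_mono2) auto
  moreover have "(\<Sum>j<m. A j) \<le> (\<Sum>j<m. 1)" using assms(3) by (intro sum_mono) auto
  ultimately show "(\<Sum>j<m. A j) \<le> (\<Sum>j<m. max 0 (min 1 (P - real j)))"
    using assms(4) by (simp add: sum_unit_ramp[OF P])
qed (use assms in auto)

lemma sum_even_odd:
  fixes f :: "nat \<Rightarrow> real"
  shows "(\<Sum>i=2 * n..<2 * n + 2 * J. f i) = (\<Sum>j<J. f (2 * (n + j))) + (\<Sum>j<J. f (Suc (2 * (n + j))))"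
proof (induction J)
  case (Suc J)
  have "{2 * n..<2 * n + 2 * Suc J} = insert (2 * (n + J)) (insert (Suc (2 * (n + J))) {2 * n..<2 * n + 2 * J})"
    by auto
  thus ?case using Suc by simp
qed simp

text \<open>Polarization writes \<open>Re (p cnj q)\<close> as \<open>\<bar>(p + q) / 2\<bar>\<^sup>2 - \<bar>(p - q) / 2\<bar>\<^sup>2\<close>; the term whose sign is
  unfavourable is dropped.\<close>

lemma polarization_bound:
  fixes p q :: complex and c s :: real
  assumes "0 \<le> s * c" "\<bar>s\<bar> = 1"
  shows "c * Re (p * cnj q) \<le> \<bar>c\<bar> * (cmod ((p + s * q) / 2))\<^sup>2"
proof -
  have s: "s = 1 \<or> s = -1" using assms(2) by auto
  have 1: "4 * (cmod ((p + s * q) / 2))\<^sup>2 = (cmod (p + s * q))\<^sup>2" for s :: real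
    by (simp add: norm_divide power_divide)
  have 2: "(cmod (p + s * q))\<^sup>2 = (cmod p)\<^sup>2 + (cmod q)\<^sup>2 + 2 * s * Re (p * cnj q)"
    unfolding cmod_power2 using s by (auto simp: power2_eq_square algebra_simps)
  have "2 * \<bar>Re (p * cnj q)\<bar> \<le> (cmod p)\<^sup>2 + (cmod q)\<^sup>2"
  proof -
    have "\<bar>Re (p * cnj q)\<bar> \<le> cmod p * cmod q"
      using abs_Re_le_cmod[of "p * cnj q"] by (simp add: norm_mult)
    moreover have "0 \<le> (cmod p - cmod q)\<^sup>2" by simp
    ultimately show ?thesis by (simp add: power2_eq_square algebra_simps)
  qed
  moreover have "s * Re (p * cnj q) \<le> \<bar>Re (p * cnj q)\<bar>" using s by auto
  ultimately have "s * Re (p * cnj q) \<le> (cmod ((p + s * q) / 2))\<^sup>2" using 1[of s] 2 by linarith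
  hence "\<bar>c\<bar> * (s * Re (p * cnj q)) \<le> \<bar>c\<bar> * (cmod ((p + s * q) / 2))\<^sup>2"
    by (rule mult_left_mono) simp
  moreover have "\<bar>c\<bar> * s = c" using s assms(1) by (auto simp: abs_if)
  ultimately show ?thesis by (simp add: mult.assoc[symmetric])
qed

lemma half_sum_squares_le:
  fixes \<alpha> \<beta> :: "nat \<Rightarrow> complex"
  assumes \<alpha>: "(\<Sum>k<m. (cmod (\<alpha> k))\<^sup>2) \<le> 1" and \<beta>: "(\<Sum>k<m. (cmod (\<beta> k))\<^sup>2) \<le> 1" and s: "\<bar>s\<bar> = (1::real)"
  shows "(\<Sum>k<m. (cmod ((\<alpha> k + s * \<beta> k) / 2))\<^sup>2) \<le> 1"
proof -
  have "(cmod ((\<alpha> k + s * \<beta> k) / 2))\<^sup>2 \<le> ((cmod (\<alpha> k))\<^sup>2 + (cmod (\<beta> k))\<^sup>2) / 2" for k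
  proof -
    have "cmod (\<alpha> k + s * \<beta> k) \<le> cmod (\<alpha> k) + cmod (\<beta> k)"
      using norm_triangle_ineq[of "\<alpha> k" "s * \<beta> k"] s by (simp add: norm_mult)
    hence "(cmod (\<alpha> k + s * \<beta> k))\<^sup>2 \<le> (cmod (\<alpha> k) + cmod (\<beta> k))\<^sup>2" by (intro power_mono) auto
    moreover have "0 \<le> (cmod (\<alpha> k) - cmod (\<beta> k))\<^sup>2" by simp
    ultimately show ?thesis by (simp add: norm_divide power_divide power2_eq_square algebra_simps)
  qed
  hence "(\<Sum>k<m. (cmod ((\<alpha> k + s * \<beta> k) / 2))\<^sup>2)
      \<le> (\<Sum>k<m. ((cmod (\<alpha> k))\<^sup>2 + (cmod (\<beta> k))\<^sup>2) / 2)" by (intro sum_mono)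
  also have "\<dots> = ((\<Sum>k<m. (cmod (\<alpha> k))\<^sup>2) + (\<Sum>k<m. (cmod (\<beta> k))\<^sup>2)) / 2"
    by (simp add: sum.distrib sum_divide_distrib[symmetric])
  finally show ?thesis using \<alpha> \<beta> by simp
qed

text \<open>The operator \<open>a x - x b\<close> for \<open>a = diag t h\<close> and \<open>b = - diag q g\<close>, where both diagonal sequences
  are non-negative at even and non-positive at odd positions. The sequence \<open>w = \<bar>t\<bar> + \<bar>q\<bar>\<close> is then
  the direct sum whose norm is the norm of the derivation.\<close>

locale signed_pair =
  t: compact_diagonal t h + q: compact_diagonal q g
  for t q :: "nat \<Rightarrow> real" and h g :: "nat \<Rightarrow> 'a::complex_hilbert" +
  assumes sign: "even n \<Longrightarrow> 0 \<le> t n \<and> 0 \<le> q n" "odd n \<Longrightarrow> t n \<le> 0 \<and> q n \<le> 0"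
    and decr: "\<bar>t (Suc (Suc n))\<bar> \<le> \<bar>t n\<bar>" "\<bar>q (Suc (Suc n))\<bar> \<le> \<bar>q n\<bar>"
    and compact: "compact_op (diag t h)" "compact_op (diag q g)"
begin

definition w :: "nat \<Rightarrow> real" where "w n = \<bar>t n\<bar> + \<bar>q n\<bar>"

definition parity_sign :: "nat \<Rightarrow> real" where "parity_sign n = (if even n then 1 else -1)"

definition deriv_op :: "('a \<Rightarrow>\<^sub>L 'a) \<Rightarrow> ('a \<Rightarrow>\<^sub>L 'a)" where
  "deriv_op x = (diag t h o\<^sub>L x) + (x o\<^sub>L diag q g)"

lemma w_nonneg: "0 \<le> w n" by (simp add: w_def)

lemma vanishing_w: "vanishing w"
proof -
  have "(\<lambda>n. \<bar>t n\<bar> + \<bar>q n\<bar>) \<longlonglongrightarrow> 0 + 0"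
    using t.c q.c unfolding vanishing_iff_tendsto by (intro tendsto_add) auto
  thus ?thesis unfolding vanishing_iff_tendsto w_def by simp
qed

lemma w_decr: "w (n + 2 * k) \<le> w n"
proof (induction k)
  case (Suc k)
  have "w (Suc (Suc (n + 2 * k))) \<le> w (n + 2 * k)" using decr[of "n + 2 * k"] by (simp add: w_def)
  thus ?case using Suc by simp
qed simp

lemma bounded_op_deriv: "x \<in> bounded_ops \<Longrightarrow> deriv_op x \<in> bounded_ops"
  unfolding deriv_op_def by (intro bounded_ops_intros t.diag_bounded_op q.diag_bounded_op)

lemma compact_op_add: "compact_op S \<Longrightarrow> compact_op T \<Longrightarrow> compact_op (S + T)"
  for S T :: "'a \<Rightarrow>\<^sub>L 'a"
  using compact_op_diff[of S "(-1) *\<^sub>R T"] compact_op_scaleR[of T "-1"] by simp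

lemma compact_op_deriv: "compact_op (deriv_op x)"
  unfolding deriv_op_def
  by (rule compact_op_add[OF compact_op_compose_right[OF compact(1)] compact_op_compose_left[OF compact(2)]])

text \<open>Below each position \<open>i \<ge> 2 n\<close> there are \<open>n\<close> positions \<open>< 2 n\<close> of the same parity, all with
  larger values of \<open>w\<close>.\<close>

lemma card_tail_le:
  assumes "finite G" "G \<noteq> {}" "G \<subseteq> {2 * n..}" "\<And>i. i \<in> G \<Longrightarrow> u < w i" "0 < u"
  shows "n + card G \<le> card {i. u < w i}"
proof -
  obtain i where i: "i \<in> G" using assms(2) by blast
  let ?H = "(\<lambda>l. i mod 2 + 2 * l) ` {..<n}"
  have H: "j < 2 * n" "u < w j" if jH: "j \<in> ?H" for j
  proof -
    obtain l where l: "l < n" "j = i mod 2 + 2 * l" using jH by auto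
    show jn: "j < 2 * n" using l by linarith
    have "2 * n \<le> i" using i assms(3) by auto
    have "i = j + 2 * (i div 2 - l)"
      using l \<open>2 * n \<le> i\<close> by (simp add: right_diff_distrib' minus_mod_eq_mult_div[symmetric])
    hence "w i \<le> w j" using w_decr[of j "i div 2 - l"] by simp
    thus "u < w j" using assms(4)[OF i] by linarith
  qed
  have "card ?H = n" by (subst card_image) (auto simp: inj_on_def)
  moreover have "?H \<inter> G = {}" using H(1) assms(3) by fastforce
  ultimately have "card (?H \<union> G) = n + card G" using assms(1) by (simp add: card_Un_disjoint)
  moreover have "?H \<union> G \<subseteq> {i. u < w i}" using H(2) assms(4) by blast
  moreover have "finite {i. u < w i}" using vanishing_w assms(5) by (simp add: vanishing_def)
  ultimately show ?thesis by (metis card_mono)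
qed

lemma sum_tail_le:
  assumes "finite G" "G \<subseteq> {2 * n..}"
  shows "(\<Sum>i\<in>G. w i) \<le> (\<Sum>k<card G. rearr w (n + k))"
  using assms
proof (induction "card G" arbitrary: G)
  case 0
  thus ?case by simp
next
  case (Suc m)
  have ne: "G \<noteq> {}" using Suc.hyps(2) by auto
  have "Min (w ` G) \<in> w ` G" using Suc.prems(1) ne by (intro Min_in) auto
  then obtain i where i: "i \<in> G" "w i = Min (w ` G)" by auto
  have min: "w i \<le> w j" if "j \<in> G" for j using i(2) that Suc.prems(1) by simp
  have "w i \<le> rearr w (n + m)"
  proof (cases "w i = 0")
    case True
    thus ?thesis using rearr_nonneg[OF vanishing_w] by simp
  next
    case False
    hence "0 < w i" using w_nonneg[of i] by simp
    thus ?thesis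
    proof (rule dense_le_bounded)
      fix u assume u: "0 < u" "u < w i"
      have "n + card G \<le> card {i. u < w i}"
        by (rule card_tail_le[OF Suc.prems(1) ne Suc.prems(2) _ u(1)]) (use u(2) min in force)
      hence "n + m < card {i. u < w i}" using Suc.hyps(2) by simp
      thus "u \<le> rearr w (n + m)" using rearr_gt_iff[OF vanishing_w u(1), of "n + m"] by simp
    qed
  qed
  moreover have c: "m = card (G - {i})" using Suc.hyps(2) i(1) Suc.prems(1) by simp
  have "(\<Sum>j\<in>G - {i}. w j) \<le> (\<Sum>k<card (G - {i}). rearr w (n + k))"
    by (rule Suc.hyps(1)[OF c]) (use Suc.prems in auto)
  ultimately show ?case
    using sum.remove[OF Suc.prems(1) i(1), of w] c by (simp add: Suc.hyps(2)[symmetric])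
qed

text \<open>At most \<open>m\<close> of the values at positions \<open>\<ge> 2 n\<close> exceed the level \<open>u\<close> of the rearrangement at \<open>n + m\<close>;
  the mass on the others contributes at most \<open>u\<close> per unit.\<close>

lemma weighted_tail_le:
  assumes F: "finite F" "F \<subseteq> {2 * n..}" and \<theta>: "\<And>i. 0 \<le> \<theta> i \<and> \<theta> i \<le> 1" "(\<Sum>i\<in>F. \<theta> i) \<le> real m"
  shows "(\<Sum>i\<in>F. w i * \<theta> i) \<le> (\<Sum>k<m. rearr w (n + k))"
proof -
  define u where "u = rearr w (n + m)"
  have u0: "0 \<le> u" unfolding u_def by (rule rearr_nonneg[OF vanishing_w])
  define G where "G = {i \<in> F. u < w i}"
  have G: "finite G" "G \<subseteq> {2 * n..}" using F by (auto simp: G_def)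
  have cG: "card G \<le> m"
  proof (cases "G = {}")
    case False
    have "Min (w ` G) \<in> w ` G" using G(1) False by (intro Min_in) auto
    then obtain i where i: "i \<in> G" "w i = Min (w ` G)" by auto
    have min: "w i \<le> w j" if "j \<in> G" for j using i(2) that G(1) by simp
    have "u < w i" using i(1) by (simp add: G_def)
    then obtain v where v: "u < v" "v < w i" using dense by blast
    have "n + card G \<le> card {i. v < w i}"
      by (rule card_tail_le[OF G(1) False G(2)]) (use v u0 min in force)+
    moreover have "\<not> v < rearr w (n + m)" using v(1) by (simp add: u_def)
    hence "card {i. v < w i} \<le> n + m" using rearr_gt_iff[OF vanishing_w, of v "n + m"] v(1) u0 by simp
    ultimately show ?thesis by simp
  qed simp
  have "(\<Sum>i\<in>F. w i * \<theta> i) \<le> (\<Sum>i\<in>F. u * \<theta> i + (if i \<in> G then w i - u else 0))"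
  proof (rule sum_mono)
    fix i assume "i \<in> F"
    show "w i * \<theta> i \<le> u * \<theta> i + (if i \<in> G then w i - u else 0)"
    proof (cases "i \<in> G")
      case True
      have "(w i - u) * \<theta> i \<le> (w i - u) * 1"
        using True \<theta>(1)[of i] by (intro mult_left_mono) (auto simp: G_def)
      thus ?thesis using True by (simp add: algebra_simps)
    next
      case False
      hence "w i \<le> u" using \<open>i \<in> F\<close> by (simp add: G_def)
      thus ?thesis using False \<theta>(1)[of i] by (simp add: mult_right_mono)
    qed
  qed
  also have "\<dots> = u * (\<Sum>i\<in>F. \<theta> i) + (\<Sum>i\<in>G. w i - u)"
  proof -
    have "(\<Sum>i\<in>F. if i \<in> G then w i - u else 0) = (\<Sum>i\<in>G. w i - u)"
      using F(1) by (intro sum.mono_neutral_cong_right) (auto simp: G_def)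
    thus ?thesis by (simp add: sum.distrib sum_distrib_left)
  qed
  also have "\<dots> \<le> u * real m + (\<Sum>k<m. rearr w (n + k) - u)"
  proof (rule add_mono)
    show "u * (\<Sum>i\<in>F. \<theta> i) \<le> u * real m" by (rule mult_left_mono[OF \<theta>(2) u0])
    have "(\<Sum>i\<in>G. w i - u) = (\<Sum>i\<in>G. w i) - real (card G) * u" by (simp add: sum_subtractf)
    also have "\<dots> \<le> (\<Sum>k<card G. rearr w (n + k)) - real (card G) * u" using sum_tail_le[OF G] by simp
    also have "\<dots> = (\<Sum>k<card G. rearr w (n + k) - u)" by (simp add: sum_subtractf)
    also have "\<dots> \<le> (\<Sum>k<m. rearr w (n + k) - u)"
      using cG rearr_decseq[OF vanishing_w] by (intro sum_mono2) (auto simp: u_def decseq_def)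
    finally show "(\<Sum>i\<in>G. w i - u) \<le> (\<Sum>k<m. rearr w (n + k) - u)" .
  qed
  also have "\<dots> = (\<Sum>k<m. rearr w (n + k))" by (simp add: sum_subtractf)
  finally show ?thesis .
qed

text \<open>After polarization, \<open>Re \<langle>(a x - x b) v\<^sub>k, u\<^sub>k\<rangle>\<close> is bounded by a sum of
  the numbers \<open>\<bar>t i\<bar>\<close> and \<open>\<bar>q i\<bar>\<close> with weights whose column sums are at most one. The total weights
  of row \<open>k\<close> at even positions are at most \<open>\<parallel>(x v\<^sub>k + u\<^sub>k) / 2\<parallel>\<^sup>2\<close> and \<open>\<parallel>(v\<^sub>k + x\<^sup>* u\<^sub>k) / 2\<parallel>\<^sup>2\<close>, and
  with minus signs at odd positions. In both cases the difference between the even and the odd mass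
  is \<open>Re \<langle>x v\<^sub>k, u\<^sub>k\<rangle>\<close>; hence the larger even mass and the larger odd mass belong to the same side,
  and they still add up to at most one.\<close>

lemma ky_fan_estimate:
  fixes x :: "'a \<Rightarrow>\<^sub>L 'a" and u v :: "nat \<Rightarrow> 'a"
  assumes x: "x \<in> bounded_ops" "norm x \<le> 1" and uv: "partial_orthonormal u" "partial_orthonormal v"
  shows "(\<Sum>k<m. \<Sum>i=2 * n..<2 * n + 2 * J.
      t i * Re (cinner (blinfun_apply x (v k)) (h i) * cinner (h i) (u k)) +
      q i * Re (cinner (v k) (g i) * cinner (g i) (blinfun_apply (cadjoint x) (u k))))
    \<le> (\<Sum>k<m. rearr w (n + k))"
proof -
  let ?x = "blinfun_apply x" and ?y = "blinfun_apply (cadjoint x)"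
  let ?F = "{2 * n..<2 * n + 2 * J}"
  define A where "A i = (\<Sum>k<m. (cmod ((cinner (?x (v k)) (h i) + parity_sign i * cinner (u k) (h i)) / 2))\<^sup>2)" for i
  define B where "B i = (\<Sum>k<m. (cmod ((cinner (v k) (g i) + parity_sign i * cinner (?y (u k)) (g i)) / 2))\<^sup>2)" for i
  have nx: "norm (?x z) \<le> norm z" for z by (rule norm_contraction[OF x(2)])
  have ny: "norm (?y z) \<le> norm z" for z
    using norm_cadjoint_le[OF x(1), of z] mult_right_mono[OF x(2), of "norm z"] by simp
  have s1: "\<bar>parity_sign i\<bar> = 1" for i by (simp add: parity_sign_def)
  have sq1: "(norm z)\<^sup>2 \<le> 1" if "norm z \<le> 1" for z :: 'a
    using power_mono[OF that, of 2] by simp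
  have nh: "norm (h i) \<le> 1" and ng: "norm (g i) \<le> 1" for i
    by (rule partial_orthonormal_norm t.h q.h)+
  have nu: "norm (u k) \<le> 1" and nv: "norm (v k) \<le> 1" for k
    by (rule partial_orthonormal_norm uv)+
  have A1: "0 \<le> A i \<and> A i \<le> 1" for i
  proof
    show "A i \<le> 1" unfolding A_def
    proof (rule half_sum_squares_le[OF _ _ s1])
      have "cinner (?x (v k)) (h i) = cinner (v k) (?y (h i))" for k
        by (simp add: cinner_cadjoint'[OF x(1)])
      moreover have "norm (?y (h i)) \<le> 1" using ny[of "h i"] nh[of i] by linarith
      ultimately show "(\<Sum>k<m. (cmod (cinner (?x (v k)) (h i)))\<^sup>2) \<le> 1"
        using bessel_left[OF uv(2) finite_lessThan, of "?y (h i)" m] sq1[of "?y (h i)"] by simp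
      show "(\<Sum>k<m. (cmod (cinner (u k) (h i)))\<^sup>2) \<le> 1"
        using bessel_left[OF uv(1) finite_lessThan, of "h i" m] sq1[OF nh[of i]] by linarith
    qed
  qed (simp add: A_def sum_nonneg)
  have B1: "0 \<le> B i \<and> B i \<le> 1" for i
  proof
    show "B i \<le> 1" unfolding B_def
    proof (rule half_sum_squares_le[OF _ _ s1])
      have "norm (?x (g i)) \<le> 1" using nx[of "g i"] ng[of i] by linarith
      thus "(\<Sum>k<m. (cmod (cinner (?y (u k)) (g i)))\<^sup>2) \<le> 1"
        using bessel_left[OF uv(1) finite_lessThan, of "?x (g i)" m] sq1[of "?x (g i)"]
        by (simp add: cinner_cadjoint[OF x(1)])
      show "(\<Sum>k<m. (cmod (cinner (v k) (g i)))\<^sup>2) \<le> 1"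
        using bessel_left[OF uv(2) finite_lessThan, of "g i" m] sq1[OF ng[of i]] by linarith
    qed
  qed (simp add: B_def sum_nonneg)
  define half where "half s z z' = (1 / 2) *\<^sub>R (z + s *\<^sub>R z')" for s :: real and z z' :: 'a
  have half_cinner: "(cinner z e + s * cinner z' e) / 2 = cinner (half s z z') e" for s z z' and e :: 'a
    by (simp add: half_def cinner_scaleR_left cinner_add_left scaleR_conv_of_real)
  have half_norm: "(norm (half s z z'))\<^sup>2 = ((norm z)\<^sup>2 + (norm z')\<^sup>2 + 2 * s * Re (cinner z z')) / 4"
    if "\<bar>s\<bar> = 1" for s z z'
  proof -
    have "s = 1 \<or> s = -1" using that by auto
    thus ?thesis
      by (elim disjE) (simp_all add: half_def power_mult_distrib power_divide norm_add_square norm_diff_square)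
  qed
  define P where "P s = (\<Sum>k<m. max ((norm (half s (?x (v k)) (u k)))\<^sup>2) ((norm (half s (v k) (?y (u k))))\<^sup>2))" for s
  have PP: "P 1 + P (-1) \<le> m"
  proof -
    have "max ((norm (half 1 (?x (v k)) (u k)))\<^sup>2) ((norm (half 1 (v k) (?y (u k))))\<^sup>2) +
        max ((norm (half (-1) (?x (v k)) (u k)))\<^sup>2) ((norm (half (-1) (v k) (?y (u k))))\<^sup>2) \<le> 1" for k
    proof -
      have "cinner (v k) (?y (u k)) = cinner (?x (v k)) (u k)" by (rule cinner_cadjoint'[OF x(1)])
      moreover have "(norm (?x (v k)))\<^sup>2 \<le> 1" "(norm (u k))\<^sup>2 \<le> 1" "(norm (v k))\<^sup>2 \<le> 1" "(norm (?y (u k)))\<^sup>2 \<le> 1"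
        using sq1 nx[of "v k"] ny[of "u k"] nu[of k] nv[of k] by (auto intro: order_trans)
      moreover have "max ((\<alpha> + \<beta> + 2 * \<rho>) / 4) ((\<gamma> + \<delta> + 2 * \<rho>) / 4)
          + max ((\<alpha> + \<beta> - 2 * \<rho>) / 4) ((\<gamma> + \<delta> - 2 * \<rho>) / 4) \<le> 1"
        if "\<alpha> \<le> 1" "\<beta> \<le> 1" "\<gamma> \<le> 1" "\<delta> \<le> 1" for \<alpha> \<beta> \<gamma> \<delta> \<rho> :: real
        using that unfolding max_def by (auto simp: divide_simps)
      ultimately show ?thesis by (simp add: half_norm)
    qed
    hence "(\<Sum>k<m. max ((norm (half 1 (?x (v k)) (u k)))\<^sup>2) ((norm (half 1 (v k) (?y (u k))))\<^sup>2) +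
        max ((norm (half (-1) (?x (v k)) (u k)))\<^sup>2) ((norm (half (-1) (v k) (?y (u k))))\<^sup>2)) \<le> (\<Sum>k<m. 1)"
      by (intro sum_mono)
    thus ?thesis by (simp add: P_def sum.distrib)
  qed
  have P0: "0 \<le> P s" for s unfolding P_def by (intro sum_nonneg) (simp add: le_max_iff_disj)
  have AP: "(\<Sum>j<J. A (r + 2 * j)) \<le> P (parity_sign r)" and BP: "(\<Sum>j<J. B (r + 2 * j)) \<le> P (parity_sign r)" for r
  proof -
    have sg: "parity_sign (r + 2 * j) = parity_sign r" for j by (simp add: parity_sign_def)
    have po: "partial_orthonormal (\<lambda>j. e (r + 2 * j))" if "partial_orthonormal e" for e :: "nat \<Rightarrow> 'a"
      using that by (simp add: partial_orthonormal_def)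
    have "(\<Sum>j<J. A (r + 2 * j)) = (\<Sum>k<m. \<Sum>j<J. (cmod (cinner (half (parity_sign r) (?x (v k)) (u k)) (h (r + 2 * j))))\<^sup>2)"
      unfolding A_def half_cinner sg by (rule sum.swap)
    also have "\<dots> \<le> (\<Sum>k<m. (norm (half (parity_sign r) (?x (v k)) (u k)))\<^sup>2)"
      by (intro sum_mono bessel po t.h finite_lessThan)
    also have "\<dots> \<le> P (parity_sign r)" unfolding P_def by (intro sum_mono) simp
    finally show "(\<Sum>j<J. A (r + 2 * j)) \<le> P (parity_sign r)" .
    have "(\<Sum>j<J. B (r + 2 * j)) = (\<Sum>k<m. \<Sum>j<J. (cmod (cinner (half (parity_sign r) (v k) (?y (u k))) (g (r + 2 * j))))\<^sup>2)"
      unfolding B_def half_cinner sg by (rule sum.swap)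
    also have "\<dots> \<le> (\<Sum>k<m. (norm (half (parity_sign r) (v k) (?y (u k))))\<^sup>2)"
      by (intro sum_mono bessel po q.h finite_lessThan)
    also have "\<dots> \<le> P (parity_sign r)" unfolding P_def by (intro sum_mono) simp
    finally show "(\<Sum>j<J. B (r + 2 * j)) \<le> P (parity_sign r)" .
  qed
  define \<theta> where "\<theta> i = max 0 (min 1 (P (parity_sign i) - real (i div 2 - n)))" for i
  have parity: "(\<Sum>j<J. \<bar>t (r + 2 * j)\<bar> * A (r + 2 * j)) + (\<Sum>j<J. \<bar>q (r + 2 * j)\<bar> * B (r + 2 * j))
      \<le> (\<Sum>j<J. w (r + 2 * j) * \<theta> (r + 2 * j))"
    if r: "r = 2 * n \<or> r = Suc (2 * n)" for r
  proof -
    have th: "\<theta> (r + 2 * j) = max 0 (min 1 (P (parity_sign r) - real j))" for j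
      using r by (auto simp: \<theta>_def parity_sign_def)
    have "(\<Sum>j<J. \<bar>t (r + 2 * j)\<bar> * A (r + 2 * j)) \<le> (\<Sum>j<J. \<bar>t (r + 2 * j)\<bar> * \<theta> (r + 2 * j))"
      unfolding th
      by (rule decreasing_weighted_sum_le) (use decr(1)[of "r + 2 * _"] A1 AP in auto)
    moreover have "(\<Sum>j<J. \<bar>q (r + 2 * j)\<bar> * B (r + 2 * j)) \<le> (\<Sum>j<J. \<bar>q (r + 2 * j)\<bar> * \<theta> (r + 2 * j))"
      unfolding th
      by (rule decreasing_weighted_sum_le) (use decr(2)[of "r + 2 * _"] B1 BP in auto)
    ultimately show ?thesis by (simp add: w_def distrib_right sum.distrib)
  qed
  have eo: "(\<Sum>i\<in>?F. f i) = (\<Sum>j<J. f (2 * n + 2 * j)) + (\<Sum>j<J. f (Suc (2 * n) + 2 * j))" for f :: "nat \<Rightarrow> real"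
    using sum_even_odd[of f n J] by (simp add: algebra_simps)
  have "(\<Sum>k<m. \<Sum>i\<in>?F. t i * Re (cinner (?x (v k)) (h i) * cinner (h i) (u k)) +
      q i * Re (cinner (v k) (g i) * cinner (g i) (?y (u k))))
    \<le> (\<Sum>k<m. \<Sum>i\<in>?F.
        \<bar>t i\<bar> * (cmod ((cinner (?x (v k)) (h i) + parity_sign i * cinner (u k) (h i)) / 2))\<^sup>2 +
        \<bar>q i\<bar> * (cmod ((cinner (v k) (g i) + parity_sign i * cinner (?y (u k)) (g i)) / 2))\<^sup>2)"
  proof (intro sum_mono add_mono)
    fix k i
    show "t i * Re (cinner (?x (v k)) (h i) * cinner (h i) (u k))
        \<le> \<bar>t i\<bar> * (cmod ((cinner (?x (v k)) (h i) + parity_sign i * cinner (u k) (h i)) / 2))\<^sup>2"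
      using polarization_bound[of "parity_sign i" "t i" "cinner (?x (v k)) (h i)" "cinner (u k) (h i)"] sign[of i] s1[of i]
      by (subst cinner_commute[of "h i"]) (auto simp: parity_sign_def)
    show "q i * Re (cinner (v k) (g i) * cinner (g i) (?y (u k)))
        \<le> \<bar>q i\<bar> * (cmod ((cinner (v k) (g i) + parity_sign i * cinner (?y (u k)) (g i)) / 2))\<^sup>2"
      using polarization_bound[of "parity_sign i" "q i" "cinner (v k) (g i)" "cinner (?y (u k)) (g i)"] sign[of i] s1[of i]
      by (subst cinner_commute[of "g i"]) (auto simp: parity_sign_def)
  qed
  also have "\<dots> = (\<Sum>i\<in>?F. \<bar>t i\<bar> * A i + \<bar>q i\<bar> * B i)"
    by (subst sum.swap) (simp add: A_def B_def sum_distrib_left sum.distrib)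
  also have "\<dots> \<le> (\<Sum>i\<in>?F. w i * \<theta> i)"
    unfolding eo using parity[of "2 * n"] parity[of "Suc (2 * n)"] by (simp add: sum.distrib)
  also have "\<dots> \<le> (\<Sum>k<m. rearr w (n + k))"
  proof (rule weighted_tail_le)
    have "(\<Sum>i\<in>?F. \<theta> i) = (\<Sum>j<J. max 0 (min 1 (P 1 - real j))) + (\<Sum>j<J. max 0 (min 1 (P (-1) - real j)))"
      unfolding eo by (simp add: \<theta>_def parity_sign_def)
    also have "\<dots> \<le> P 1 + P (-1)" by (simp add: sum_unit_ramp P0 add_mono)
    also have "\<dots> \<le> real m" by (rule PP)
    finally show "(\<Sum>i\<in>?F. \<theta> i) \<le> real m" .
  qed (auto simp: \<theta>_def)
  finally show ?thesis .
qed

end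

context singular_system
begin

text \<open>The left singular vectors; where the singular value is zero, division by zero makes them vanish.\<close>

definition left :: "nat \<Rightarrow> 'a" where
  "left k = (1 / singular_values T k) *\<^sub>R blinfun_apply T (h k)"

lemma cinner_images:
  "cinner (blinfun_apply T (h i)) (blinfun_apply T (h j))
    = (if i = j then complex_of_real ((singular_values T i)\<^sup>2) else 0)"
  unfolding cinner_apply sq.diag_apply_basis
  using supp[of i] by (auto simp: cinner_scaleR_left partial_orthonormal_cinner[OF h] scaleR_conv_of_real)

lemma left_orthonormal: "partial_orthonormal left"
  unfolding partial_orthonormal_def
proof (intro conjI allI impI)
  show "cinner (left i) (left j) = 0" if "i \<noteq> j" for i j
    using that by (simp add: left_def cinner_scaleR_left cinner_scaleR_right cinner_images)
  show "left i = 0 \<or> norm (left i) = 1" for i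
  proof (cases "singular_values T i = 0")
    case False
    have "complex_of_real ((norm (blinfun_apply T (h i)))\<^sup>2) = complex_of_real ((singular_values T i)\<^sup>2)"
      unfolding cinner_self[symmetric] by (simp add: cinner_images)
    hence "(norm (blinfun_apply T (h i)))\<^sup>2 = (singular_values T i)\<^sup>2" by (simp only: of_real_eq_iff)
    hence "norm (blinfun_apply T (h i)) = singular_values T i" using nonneg by simp
    thus ?thesis using False nonneg[of i] by (simp add: left_def)
  qed (simp add: left_def)
qed

lemma cinner_left: "cinner (blinfun_apply T (h k)) (left k) = complex_of_real (singular_values T k)"
  by (cases "singular_values T k = 0")
    (simp_all add: left_def cinner_scaleR_right cinner_images scaleR_conv_of_real power2_eq_square)

end

context signed_pair
begin

text \<open>The operator that remains when the \<open>n\<close> largest eigenvalues of each sign are removed.\<close>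

definition tail_op :: "nat \<Rightarrow> ('a \<Rightarrow>\<^sub>L 'a) \<Rightarrow> ('a \<Rightarrow>\<^sub>L 'a)" where
  "tail_op n x = (diag (truncated {2 * n..} t) h o\<^sub>L x) + (x o\<^sub>L diag (truncated {2 * n..} q) g)"

lemma bounded_tail_op: "x \<in> bounded_ops \<Longrightarrow> tail_op n x \<in> bounded_ops"
  unfolding tail_op_def
  by (intro bounded_ops_intros compact_diagonal.diag_bounded_op t.restrict_diagonal q.restrict_diagonal)

lemma compact_tail_op: "compact_op (tail_op n x)"
  unfolding tail_op_def
  by (rule compact_op_add[OF compact_op_compose_right[OF t.compact_restrict[OF compact(1)]]
        compact_op_compose_left[OF q.compact_restrict[OF compact(2)]]])

text \<open>The truncated operator agrees with the original one on the vectors orthogonal to \<open>x\<^sup>* (h i)\<close> and to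
  \<open>g i\<close> for \<open>i < 2 n\<close>.\<close>

lemma singular_values_tail_op:
  assumes x: "x \<in> bounded_ops"
  shows "singular_values (deriv_op x) (4 * n + k) \<le> singular_values (tail_op n x) k"
proof -
  define z where "z i = (if i < 2 * n then blinfun_apply (cadjoint x) (h i) else g (i - 2 * n))" for i
  show ?thesis
  proof (rule singular_values_shift[OF bounded_op_deriv[OF x] compact_op_deriv bounded_tail_op[OF x] compact_tail_op])
    fix y assume y: "\<And>i. i < 4 * n \<Longrightarrow> cinner y (z i) = 0"
    have h: "cinner (blinfun_apply x y) (h i) = 0" if "i < 2 * n" for i
      using y[of i] that by (simp add: z_def cinner_cadjoint'[OF x])
    have g: "cinner y (g i) = 0" if "i < 2 * n" for i
      using y[of "2 * n + i"] that by (simp add: z_def)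
    have "blinfun_apply (diag (truncated (- {2 * n..}) t) h) (blinfun_apply x y) = 0"
      by (rule compact_diagonal.diag_apply_orthogonal[OF t.restrict_diagonal])
        (use h in \<open>auto simp: truncated_def split: if_splits\<close>)
    hence 1: "blinfun_apply (diag t h) (blinfun_apply x y)
        = blinfun_apply (diag (truncated {2 * n..} t) h) (blinfun_apply x y)"
      by (subst t.diag_split[of "{2 * n..}"]) (simp add: plus_blinfun.rep_eq)
    have "blinfun_apply (diag (truncated (- {2 * n..}) q) g) y = 0"
      by (rule compact_diagonal.diag_apply_orthogonal[OF q.restrict_diagonal])
        (use g in \<open>auto simp: truncated_def split: if_splits\<close>)
    hence 2: "blinfun_apply (diag q g) y = blinfun_apply (diag (truncated {2 * n..} q) g) y"
      by (subst q.diag_split[of "{2 * n..}"]) (simp add: plus_blinfun.rep_eq)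
    show "blinfun_apply (deriv_op x) y = blinfun_apply (tail_op n x) y"
      by (simp add: deriv_op_def tail_op_def plus_blinfun.rep_eq 1 2)
  qed
qed

text \<open>The singular values are the numbers \<open>\<langle>T v\<^sub>k, u\<^sub>k\<rangle>\<close> for the singular vectors. Replacing the two diagonal
  operators by finite sections costs \<open>\<epsilon>\<close> each, and to the sections the Ky Fan type estimate applies.\<close>

lemma sum_singular_values_tail_op:
  assumes x: "x \<in> bounded_ops" "norm x \<le> 1"
  shows "(\<Sum>k<m. singular_values (tail_op n x) k) \<le> (\<Sum>k<m. rearr w (n + k))"
proof (rule field_le_epsilon)
  fix e :: real assume "0 < e"
  define \<epsilon> where "\<epsilon> = e / (2 * (real m + 1))"
  have \<epsilon>: "0 < \<epsilon>" using \<open>0 < e\<close> by (simp add: \<epsilon>_def)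
  have me: "real m * (2 * \<epsilon>) \<le> e"
    using \<open>0 < e\<close> by (simp add: \<epsilon>_def field_simps)
  let ?t = "truncated {2 * n..} t" and ?q = "truncated {2 * n..} q"
  interpret tr: compact_diagonal ?t h by (rule t.restrict_diagonal)
  interpret qr: compact_diagonal ?q g by (rule q.restrict_diagonal)
  obtain u where "singular_system (tail_op n x) u"
    using singular_system_exists[OF bounded_tail_op[OF x(1)] compact_tail_op] .
  then interpret S: singular_system "tail_op n x" u .
  have "w \<longlonglongrightarrow> 0" using vanishing_w by (simp add: vanishing_iff_tendsto)
  from order_tendstoD(2)[OF this \<epsilon>] obtain J where J: "\<And>i. J \<le> i \<Longrightarrow> w i < \<epsilon>"
    unfolding eventually_sequentially by blast
  let ?F = "{2 * n..<2 * n + 2 * J}"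
  have small: "\<bar>?t i\<bar> \<le> \<epsilon>" "\<bar>?q i\<bar> \<le> \<epsilon>" if "i \<notin> ?F" for i
    using that J[of i] \<epsilon> by (auto simp: truncated_def w_def)
  have nu: "norm (u k) \<le> 1" and nl: "norm (S.left k) \<le> 1" for k
    by (rule partial_orthonormal_norm S.h S.left_orthonormal)+
  have nx: "norm (blinfun_apply x (u k)) \<le> 1" for k
    using norm_contraction[OF x(2), of "u k"] nu[of k] by linarith
  have ny: "norm (blinfun_apply (cadjoint x) (S.left k)) \<le> 1" for k
    using norm_cadjoint_le[OF x(1), of "S.left k"] mult_right_mono[OF x(2), of "norm (S.left k)"] nl[of k] by simp
  let ?X = "\<lambda>k. blinfun_apply x (u k)" and ?Y = "\<lambda>k. blinfun_apply (cadjoint x) (S.left k)"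
  have sk: "singular_values (tail_op n x) k \<le> (\<Sum>i\<in>?F.
      t i * Re (cinner (?X k) (h i) * cinner (h i) (S.left k)) +
      q i * Re (cinner (u k) (g i) * cinner (g i) (?Y k))) + 2 * \<epsilon>" for k
  proof -
    let ?A = "cinner (blinfun_apply (diag ?t h) (?X k)) (S.left k)"
    let ?B = "cinner (blinfun_apply (diag ?q g) (u k)) (?Y k)"
    let ?A' = "\<Sum>i\<in>?F. ?t i * cinner (?X k) (h i) * cinner (h i) (S.left k)"
    let ?B' = "\<Sum>i\<in>?F. ?q i * cinner (u k) (g i) * cinner (g i) (?Y k)"
    have "complex_of_real (singular_values (tail_op n x) k) = ?A + ?B"
      unfolding S.cinner_left[symmetric]
      by (simp add: tail_op_def plus_blinfun.rep_eq cinner_add_left cinner_cadjoint'[OF x(1)])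
    hence s: "singular_values (tail_op n x) k = Re ?A + Re ?B"
      by (metis Re_complex_of_real plus_complex.sel(1))
    have "cmod (?A - ?A') \<le> \<epsilon> * norm (?X k) * norm (S.left k)"
      by (rule tr.cinner_diag_approx) (use small \<epsilon> in auto)
    also have "\<dots> \<le> \<epsilon> * 1 * 1" using nx nl \<epsilon> by (intro mult_mono) auto
    finally have A: "Re ?A \<le> Re ?A' + \<epsilon>"
      using complex_Re_le_cmod[of "?A - ?A'"] by simp
    have "cmod (?B - ?B') \<le> \<epsilon> * norm (u k) * norm (?Y k)"
      by (rule qr.cinner_diag_approx) (use small \<epsilon> in auto)
    also have "\<dots> \<le> \<epsilon> * 1 * 1" using nu ny \<epsilon> by (intro mult_mono) auto
    finally have B: "Re ?B \<le> Re ?B' + \<epsilon>"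
      using complex_Re_le_cmod[of "?B - ?B'"] by simp
    have "Re ?A' + Re ?B' = (\<Sum>i\<in>?F.
      t i * Re (cinner (?X k) (h i) * cinner (h i) (S.left k)) +
      q i * Re (cinner (u k) (g i) * cinner (g i) (?Y k)))"
      unfolding Re_sum sum.distrib
      by (intro arg_cong2[of _ _ _ _ "(+)"] sum.cong) (auto simp: truncated_def mult.assoc)
    thus ?thesis using s A B by linarith
  qed
  have "(\<Sum>k<m. singular_values (tail_op n x) k) \<le> (\<Sum>k<m. (\<Sum>i\<in>?F.
      t i * Re (cinner (?X k) (h i) * cinner (h i) (S.left k)) +
      q i * Re (cinner (u k) (g i) * cinner (g i) (?Y k))) + 2 * \<epsilon>)"
    by (intro sum_mono sk)
  also have "\<dots> = (\<Sum>k<m. \<Sum>i\<in>?F.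
      t i * Re (cinner (?X k) (h i) * cinner (h i) (S.left k)) +
      q i * Re (cinner (u k) (g i) * cinner (g i) (?Y k))) + real m * (2 * \<epsilon>)"
    by (subst sum.distrib) simp
  also have "\<dots> \<le> (\<Sum>k<m. rearr w (n + k)) + e"
    by (rule add_mono[OF ky_fan_estimate[OF x S.left_orthonormal S.h] me])
  finally show "(\<Sum>k<m. singular_values (tail_op n x) k) \<le> (\<Sum>k<m. rearr w (n + k)) + e" .
qed

text \<open>Removing the \<open>n\<close> largest eigenvalues of each sign from both diagonal operators is a perturbation of
  rank at most \<open>4 n\<close>; this is where the shift by \<open>4 n\<close> comes from.\<close>

lemma deriv_op_majorization:
  assumes x: "x \<in> bounded_ops" "norm x \<le> 1"
  shows "(\<Sum>k<m. singular_values (deriv_op x) (4 * n + k)) \<le> (\<Sum>k<m. rearr w (n + k))"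
proof -
  have "(\<Sum>k<m. singular_values (deriv_op x) (4 * n + k)) \<le> (\<Sum>k<m. singular_values (tail_op n x) k)"
    by (intro sum_mono singular_values_tail_op x)
  thus ?thesis using sum_singular_values_tail_op[OF x] by (rule order_trans)
qed

end

section \<open>The lower bound\<close>

text \<open>On the span of finitely many \<open>f i\<close> the operator is bounded below by the smallest \<open>\<bar>c i\<bar>\<close> involved,
  and the minimax principle turns the dimension of the span into a number of singular values.\<close>

lemma card_singular_values_ge:
  fixes T :: "'a::complex_hilbert \<Rightarrow>\<^sub>L 'a" and f e :: "nat \<Rightarrow> 'a" and c :: "nat \<Rightarrow> real"
  assumes T: "T \<in> bounded_ops" "compact_op T" and f: "partial_orthonormal f" and e: "partial_orthonormal e"
    and map: "\<And>i. i \<in> I \<Longrightarrow> blinfun_apply T (f i) = c i *\<^sub>R e i \<and> f i \<noteq> 0 \<and> e i \<noteq> 0"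
    and s: "0 < s"
  shows "finite {i \<in> I. s < \<bar>c i\<bar>}" and "card {i \<in> I. s < \<bar>c i\<bar>} \<le> card {k. s < singular_values T k}"
proof -
  have fin: "finite {k. s < singular_values T k}"
    using singular_values_vanishing[OF T] s by (simp add: vanishing_def)
  have key: "card J \<le> card {k. s < singular_values T k}" if J: "finite J" "J \<subseteq> {i \<in> I. s < \<bar>c i\<bar>}" for J
  proof (cases "J = {}")
    case False
    define m where "m = Min ((\<lambda>i. \<bar>c i\<bar>) ` J)"
    have m: "s < m" "\<And>i. i \<in> J \<Longrightarrow> m \<le> \<bar>c i\<bar>" using J False by (auto simp: m_def)
    have "m \<le> singular_values T (card J - 1)"
    proof (rule singular_value_ge[OF T f J(1), of 0])
      show "f j \<noteq> 0" if "j \<in> J" for j using map that J(2) by blast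
      show "0 + (card J - 1) < card J" using J(1) False by (simp add: card_gt_0_iff)
      fix \<alpha> :: "nat \<Rightarrow> complex"
      let ?y = "\<Sum>j\<in>J. \<alpha> j *\<^sub>C f j"
      have "blinfun_apply T ?y = (\<Sum>j\<in>J. (\<alpha> j * c j) *\<^sub>C e j)"
        unfolding blinfun.sum_right
        by (intro sum.cong refl) (use map J(2) in
          \<open>auto simp: bounded_ops_scaleC[OF T(1)] scaleC_of_real[symmetric] scaleC_scaleC\<close>)
      hence "(norm (blinfun_apply T ?y))\<^sup>2 = (\<Sum>j\<in>J. if e j = 0 then 0 else (cmod (\<alpha> j * c j))\<^sup>2)"
        by (simp only: norm_sum_orthonormal[OF e J(1)])
      also have "\<dots> = (\<Sum>j\<in>J. (cmod (\<alpha> j))\<^sup>2 * \<bar>c j\<bar>\<^sup>2)"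
        by (intro sum.cong refl) (use map J(2) in \<open>auto simp: norm_mult power_mult_distrib\<close>)
      also have "\<dots> \<ge> (\<Sum>j\<in>J. (cmod (\<alpha> j))\<^sup>2 * m\<^sup>2)"
        using m s by (intro sum_mono mult_left_mono power_mono) auto
      also have "(\<Sum>j\<in>J. (cmod (\<alpha> j))\<^sup>2 * m\<^sup>2) = m\<^sup>2 * (\<Sum>j\<in>J. if f j = 0 then 0 else (cmod (\<alpha> j))\<^sup>2)"
        unfolding sum_distrib_left by (intro sum.cong refl) (use map J(2) in auto)
      also have "\<dots> = (m * norm ?y)\<^sup>2" by (simp add: norm_sum_orthonormal[OF f J(1)] power_mult_distrib)
      finally show "m * norm ?y \<le> norm (blinfun_apply T ?y)" by (rule power2_le_imp_le) simp
    qed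
    hence last: "s < singular_values T (card J - 1)" using m(1) by simp
    have "s < singular_values T k" if "k < card J" for k
    proof -
      have "k \<le> card J - 1" using that by simp
      hence "singular_values T (card J - 1) \<le> singular_values T k"
        using singular_values_decseq[OF T] by (simp add: decseq_def)
      thus ?thesis using last by simp
    qed
    hence "{..<card J} \<subseteq> {k. s < singular_values T k}" by auto
    from card_mono[OF fin this] show ?thesis by simp
  qed simp
  show fI: "finite {i \<in> I. s < \<bar>c i\<bar>}"
  proof (rule ccontr)
    assume "infinite {i \<in> I. s < \<bar>c i\<bar>}"
    then obtain J where "finite J" "card J = Suc (card {k. s < singular_values T k})" "J \<subseteq> {i \<in> I. s < \<bar>c i\<bar>}"
      using infinite_arbitrarily_large by blast
    thus False using key[of J] by simp
  qed
  show "card {i \<in> I. s < \<bar>c i\<bar>} \<le> card {k. s < singular_values T k}" using key[OF fI] by simp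
qed

text \<open>More independent vectors than conditions have a non-trivial combination that satisfies the
  conditions.\<close>

lemma orthogonal_vector_exists:
  fixes F :: "'a::complex_hilbert set"
  assumes inf: "infinite_dimensional TYPE('a)" and F: "finite F"
  shows "\<exists>z. norm z = 1 \<and> (\<forall>f\<in>F. cinner z f = 0)"
proof -
  have "\<exists>J. finite J \<and> card J = n \<and> \<not> complex_vector.dependent (J :: 'a set)" for n
  proof (induction n)
    case 0
    show ?case by (intro exI[of _ "{}"]) (simp add: complex_vector.dependent_explicit)
  next
    case (Suc n)
    then obtain J where J: "finite J" "card J = n" "\<not> complex_vector.dependent (J :: 'a set)" by blast
    hence "complex_vector.span J \<noteq> UNIV" using inf unfolding infinite_dimensional_def by blast
    then obtain z where z: "z \<notin> complex_vector.span J" by blast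
    hence "\<not> complex_vector.dependent (insert z J)" by (rule complex_vector.independent_insertI[OF _ J(3)])
    moreover have "z \<notin> J" using z complex_vector.span_base by blast
    ultimately show ?case using J by (intro exI[of _ "insert z J"]) auto
  qed
  then obtain J where J: "finite J" "card J = Suc (card F)" "\<not> complex_vector.dependent (J :: 'a set)" by blast
  obtain c where c: "\<exists>j\<in>J. c j \<noteq> 0" "\<forall>f\<in>F. (\<Sum>j\<in>J. cinner j f * c j) = 0"
    using homogeneous_system_solution[OF F J(1), of "\<lambda>f j. cinner j f"] J(2) by auto
  let ?y = "\<Sum>j\<in>J. c j *\<^sub>C j"
  have "?y \<noteq> 0"
  proof
    assume "?y = 0"
    hence "complex_vector.dependent J"
      using c(1) J(1) unfolding complex_vector.dependent_finite[OF J(1)] by blast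
    thus False using J(3) by blast
  qed
  moreover have "cinner ?y f = 0" if "f \<in> F" for f
    using c(2) that by (simp add: cinner_sum_left cinner_scaleC_left mult.commute)
  ultimately show ?thesis
    by (intro exI[of _ "(1 / norm ?y) *\<^sub>R ?y"]) (simp add: cinner_scaleR_left)
qed

text \<open>A Gram-Schmidt process in which the next vector is obtained by dimension count, as a solution of
  finitely many homogeneous equations.\<close>

lemma orthonormal_sequence_exists:
  fixes F :: "'a::complex_hilbert set"
  assumes inf: "infinite_dimensional TYPE('a)" and F: "finite F"
  shows "\<exists>z :: nat \<Rightarrow> 'a. partial_orthonormal z \<and> (\<forall>n. z n \<noteq> 0) \<and> (\<forall>n. \<forall>f\<in>F. cinner (z n) f = 0)"
proof -
  have "\<exists>S. \<forall>n. (case S n of (A, z) \<Rightarrow> finite A \<and> F \<subseteq> A \<and> norm z = 1 \<and> (\<forall>f\<in>A. cinner z f = 0)) \<and>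
      fst (S (Suc n)) = insert (snd (S n)) (fst (S n))"
  proof (rule dependent_nat_choice)
    show "\<exists>x. case x of (A, z) \<Rightarrow> finite A \<and> F \<subseteq> A \<and> norm z = 1 \<and> (\<forall>f\<in>A. cinner (z::'a) f = 0)"
      using orthogonal_vector_exists[OF inf F] F by auto
  next
    fix x :: "'a set \<times> 'a" and n :: nat
    assume x: "case x of (A, z) \<Rightarrow> finite A \<and> F \<subseteq> A \<and> norm z = 1 \<and> (\<forall>f\<in>A. cinner z f = 0)"
    obtain A z where [simp]: "x = (A, z)" by (cases x)
    have fin: "finite (insert z A)" using x by simp
    obtain y where "norm y = 1" "\<forall>f\<in>insert z A. cinner y f = 0"
      using orthogonal_vector_exists[OF inf fin] by blast
    thus "\<exists>y. (case y of (A, z) \<Rightarrow> finite A \<and> F \<subseteq> A \<and> norm z = 1 \<and> (\<forall>f\<in>A. cinner z f = 0)) \<and>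
        fst y = insert (snd x) (fst x)"
      using x by (intro exI[of _ "(insert z A, y)"]) auto
  qed
  then obtain S where "\<forall>n. (case S n of (A, z) \<Rightarrow> finite A \<and> F \<subseteq> A \<and> norm z = 1 \<and> (\<forall>f\<in>A. cinner (z::'a) f = 0)) \<and>
      fst (S (Suc n)) = insert (snd (S n)) (fst (S n))" by (rule exE)
  note S = this[rule_format, THEN conjunct1] this[rule_format, THEN conjunct2]
  have S': "F \<subseteq> fst (S n)" "norm (snd (S n)) = 1" "f \<in> fst (S n) \<Longrightarrow> cinner (snd (S n)) f = 0" for n f
    using S(1)[of n] by (auto split: prod.splits)
  have mem: "snd (S i) \<in> fst (S n)" if "i < n" for i n
    using that by (induction n) (auto simp: S(2) less_Suc_eq)
  have lt: "cinner (snd (S n)) (snd (S i)) = 0" if "i < n" for i n by (rule S'(3)[OF mem[OF that]])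
  have "cinner (snd (S i)) (snd (S j)) = 0" if "i \<noteq> j" for i j
    using lt[of i j] lt[of j i] that cinner_commute[of "snd (S i)" "snd (S j)"] by (cases "i < j") auto
  hence "partial_orthonormal (\<lambda>n. snd (S n))" using S'(2) by (simp add: partial_orthonormal_def)
  moreover have "snd (S n) \<noteq> 0" for n using S'(2)[of n] by auto
  ultimately show ?thesis using S'(1,3) by (intro exI[of _ "\<lambda>n. snd (S n)"]) blast
qed

text \<open>The elements are chosen one after the other; at every step only finitely many are already taken.\<close>

lemma injective_selection:
  fixes A :: "nat \<Rightarrow> 'b set"
  assumes "\<And>n. infinite (A n)"
  shows "\<exists>\<nu>. inj \<nu> \<and> (\<forall>n. \<nu> n \<in> A n)"
proof -
  have "\<exists>S. \<forall>n. (case S n of (B, z) \<Rightarrow> finite B \<and> z \<in> A n \<and> z \<notin> B) \<and> fst (S (Suc n)) = insert (snd (S n)) (fst (S n))"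
  proof (rule dependent_nat_choice)
    have "A 0 \<noteq> {}" using assms[of 0] by (metis finite.emptyI)
    then obtain z where "z \<in> A 0" by blast
    thus "\<exists>x. case x of (B, z) \<Rightarrow> finite B \<and> z \<in> A 0 \<and> z \<notin> B" by (intro exI[of _ "({}, z)"]) simp
  next
    fix x :: "'b set \<times> 'b" and n :: nat
    assume x: "case x of (B, z) \<Rightarrow> finite B \<and> z \<in> A n \<and> z \<notin> B"
    obtain B z where [simp]: "x = (B, z)" by (cases x)
    have fin: "finite (insert z B)" using x by simp
    hence "infinite (A (Suc n) - insert z B)" using assms[of "Suc n"] by (rule Diff_infinite_finite)
    hence "A (Suc n) - insert z B \<noteq> {}" by (metis finite.emptyI)
    then obtain y where "y \<in> A (Suc n) - insert z B" by blast
    thus "\<exists>y. (case y of (B, z) \<Rightarrow> finite B \<and> z \<in> A (Suc n) \<and> z \<notin> B) \<and> fst y = insert (snd x) (fst x)"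
      using fin by (intro exI[of _ "(insert z B, y)"]) auto
  qed
  then obtain S where "\<forall>n. (case S n of (B, z) \<Rightarrow> finite B \<and> z \<in> A n \<and> z \<notin> B) \<and>
      fst (S (Suc n)) = insert (snd (S n)) (fst (S n))" by (rule exE)
  note S = this[rule_format, THEN conjunct1] this[rule_format, THEN conjunct2]
  have S': "snd (S n) \<in> A n" "snd (S n) \<notin> fst (S n)" for n
    using S(1)[of n] by (auto split: prod.splits)
  have mem: "snd (S i) \<in> fst (S n)" if "i < n" for i n
    using that by (induction n) (auto simp: S(2) less_Suc_eq)
  have "inj (\<lambda>n. snd (S n))"
  proof (rule injI)
    fix i j assume eq: "snd (S i) = snd (S j)"
    show "i = j" using mem[of i j] mem[of j i] S'(2)[of i] S'(2)[of j] eq by (cases i j rule: linorder_cases) auto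
  qed
  thus ?thesis using S'(1) by (intro exI[of _ "\<lambda>n. snd (S n)"]) blast
qed

text \<open>Positions \<open>i\<close> with \<open>c i = 0\<close> carry no vector; they need one on which
  the operator is as small as prescribed by \<open>\<delta>\<close>. If only finitely many positions are occupied, the
  kernel provides such vectors. Otherwise a sparse set of eigenvectors with small eigenvalues is
  taken away from its own positions; \<open>Q\<close> disjoint choices of this sparse set are available, so that
  a given position is spoilt in at most one of them.\<close>

lemma completed_eigenvectors:
  fixes c :: "nat \<Rightarrow> real" and h :: "nat \<Rightarrow> 'a::complex_hilbert" and \<delta> :: "nat \<Rightarrow> real" and Q :: nat
  assumes inf: "infinite_dimensional TYPE('a)" and c: "compact_diagonal c h" and \<delta>: "\<And>i. 0 < \<delta> i"
  shows "\<exists>S e d. (\<forall>p<Q. partial_orthonormal (e p)) \<and>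
    (\<forall>p<Q. \<forall>r<Q. p \<noteq> r \<longrightarrow> S p \<inter> S r = {}) \<and>
    (\<forall>p<Q. \<forall>i. i \<notin> S p \<longrightarrow> e p i \<noteq> 0 \<and> \<bar>d p i - c i\<bar> \<le> \<delta> i \<and> blinfun_apply (diag c h) (e p i) = d p i *\<^sub>R e p i)"
proof -
  interpret compact_diagonal c h by fact
  show ?thesis
  proof (cases "finite {i. c i \<noteq> 0}")
    case True
    obtain z :: "nat \<Rightarrow> 'a" where z0: "partial_orthonormal z \<and> (\<forall>n. z n \<noteq> 0) \<and>
        (\<forall>n. \<forall>f\<in>h ` {i. c i \<noteq> 0}. cinner (z n) f = 0)"
      using orthonormal_sequence_exists[OF inf finite_imageI[OF True, of h]] by (rule exE)
    have z: "partial_orthonormal z" "z n \<noteq> 0" "c i \<noteq> 0 \<Longrightarrow> cinner (z n) (h i) = 0" for n i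
      using z0 by simp_all
    define e where "e i = (if c i \<noteq> 0 then h i else z i)" for i
    have z': "cinner (h i) (z n) = 0" if "c i \<noteq> 0" for n i
      using z(3)[OF that, of n] cinner_commute[of "h i" "z n"] by simp
    have po: "partial_orthonormal e"
      unfolding partial_orthonormal_def
    proof (intro conjI allI impI)
      show "cinner (e i) (e j) = 0" if "i \<noteq> j" for i j
        using that z(3) z' partial_orthonormal_cinner[OF h, of i j] partial_orthonormal_cinner[OF z(1), of i j]
        by (auto simp: e_def)
      show "e i = 0 \<or> norm (e i) = 1" for i
        using h z(1) by (auto simp: e_def partial_orthonormal_def)
    qed
    have "blinfun_apply (diag c h) (e i) = c i *\<^sub>R e i" for i
      using diag_apply_orthogonal[of "z i"] z(3) by (auto simp: e_def diag_apply_basis)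
    moreover have "e i \<noteq> 0" for i using z(2) supp by (auto simp: e_def)
    ultimately show ?thesis
      using po less_imp_le[OF \<delta>]
      by (intro exI[of _ "\<lambda>_. {}"] exI[of _ "\<lambda>_. e"] exI[of _ "\<lambda>_. c"]) simp
  next
    case False
    define A where "A n = {i. c i \<noteq> 0 \<and> \<bar>c i\<bar> \<le> \<delta> (snd (prod_decode n))}" for n
    have "infinite (A n)" for n
    proof -
      have "finite {i. \<delta> (snd (prod_decode n)) < \<bar>c i\<bar>}" using c \<delta> by (simp add: vanishing_def)
      hence "infinite ({i. c i \<noteq> 0} - {i. \<delta> (snd (prod_decode n)) < \<bar>c i\<bar>})" using False by (rule Diff_infinite_finite)
      moreover have "{i. c i \<noteq> 0} - {i. \<delta> (snd (prod_decode n)) < \<bar>c i\<bar>} = A n" by (auto simp: A_def)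
      ultimately show ?thesis by simp
    qed
    then obtain \<nu>' where \<nu>': "inj \<nu>'" "\<And>n. \<nu>' n \<in> A n" using injective_selection[of A] by blast
    define \<nu> where "\<nu> p i = \<nu>' (prod_encode (p, i))" for p i
    have \<nu>inj: "\<nu> p i = \<nu> r j \<longleftrightarrow> p = r \<and> i = j" for p i r j
      using \<nu>'(1) by (auto simp: \<nu>_def inj_eq)
    have \<nu>c: "c (\<nu> p i) \<noteq> 0 \<and> \<bar>c (\<nu> p i)\<bar> \<le> \<delta> i" for p i
      using \<nu>'(2)[of "prod_encode (p, i)"] by (auto simp: \<nu>_def A_def)
    define S where "S p = range (\<nu> p)" for p
    define \<mu> where "\<mu> p i = (if c i \<noteq> 0 then i else \<nu> p i)" for p i
    define e where "e p i = (if i \<notin> S p then h (\<mu> p i) else 0)" for p i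
    have \<mu>c: "c (\<mu> p i) \<noteq> 0" for p i using \<nu>c by (simp add: \<mu>_def)
    have "inj_on (\<mu> p) {i. i \<notin> S p}" for p
      by (auto simp: inj_on_def \<mu>_def S_def \<nu>inj split: if_splits)
    hence po: "partial_orthonormal (e p)" for p
      unfolding e_def by (intro partial_orthonormal_reindex[OF h])
    have "S p \<inter> S r = {}" if "p \<noteq> r" for p r using that by (auto simp: S_def \<nu>inj)
    moreover have "e p i \<noteq> 0 \<and> \<bar>c (\<mu> p i) - c i\<bar> \<le> \<delta> i \<and> blinfun_apply (diag c h) (e p i) = c (\<mu> p i) *\<^sub>R e p i"
      if "i \<notin> S p" for p i
      using that supp[OF \<mu>c] \<nu>c[of p i] less_imp_le[OF \<delta>[of i]] by (auto simp: e_def diag_apply_basis \<mu>_def)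
    ultimately show ?thesis
      using po by (intro exI[of _ S] exI[of _ e] exI[of _ "\<lambda>p i. c (\<mu> p i)"]) simp
  qed
qed

context signed_pair
begin

text \<open>Partial isometries that carry the completed eigenvectors of \<open>diag q g\<close> to those of \<open>diag t h\<close>
  realize almost all of \<open>w\<close> as singular values, except at the spoilt positions; averaging over the
  \<open>Q\<close> disjoint choices of these positions removes the exception.\<close>

lemma norm_w_le_if_deriv_bounded:
  assumes normed: "symmetric_norm E N" and inf: "infinite_dimensional TYPE('a)"
    and w: "symmetric_norm.inE E w"
    and L: "\<And>x. x \<in> bounded_ops \<Longrightarrow> norm x \<le> 1 \<Longrightarrow>
      symmetric_norm.inE E (singular_values (deriv_op x)) \<and> symmetric_norm.NN N (singular_values (deriv_op x)) \<le> L"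
  shows "symmetric_norm.NN N w \<le> L"
proof -
  interpret symmetric_norm E N by (rule normed)
  have L0: "0 \<le> L"
    using L[of 0] NN_nonneg by (fastforce simp: bounded_ops_zero)
  have main: "(real Q - 2) * (1 - 1 / real Q) * NN w \<le> real Q * L" if Q: "2 \<le> Q" for Q :: nat
  proof -
    \<comment> \<open>Both tolerances together cost at most the fraction \<open>1 / Q\<close> of \<open>w i\<close>; where \<open>w\<close> vanishes any
      positive tolerance will do.\<close>
    define \<delta> where "\<delta> i = (if w i = 0 then 1 else w i / (2 * real Q))" for i
    have \<delta>: "0 < \<delta> i" for i using w_nonneg[of i] Q by (simp add: \<delta>_def)
    have ct: "compact_diagonal t h" and cq: "compact_diagonal q g" by unfold_locales
    obtain A e d where e: "\<forall>p<Q. partial_orthonormal (e p)" "\<forall>p<Q. \<forall>r<Q. p \<noteq> r \<longrightarrow> A p \<inter> A r = {}"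
        "\<forall>p<Q. \<forall>i. i \<notin> A p \<longrightarrow> e p i \<noteq> 0 \<and> \<bar>d p i - t i\<bar> \<le> \<delta> i \<and> blinfun_apply (diag t h) (e p i) = d p i *\<^sub>R e p i"
      using completed_eigenvectors[where Q = Q and \<delta> = \<delta>, OF inf ct \<delta>] by (elim exE conjE) (rule that)
    obtain B f d' where f: "\<forall>p<Q. partial_orthonormal (f p)" "\<forall>p<Q. \<forall>r<Q. p \<noteq> r \<longrightarrow> B p \<inter> B r = {}"
        "\<forall>p<Q. \<forall>i. i \<notin> B p \<longrightarrow> f p i \<noteq> 0 \<and> \<bar>d' p i - q i\<bar> \<le> \<delta> i \<and> blinfun_apply (diag q g) (f p i) = d' p i *\<^sub>R f p i"
      using completed_eigenvectors[where Q = Q and \<delta> = \<delta>, OF inf cq \<delta>] by (elim exE conjE) (rule that)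
    define y where "y p i = (if i \<notin> A p \<and> i \<notin> B p then w i else 0)" for p i
    have yE: "inE (y p)" for p by (rule inE_mono[OF w]) (simp add: y_def)
    have y: "(1 - 1 / real Q) * NN (y p) \<le> L" if p: "p < Q" for p
    proof -
      interpret X: diagonal "\<lambda>_. 1" "f p" "e p" by unfold_locales (use e(1) f(1) p in auto)
      define x where "x = diagonal_op (\<lambda>_. 1) (f p) (e p)"
      have x: "x \<in> bounded_ops" unfolding x_def by (rule X.bounded_op)
      have nx: "norm x \<le> 1"
      proof (rule norm_blinfun_bound)
        show "norm (blinfun_apply x z) \<le> 1 * norm z" for z
          unfolding x_def by (rule X.norm_apply_le) auto
      qed simp
      have map: "blinfun_apply (deriv_op x) (f p i) = (d p i + d' p i) *\<^sub>R e p i \<and> f p i \<noteq> 0 \<and> e p i \<noteq> 0"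
        if i: "i \<in> - (A p \<union> B p)" for i
      proof -
        have fi: "f p i \<noteq> 0" "blinfun_apply (diag q g) (f p i) = d' p i *\<^sub>R f p i" using f(3) p i by auto
        have ei: "e p i \<noteq> 0" "blinfun_apply (diag t h) (e p i) = d p i *\<^sub>R e p i" using e(3) p i by auto
        have "blinfun_apply x (f p i) = e p i" unfolding x_def X.apply_basis using fi(1) by simp
        thus ?thesis using fi ei
          by (simp add: deriv_op_def plus_blinfun.rep_eq blinfun.scaleR_right scaleR_add_left)
      qed
      have big: "(1 - 1 / real Q) * w i \<le> \<bar>d p i + d' p i\<bar>" if i: "i \<in> - (A p \<union> B p)" for i
      proof (cases "w i = 0")
        case False
        have "\<bar>d p i - t i\<bar> \<le> \<delta> i" "\<bar>d' p i - q i\<bar> \<le> \<delta> i" using e(3) f(3) p i by auto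
        moreover have "\<bar>t i + q i\<bar> = w i" using sign[of i] by (cases "even i") (auto simp: w_def)
        ultimately have "w i - 2 * \<delta> i \<le> \<bar>d p i + d' p i\<bar>" by linarith
        moreover have "w i - 2 * \<delta> i = (1 - 1 / real Q) * w i"
          using False Q by (simp add: \<delta>_def field_simps)
        ultimately show ?thesis by simp
      qed simp
      have sE: "inE (singular_values (deriv_op x))" "NN (singular_values (deriv_op x)) \<le> L"
        using L[OF x nx] by auto
      have s0: "\<bar>singular_values (deriv_op x) k\<bar> = singular_values (deriv_op x) k" for k
        using singular_values_vanishing[OF bounded_op_deriv[OF x] compact_op_deriv] by (simp add: vanishing_def)
      have Qf: "0 \<le> 1 - 1 / real Q" using Q by simp
      have "NN (\<lambda>i. (1 - 1 / real Q) * y p i) \<le> NN (singular_values (deriv_op x))"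
      proof (rule NN_card[OF sE(1)])
        show "vanishing (\<lambda>n. \<bar>(1 - 1 / real Q) * y p n\<bar>)" by (intro inE_vanishing inE_scale yE)
        fix s :: real assume s: "0 < s"
        have I: "i \<in> - (A p \<union> B p) \<and> s < \<bar>d p i + d' p i\<bar>" if "s < \<bar>(1 - 1 / real Q) * y p i\<bar>" for i
        proof -
          have i: "i \<in> - (A p \<union> B p)" using that s by (auto simp: y_def split: if_splits)
          hence "s < (1 - 1 / real Q) * w i" using that Qf w_nonneg[of i] by (simp add: y_def abs_mult)
          thus ?thesis using big[OF i] i by simp
        qed
        note T = bounded_op_deriv[OF x] compact_op_deriv
        have "card {n. s < \<bar>(1 - 1 / real Q) * y p n\<bar>} \<le> card {i \<in> - (A p \<union> B p). s < \<bar>d p i + d' p i\<bar>}"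
          using I by (intro card_mono card_singular_values_ge(1)[OF T _ _ map s]) (use e(1) f(1) p in auto)
        also have "\<dots> \<le> card {k. s < singular_values (deriv_op x) k}"
          by (rule card_singular_values_ge(2)[OF T _ _ map s]) (use e(1) f(1) p in auto)
        finally show "card {n. s < \<bar>(1 - 1 / real Q) * y p n\<bar>} \<le> card {n. s < \<bar>singular_values (deriv_op x) n\<bar>}"
          by (simp only: s0)
      qed
      thus ?thesis using sE(2) Qf NN_scale[OF yE, of "1 - 1 / real Q" p] by simp
    qed
    have once: "card {p. p < Q \<and> i \<in> C p} \<le> 1" if "\<forall>p<Q. \<forall>r<Q. p \<noteq> r \<longrightarrow> C p \<inter> C r = {}" for C :: "nat \<Rightarrow> nat set" and i
    proof -
      have "p = r" if "p \<in> {p. p < Q \<and> i \<in> C p}" "r \<in> {p. p < Q \<and> i \<in> C p}" for p r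
        using that \<open>\<forall>p<Q. \<forall>r<Q. p \<noteq> r \<longrightarrow> C p \<inter> C r = {}\<close> by blast
      hence "is_singleton {p. p < Q \<and> i \<in> C p} \<or> {p. p < Q \<and> i \<in> C p} = {}"
        unfolding is_singleton_def by blast
      thus ?thesis by (elim disjE) (simp add: is_singleton_altdef, simp only: card.empty)
    qed
    have cover: "(real Q - 2) * w i \<le> (\<Sum>p<Q. y p i)" for i
    proof -
      have ind: "(\<Sum>p<Q. if i \<in> C p then w i else 0) = real (card {p. p < Q \<and> i \<in> C p}) * w i" for C :: "nat \<Rightarrow> nat set"
      proof -
        have "(\<Sum>p<Q. if i \<in> C p then w i else 0) = (\<Sum>p\<in>{p. p < Q \<and> i \<in> C p}. w i)"
          by (intro sum.mono_neutral_cong_right) auto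
        thus ?thesis by simp
      qed
      have c1: "real (card {p. p < Q \<and> i \<in> A p}) * w i \<le> 1 * w i" "real (card {p. p < Q \<and> i \<in> B p}) * w i \<le> 1 * w i"
        using once[OF e(2), of i] once[OF f(2), of i] w_nonneg[of i] by (intro mult_right_mono; simp)+
      have "(\<Sum>p<Q. w i - (if i \<in> A p then w i else 0) - (if i \<in> B p then w i else 0)) \<le> (\<Sum>p<Q. y p i)"
        by (intro sum_mono) (auto simp: y_def w_nonneg)
      moreover have "(\<Sum>p<Q. w i - (if i \<in> A p then w i else 0) - (if i \<in> B p then w i else 0))
          = real Q * w i - real (card {p. p < Q \<and> i \<in> A p}) * w i - real (card {p. p < Q \<and> i \<in> B p}) * w i"
        unfolding sum_subtractf ind by simp
      ultimately show ?thesis using c1 by (simp add: algebra_simps)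
    qed
    have Q2: "0 \<le> real Q - 2" and Q1: "0 \<le> 1 - 1 / real Q" using Q by auto
    have "(real Q - 2) * NN w = NN (\<lambda>i. (real Q - 2) * w i)" using Q2 by (simp add: NN_scale[OF w])
    also have "\<dots> \<le> NN (\<lambda>i. \<Sum>p<Q. y p i)"
    proof (rule NN_mono)
      show "inE (\<lambda>i. \<Sum>p<Q. y p i)" by (rule inE_sum) (auto simp: yE)
      show "\<bar>(real Q - 2) * w i\<bar> \<le> \<bar>\<Sum>p<Q. y p i\<bar>" for i
        using cover[of i] Q2 w_nonneg[of i] by (simp add: abs_mult)
    qed
    also have "\<dots> \<le> (\<Sum>p<Q. NN (y p))" by (rule NN_sum) (auto simp: yE)
    finally have "(1 - 1 / real Q) * ((real Q - 2) * NN w) \<le> (1 - 1 / real Q) * (\<Sum>p<Q. NN (y p))"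
      using Q1 by (rule mult_left_mono)
    also have "\<dots> = (\<Sum>p<Q. (1 - 1 / real Q) * NN (y p))" by (rule sum_distrib_left)
    also have "\<dots> \<le> (\<Sum>p<Q. L)" by (intro sum_mono y) simp
    finally show ?thesis by (simp add: mult_ac)
  qed
  show ?thesis
  proof (rule LIMSEQ_le_const2)
    have inv: "(\<lambda>n. 1 / real (Suc n)) \<longlonglongrightarrow> 0"
      using LIMSEQ_inverse_real_of_nat by (simp add: inverse_eq_divide)
    have "(\<lambda>n. (1 - 2 * (1 / real (Suc n))) * (1 - 1 / real (Suc n)) * NN w)
        \<longlonglongrightarrow> (1 - 2 * 0) * (1 - 0) * NN w"
      by (rule tendsto_mult[OF tendsto_mult[OF tendsto_diff[OF tendsto_const tendsto_mult[OF tendsto_const inv]]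
            tendsto_diff[OF tendsto_const inv]] tendsto_const])
    thus "(\<lambda>n. (1 - 2 * (1 / real (Suc n))) * (1 - 1 / real (Suc n)) * NN w) \<longlonglongrightarrow> NN w" by simp
    have "(1 - 2 * (1 / real (Suc n))) * (1 - 1 / real (Suc n)) * NN w \<le> L" if "1 \<le> n" for n
    proof -
      have "(real (Suc n) - 2) * (1 - 1 / real (Suc n)) * NN w \<le> real (Suc n) * L" using main[of "Suc n"] that by simp
      hence "(real (Suc n) - 2) * (1 - 1 / real (Suc n)) * NN w / real (Suc n) \<le> L"
        by (simp add: divide_le_eq mult.commute)
      moreover have "(real (Suc n) - 2) * z / real (Suc n) = (1 - 2 * (1 / real (Suc n))) * z" for z
        by (simp add: field_simps)
      ultimately show ?thesis by (simp only: mult.assoc)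
    qed
    thus "\<exists>K. \<forall>n\<ge>K. (1 - 2 * (1 / real (Suc n))) * (1 - 1 / real (Suc n)) * NN w \<le> L" by blast
  qed
qed

lemma deriv_op_norm_le:
  assumes normed: "symmetric_norm E N" and w: "symmetric_norm.inE E w"
    and x: "x \<in> bounded_ops" "norm x \<le> 1"
  shows "symmetric_norm.inE E (singular_values (deriv_op x)) \<and>
    symmetric_norm.NN N (singular_values (deriv_op x)) \<le> symmetric_norm.NN N w"
proof -
  interpret symmetric_norm E N by (rule normed)
  have w_abs: "(\<lambda>n. \<bar>w n\<bar>) = w" using w_nonneg by auto
  have wE: "inE (rearr w)" and Nw: "NN (rearr w) = NN w"
    using inE_rearr[of w] NN_rearr[of w] w vanishing_w unfolding w_abs by auto
  note T = bounded_op_deriv[OF x(1)] compact_op_deriv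
  have s0: "0 \<le> singular_values (deriv_op x) n" for n
    using singular_values_vanishing[OF T] by (simp add: vanishing_def)
  show ?thesis
    using uniform_majorization[OF singular_values_decseq[OF T] s0 rearr_decseq[OF vanishing_w]
        rearr_nonneg[OF vanishing_w] wE deriv_op_majorization[OF x]] Nw by simp
qed

text \<open>A general \<open>x\<close> is a multiple of a contraction.\<close>

lemma deriv_op_in_ideal:
  assumes normed: "symmetric_norm E N" and w: "symmetric_norm.inE E w" and x: "x \<in> bounded_ops"
  shows "deriv_op x \<in> op_ideal E"
proof -
  interpret symmetric_norm E N by (rule normed)
  define r where "r = norm x + 1"
  have r: "0 < r" using norm_ge_zero[of x] unfolding r_def by linarith
  define x' where "x' = (1 / r) *\<^sub>R x"
  have x': "x' \<in> bounded_ops" "norm x' \<le> 1"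
    using x r by (auto simp: x'_def bounded_ops_scaleR r_def)
  have "x = r *\<^sub>R x'" using r by (simp add: x'_def)
  hence dx: "deriv_op x = r *\<^sub>R deriv_op x'"
    by (intro blinfun_eqI)
      (simp add: deriv_op_def plus_blinfun.rep_eq scaleR_blinfun.rep_eq blinfun.scaleR_right scaleR_add_right)
  note T = bounded_op_deriv[OF x] compact_op_deriv
  have "inE (singular_values (deriv_op x))"
  proof (rule inE_mono)
    show "inE (\<lambda>n. r * singular_values (deriv_op x') n)"
      using deriv_op_norm_le[OF normed w x'] by (intro inE_scale) blast
    fix n
    have "0 \<le> singular_values (deriv_op x) n"
      using singular_values_vanishing[OF T] by (simp add: vanishing_def)
    thus "\<bar>singular_values (deriv_op x) n\<bar> \<le> \<bar>r * singular_values (deriv_op x') n\<bar>"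
      using singular_values_scaleR_le[OF bounded_op_deriv[OF x'(1)] compact_op_deriv r, of n] by (simp add: dx)
  qed
  thus ?thesis using T by (simp add: op_ideal_def inE_def)
qed

lemma deriv_op_norm:
  assumes normed: "symmetric_norm E N" and inf: "infinite_dimensional TYPE('a)" and w: "symmetric_norm.inE E w"
  shows "(SUP x\<in>{x \<in> bounded_ops. norm x \<le> 1}. ereal (op_ideal_norm N (deriv_op x)))
    = ereal (symmetric_norm.NN N w)" (is "?S = _")
proof -
  interpret symmetric_norm E N by (rule normed)
  have NN: "op_ideal_norm N T = NN (singular_values T)" for T :: "'a \<Rightarrow>\<^sub>L 'a"
    by (simp add: op_ideal_norm_def NN_def)
  note upper = deriv_op_norm_le[OF normed w]
  have le: "?S \<le> ereal (NN w)"
    unfolding NN by (rule SUP_least) (use upper in auto)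
  have ge: "ereal (NN (singular_values (deriv_op x))) \<le> ?S" if "x \<in> bounded_ops" "norm x \<le> 1" for x
    unfolding NN by (rule SUP_upper) (use that in auto)
  \<comment> \<open>The supremum is finite, so that it can serve as a real bound.\<close>
  have "ereal (NN (singular_values (deriv_op 0))) \<le> ?S" by (rule ge) (simp_all add: bounded_ops_zero)
  with le obtain L where L: "?S = ereal L" by (cases ?S) auto
  have "NN w \<le> L"
  proof (rule norm_w_le_if_deriv_bounded[OF normed inf w])
    fix x :: "'a \<Rightarrow>\<^sub>L 'a" assume x: "x \<in> bounded_ops" "norm x \<le> 1"
    show "inE (singular_values (deriv_op x)) \<and> NN (singular_values (deriv_op x)) \<le> L"
      using upper[OF x] ge[OF x] unfolding L by simp
  qed
  thus ?thesis using L le by simp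
qed

end

section \<open>The norm of the generalized derivation\<close>

text \<open>Passing from \<open>b\<close> to \<open>- b\<close> exchanges its positive and negative parts, hence the even and the
  odd positions; this is why \<open>\<mu>(b\<^sub>-)\<close> is paired with \<open>\<mu>(a\<^sub>+)\<close>.\<close>

lemma signed_pair_exists:
  fixes a b :: "'a::complex_hilbert \<Rightarrow>\<^sub>L 'a"
  assumes a: "a \<in> bounded_ops" "compact_op a" "selfadjoint_op a"
    and b: "b \<in> bounded_ops" "compact_op b" "selfadjoint_op b"
  defines "t \<equiv> interleave (singular_values (pos_op a)) (\<lambda>k. - singular_values (neg_op a) k)"
    and "q \<equiv> interleave (singular_values (neg_op b)) (\<lambda>k. - singular_values (pos_op b) k)"
  obtains h g where "signed_pair t q h g" "a = diag t h" "b = - diag q g"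
    "seq_oplus (\<lambda>n. singular_values (pos_op a) n + singular_values (neg_op b) n)
      (\<lambda>n. singular_values (pos_op b) n + singular_values (neg_op a) n)
      = (\<lambda>n. complex_of_real (\<bar>t n\<bar> + \<bar>q n\<bar>))"
proof -
  define t' where "t' = interleave (singular_values (pos_op b)) (\<lambda>k. - singular_values (neg_op b) k)"
  obtain h where h: "compact_diagonal t h" "a = diag t h"
      "\<And>k. 0 \<le> singular_values (pos_op a) k" "decseq (singular_values (pos_op a))"
      "\<And>k. 0 \<le> singular_values (neg_op a) k" "decseq (singular_values (neg_op a))"
    by (rule signed_spectral_representation[OF a, folded t_def]; blast)
  obtain g' where g': "compact_diagonal t' g'" "b = diag t' g'"
      "\<And>k. 0 \<le> singular_values (pos_op b) k" "decseq (singular_values (pos_op b))"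
      "\<And>k. 0 \<le> singular_values (neg_op b) k" "decseq (singular_values (neg_op b))"
    by (rule signed_spectral_representation[OF b, folded t'_def]; blast)
  define flip where "flip n = (if even n then Suc n else n - 1)" for n :: nat
  have flip_flip: "flip (flip n) = n" for n by (auto simp: flip_def)
  have qt': "- t' (flip n) = q n" for n
    by (auto simp: q_def t'_def flip_def interleave_def elim!: oddE)
  have neg: "compact_diagonal (\<lambda>n. - t' n) g'"
    by (rule compact_diagonal_modify[OF g'(1)]) simp
  have flip_inj: "inj_on flip X" for X by (metis flip_flip inj_onI)
  have surj: "\<exists>n. q n \<noteq> 0 \<and> flip n = i" if "- t' i \<noteq> 0" for i
    using that qt'[of "flip i"] by (intro exI[of _ "flip i"]) (simp add: flip_flip)
  obtain g where g: "compact_diagonal q g" "diag (\<lambda>n. - t' n) g' = diag q g"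
    using diag_reindex(1,2)[OF neg flip_inj qt' surj] by blast
  have bq: "b = - diag q g" using g'(2) g(2) diag_minus[OF g'(1)] by (metis minus_minus)
  have sp: "signed_pair t q h g"
  proof (intro signed_pair.intro signed_pair_axioms.intro h(1) g(1))
    show "even n \<Longrightarrow> 0 \<le> t n \<and> 0 \<le> q n" "odd n \<Longrightarrow> t n \<le> 0 \<and> q n \<le> 0" for n
      using h(3,5) g'(3,5) by (auto simp: t_def q_def interleave_def)
    show "\<bar>t (Suc (Suc n))\<bar> \<le> \<bar>t n\<bar>" "\<bar>q (Suc (Suc n))\<bar> \<le> \<bar>q n\<bar>" for n
      using h(3-6) g'(3-6) by (auto simp: t_def q_def interleave_def decseq_Suc_iff)
    show "compact_op (diag t h)" using a(2) h(2) by simp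
    show "compact_op (diag q g)" using compact_op_scaleR[OF b(2), of "-1"] bq by simp
  qed
  have "seq_oplus (\<lambda>n. singular_values (pos_op a) n + singular_values (neg_op b) n)
      (\<lambda>n. singular_values (pos_op b) n + singular_values (neg_op a) n)
      = (\<lambda>n. complex_of_real (\<bar>t n\<bar> + \<bar>q n\<bar>))"
    using h(3,5) g'(3,5)
    by (auto simp: seq_oplus_def sum_decode_def t_def q_def interleave_def)
  with sp h(2) bq show ?thesis by (rule that)
qed

theorem theorem1p1:
  fixes E :: "(nat \<Rightarrow> complex) set"
    and N :: "(nat \<Rightarrow> complex) \<Rightarrow> real"
    and a b :: "'a::complex_hilbert \<Rightarrow>\<^sub>L 'a"
  assumes "infinite_dimensional TYPE('a)"
    and "symmetrically_normed E N"
    and "a \<in> op_ideal E" and "selfadjoint_op a"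
    and "b \<in> op_ideal E" and "selfadjoint_op b"
  shows "(\<forall>x\<in>bounded_ops. gen_derivation a b x \<in> op_ideal E) \<and>
    seq_oplus (\<lambda>n. singular_values (pos_op a) n + singular_values (neg_op b) n)
              (\<lambda>n. singular_values (pos_op b) n + singular_values (neg_op a) n) \<in> E \<and>
    gen_derivation_norm N a b = ereal (N (seq_oplus
      (\<lambda>n. singular_values (pos_op a) n + singular_values (neg_op b) n)
      (\<lambda>n. singular_values (pos_op b) n + singular_values (neg_op a) n)))"
proof -
  have normed: "symmetric_norm E N" by (rule symmetric_norm.intro) (rule assms(2))
  have a: "a \<in> bounded_ops" "compact_op a" and b: "b \<in> bounded_ops" "compact_op b"
    and sE: "symmetric_norm.inE E (singular_values a)" "symmetric_norm.inE E (singular_values b)"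
    using assms(3,5) by (auto simp: op_ideal_def symmetric_norm.inE_def[OF normed])
  let ?oplus = "seq_oplus (\<lambda>n. singular_values (pos_op a) n + singular_values (neg_op b) n)
      (\<lambda>n. singular_values (pos_op b) n + singular_values (neg_op a) n)"
  define t where "t = interleave (singular_values (pos_op a)) (\<lambda>k. - singular_values (neg_op a) k)"
  define q where "q = interleave (singular_values (neg_op b)) (\<lambda>k. - singular_values (pos_op b) k)"
  obtain h g where sp: "signed_pair t q h g"
      and at: "a = diag t h" and bq: "b = - diag q g"
      and oplus: "?oplus = (\<lambda>n. complex_of_real (\<bar>t n\<bar> + \<bar>q n\<bar>))"
    by (rule signed_pair_exists[OF a assms(4) b assms(6), folded t_def q_def]; blast)
  have ct: "compact_diagonal t h" and cq: "compact_diagonal q g"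
    using sp by (simp_all add: signed_pair_def)
  have cq': "compact_diagonal (\<lambda>n. - q n) g" by (rule compact_diagonal_modify[OF cq]) simp
  have sa: "singular_values a = rearr (\<lambda>n. \<bar>t n\<bar>)" and sb: "singular_values b = rearr (\<lambda>n. \<bar>q n\<bar>)"
    unfolding at bq diag_minus[OF cq, symmetric] singular_values_diag[OF ct] singular_values_diag[OF cq']
    by simp_all
  have tE: "symmetric_norm.inE E t" and qE: "symmetric_norm.inE E q"
    using sE symmetric_norm.inE_rearr[OF normed compact_diagonal.c[OF ct]]
      symmetric_norm.inE_rearr[OF normed compact_diagonal.c[OF cq]] by (simp_all add: sa sb)
  have w: "signed_pair.w t q = (\<lambda>n. \<bar>t n\<bar> + \<bar>q n\<bar>)"
    by (intro ext) (rule signed_pair.w_def[OF sp])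
  have wE: "symmetric_norm.inE E (signed_pair.w t q)"
  proof (rule symmetric_norm.inE_mono[OF normed symmetric_norm.inE_add[OF normed tE qE]])
    show "\<bar>signed_pair.w t q n\<bar> \<le> \<bar>t n + q n\<bar>" for n
      using signed_pair.sign[OF sp, of n] by (cases "even n") (auto simp: w)
  qed
  have deriv: "gen_derivation a b x = signed_pair.deriv_op t q h g x" for x
    by (rule blinfun_eqI)
      (simp add: gen_derivation_def signed_pair.deriv_op_def[OF sp] minus_blinfun.rep_eq plus_blinfun.rep_eq
        uminus_blinfun.rep_eq at bq blinfun.minus_right)
  have "?oplus \<in> E" and "N ?oplus = symmetric_norm.NN N (signed_pair.w t q)"
    using wE by (simp_all add: oplus w symmetric_norm.inE_def[OF normed] symmetric_norm.NN_def[OF normed])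
  thus ?thesis
    using signed_pair.deriv_op_in_ideal[OF sp normed wE] signed_pair.deriv_op_norm[OF sp normed assms(1) wE]
    by (simp add: deriv gen_derivation_norm_def)
qed

end
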